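(* Let $n\ge2$, $m\ge1$, and let $\Omega\subset\mathbb{C}^n$ be a bounded $m$-convex domain with Dini-smooth boundary. Then for any $\alpha>3m^2-2m$ there exists a constant $\tilde C>0$ such that for all $x,y\in\Omega$, every Kobayashi geodesic $[x,y]\subset\Omega$ joining $x$ and $y$, and every $w\in[x,y]$, $$\delta_\Omega(w)\ge\tilde C\,\bigl(\min\{l_d([x,w]),\,l_d([w,y])\}\bigr)^{\alpha},$$ where $[x,w]$ and $[w,y]$ denote the subcurves of $[x,y]$ from $x$ to $w$ and from $w$ to $y$.
   Context: Notation: $|\cdot|$ is the Euclidean norm on $\mathbb{C}^n$ and $l_d$ denotes Euclidean length of curves. For an open set $\Omega\subsetneq\mathbb{C}^n$, $\delta_\Omega(z)$ is the Euclidean distance from $z\in\Omega$ to $\partial\Omega$, and for $v\in\mathbb{C}^n\setminus\{0\}$, $\delta_\Omega(z;v)=\inf\{|z-\xi|:\xi\in\partial\Omega\cap(z+\mathbb{C}v)\}$. $m$-convex: a bounded convex domain $\Omega\subset\mathbb{C}^n$ ($n\ge2$) is $m$-convex ($m\ge1$) if there exists $C>0$ such that $\delta_\Omega(z;v)\le C\,\delta_\Omega(z)^{1/m}$ for all $z\in\Omega$ and all $v\in\mathbb{C}^n\setminus\{0\}$. Dini-smooth boundary: $\partial\Omega$ is $C^1$-smooth and each $p\in\partial\Omega$ has a neighborhood $U$ such that $\int_0^1\frac{\omega(t)}{t}\,dt<\infty$, where $\omega(t)=\sup\{|\mathbf{n}_x-\mathbf{n}_y|:|x-y|<t,\ x,y\in\partial\Omega\cap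 U\}$ and $\mathbf{n}$ is the inner unit normal to $\partial\Omega$. Kobayashi metric: $k_\Omega(x;v)=\inf\{|\xi|: f:\mathbb{D}\to\Omega \text{ holomorphic},\ f(0)=x,\ d(f)_0(\xi)=v\}$, and the Kobayashi distance $K_\Omega(x,y)$ is the infimum of $\int_a^b k_\Omega(\sigma(t);\sigma'(t))\,dt$ over absolutely continuous curves $\sigma:[a,b]\to\Omega$ joining $x$ to $y$. A Kobayashi geodesic is a map $\sigma:I\to\Omega$ ($I\subset\mathbb{R}$ an interval) with $K_\Omega(\sigma(s),\sigma(t))=|t-s|$ for all $s,t\in I$. *)

theory Defs
  imports "HOL-Complex_Analysis.Complex_Analysis"
begin

text \<open>
  Complex n-space is \<^typ>\<open>complex ^ 'n\<close>: its norm is the Euclidean norm, \<open>\<bullet>\<close> is the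
  underlying real inner product, and \<open>*s\<close> is multiplication by complex scalars.
\<close>

definition bdist :: "(complex ^ 'n) set \<Rightarrow> complex ^ 'n \<Rightarrow> real" where
  "bdist \<Omega> z = infdist z (frontier \<Omega>)"

definition bdist_dir :: "(complex ^ 'n) set \<Rightarrow> complex ^ 'n \<Rightarrow> complex ^ 'n \<Rightarrow> real" where
  "bdist_dir \<Omega> z v = infdist z (frontier \<Omega> \<inter> range (\<lambda>\<zeta>. z + \<zeta> *s v))"

text \<open>The sets over which the two infima range are nonempty for bounded \<open>\<Omega>\<close>, \<open>z \<in> \<Omega>\<close> and
  \<open>v \<noteq> 0\<close>, so the convention \<open>infdist z {} = 0\<close> plays no role below.\<close>

definition m_convex :: "real \<Rightarrow> (complex ^ 'n) set \<Rightarrow> bool" where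
  "m_convex m \<Omega> \<longleftrightarrow>
     open \<Omega> \<and> \<Omega> \<noteq> {} \<and> bounded \<Omega> \<and> convex \<Omega> \<and>
     (\<exists>C>0. \<forall>z\<in>\<Omega>. \<forall>v. v \<noteq> 0 \<longrightarrow> bdist_dir \<Omega> z v \<le> C * bdist \<Omega> z powr (1 / m))"

definition C1_defining_function ::
    "'a::euclidean_space set \<Rightarrow> 'a set \<Rightarrow> ('a \<Rightarrow> real) \<Rightarrow> ('a \<Rightarrow> 'a) \<Rightarrow> bool" where
  "C1_defining_function \<Omega> U r g \<longleftrightarrow>
     open U \<and> (\<forall>x\<in>U. GDERIV r x :> g x) \<and> continuous_on U g \<and> (\<forall>x\<in>U. g x \<noteq> 0) \<and>
     \<Omega> \<inter> U = {x \<in> U. r x < 0} \<and> frontier \<Omega> \<inter> U = {x \<in> U. r x = 0}"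

definition C1_boundary :: "'a::euclidean_space set \<Rightarrow> bool" where
  "C1_boundary \<Omega> \<longleftrightarrow> (\<forall>p\<in>frontier \<Omega>. \<exists>U r g. p \<in> U \<and> C1_defining_function \<Omega> U r g)"

definition is_inner_unit_normal :: "'a::euclidean_space set \<Rightarrow> 'a \<Rightarrow> 'a \<Rightarrow> bool" where
  "is_inner_unit_normal \<Omega> x \<nu> \<longleftrightarrow>
     x \<in> frontier \<Omega> \<and> (\<exists>U r g. x \<in> U \<and> C1_defining_function \<Omega> U r g \<and> \<nu> = - sgn (g x))"

definition inner_unit_normal :: "'a::euclidean_space set \<Rightarrow> 'a \<Rightarrow> 'a" where
  "inner_unit_normal \<Omega> x = (THE \<nu>. is_inner_unit_normal \<Omega> x \<nu>)"

lemma GDERIV_along_line: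
  fixes r :: "'a::euclidean_space \<Rightarrow> real"
  assumes "GDERIV r x :> d"
  shows "((\<lambda>t. r (x + t *\<^sub>R h)) has_real_derivative (d \<bullet> h)) (at 0)"
proof -
  have 1: "((\<lambda>t::real. x + t *\<^sub>R h) has_derivative (\<lambda>t. t *\<^sub>R h)) (at 0)"
    by (auto intro!: derivative_eq_intros)
  have "(r has_derivative (\<lambda>k. k \<bullet> d)) (at (x + 0 *\<^sub>R h))"
    using assms by (simp add: gderiv_def)
  from has_derivative_compose[OF 1 this]
  show ?thesis
    by (simp add: has_field_derivative_def inner_commute mult.commute[of "d \<bullet> h"]
        mult_commute_abs)
qed

lemma C1_defining_function_normal_unique:
  fixes \<Omega> :: "'a::euclidean_space set"
  assumes x: "x \<in> frontier \<Omega>" "x \<in> U1" "x \<in> U2"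
    and 1: "C1_defining_function \<Omega> U1 r1 g1"
    and 2: "C1_defining_function \<Omega> U2 r2 g2"
  shows "sgn (g1 x) = sgn (g2 x)"
proof (rule ccontr)
  assume ne: "sgn (g1 x) \<noteq> sgn (g2 x)"
  define u v where "u = sgn (g1 x)" and "v = sgn (g2 x)"
  have g: "g1 x \<noteq> 0" "g2 x \<noteq> 0"
    using x 1 2 by (auto simp: C1_defining_function_def)
  have uv: "u \<bullet> u = 1" "v \<bullet> v = 1"
    using g by (auto simp: u_def v_def norm_sgn simp flip: power2_norm_eq_inner)
  have g_eq: "g1 x = norm (g1 x) *\<^sub>R u" "g2 x = norm (g2 x) *\<^sub>R v"
    using g by (auto simp: u_def v_def sgn_div_norm)
  have "(u - v) \<bullet> (u - v) > 0"
    using ne by (simp add: u_def v_def)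
  then have lt: "u \<bullet> v < 1"
    using uv by (simp add: inner_diff_left inner_diff_right inner_commute)
  define h where "h = v - u"
  have h1: "g1 x \<bullet> h < 0"
    by (subst g_eq) (use g uv lt in \<open>simp add: h_def inner_diff_right mult_pos_neg\<close>)
  have h2: "g2 x \<bullet> h > 0"
    by (subst g_eq) (use g uv lt in \<open>simp add: h_def inner_diff_right inner_commute\<close>)
  have r0: "r1 x = 0" "r2 x = 0"
    using x 1 2 by (auto simp: C1_defining_function_def)
  have d1: "((\<lambda>t. r1 (x + t *\<^sub>R h)) has_real_derivative (g1 x \<bullet> h)) (at 0)"
    and d2: "((\<lambda>t. r2 (x + t *\<^sub>R h)) has_real_derivative (g2 x \<bullet> h)) (at 0)"
    using x 1 2 by (auto simp: C1_defining_function_def intro!: GDERIV_along_line)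
  obtain e1 where e1: "e1 > 0" "\<And>t. 0 < t \<Longrightarrow> t < e1 \<Longrightarrow> r1 (x + t *\<^sub>R h) < 0"
    using DERIV_neg_dec_right[OF d1 h1] r0 by auto
  obtain e2 where e2: "e2 > 0" "\<And>t. 0 < t \<Longrightarrow> t < e2 \<Longrightarrow> r2 (x + t *\<^sub>R h) > 0"
    using DERIV_pos_inc_right[OF d2 h2] r0 by auto
  have "open (U1 \<inter> U2)"
    using 1 2 by (auto simp: C1_defining_function_def)
  moreover have "((\<lambda>t::real. x + t *\<^sub>R h) \<longlongrightarrow> x + 0 *\<^sub>R h) (at_right 0)"
    by (intro tendsto_intros)
  ultimately have "\<forall>\<^sub>F t in at_right 0. x + t *\<^sub>R h \<in> U1 \<inter> U2"
    using x topological_tendstoD by fastforce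
  moreover have "\<forall>\<^sub>F t in at_right 0. 0 < t \<and> t < min e1 e2"
    using e1(1) e2(1) eventually_at_right_less eventually_at_right_real[of 0 "min e1 e2"]
    by (auto elim!: eventually_mono)
  ultimately have "\<forall>\<^sub>F t::real in at_right 0. False"
  proof eventually_elim
    case (elim t)
    then have "r1 (x + t *\<^sub>R h) < 0" "r2 (x + t *\<^sub>R h) > 0"
      using e1 e2 by auto
    moreover have "x + t *\<^sub>R h \<in> \<Omega> \<longleftrightarrow> r1 (x + t *\<^sub>R h) < 0"
      using elim 1 unfolding C1_defining_function_def by blast
    moreover have "x + t *\<^sub>R h \<in> \<Omega> \<longleftrightarrow> r2 (x + t *\<^sub>R h) < 0"
      using elim 2 unfolding C1_defining_function_def by blast
    ultimately show ?case
      by simp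
  qed
  then show False
    by simp
qed

lemma inner_unit_normal_eqI:
  assumes "is_inner_unit_normal \<Omega> x \<nu>"
  shows "inner_unit_normal \<Omega> x = \<nu>"
  unfolding inner_unit_normal_def
proof (rule the_equality)
  fix \<mu>
  assume "is_inner_unit_normal \<Omega> x \<mu>"
  with assms obtain U1 r1 g1 U2 r2 g2 where
    "x \<in> frontier \<Omega>" "x \<in> U1" "x \<in> U2"
    "C1_defining_function \<Omega> U1 r1 g1" "C1_defining_function \<Omega> U2 r2 g2"
    "\<mu> = - sgn (g1 x)" "\<nu> = - sgn (g2 x)"
    unfolding is_inner_unit_normal_def by metis
  then show "\<mu> = \<nu>"
    using C1_defining_function_normal_unique[of x \<Omega> U1 U2 r1 g1 r2 g2] by simp
qed (fact assms)

definition normal_modulus :: "'a::euclidean_space set \<Rightarrow> 'a set \<Rightarrow> real \<Rightarrow> real" where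
  "normal_modulus \<Omega> U t =
     Sup {norm (inner_unit_normal \<Omega> x - inner_unit_normal \<Omega> y) | x y.
            norm (x - y) < t \<and> x \<in> frontier \<Omega> \<inter> U \<and> y \<in> frontier \<Omega> \<inter> U}"

definition Dini_smooth_boundary :: "'a::euclidean_space set \<Rightarrow> bool" where
  "Dini_smooth_boundary \<Omega> \<longleftrightarrow>
     C1_boundary \<Omega> \<and>
     (\<forall>p\<in>frontier \<Omega>. \<exists>U. open U \<and> p \<in> U \<and>
        (\<integral>\<^sup>+t\<in>{0<..1}. ennreal (normal_modulus \<Omega> U t / t) \<partial>lborel) < \<infinity>)"

definition kobayashi_metric :: "(complex ^ 'n) set \<Rightarrow> complex ^ 'n \<Rightarrow> complex ^ 'n \<Rightarrow> real" where
  "kobayashi_metric \<Omega> x v =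
     Inf {norm \<xi> | \<xi> (f :: complex \<Rightarrow> complex ^ 'n).
            (\<forall>j. (\<lambda>\<zeta>. f \<zeta> $ j) holomorphic_on ball 0 1) \<and> f ` ball 0 1 \<subseteq> \<Omega> \<and> f 0 = x \<and>
            \<xi> *s (\<chi> j. deriv (\<lambda>\<zeta>. f \<zeta> $ j) 0) = v}"

definition absolutely_continuous_curve ::
    "real \<Rightarrow> real \<Rightarrow> (real \<Rightarrow> 'a::real_normed_vector) \<Rightarrow> bool" where
  "absolutely_continuous_curve a b \<sigma> \<longleftrightarrow>
     (\<forall>\<epsilon>>0. \<exists>\<eta>>0. \<forall>D. finite D \<and> (\<forall>(s, t)\<in>D. a \<le> s \<and> s \<le> t \<and> t \<le> b) \<and>
        disjoint_family_on (\<lambda>(s, t). {s<..<t}) D \<and> (\<Sum>(s, t)\<in>D. t - s) < \<eta> \<longrightarrow>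
        (\<Sum>(s, t)\<in>D. norm (\<sigma> t - \<sigma> s)) < \<epsilon>)"

text \<open>An absolutely continuous curve is differentiable almost everywhere, so the unspecified value
  of \<^const>\<open>vector_derivative\<close> elsewhere does not affect the integral below.\<close>

definition kobayashi_dist :: "(complex ^ 'n) set \<Rightarrow> complex ^ 'n \<Rightarrow> complex ^ 'n \<Rightarrow> ennreal" where
  "kobayashi_dist \<Omega> x y =
     Inf {\<integral>\<^sup>+t\<in>{a..b}. ennreal (kobayashi_metric \<Omega> (\<sigma> t) (vector_derivative \<sigma> (at t))) \<partial>lebesgue
          | a b \<sigma>. a \<le> b \<and> absolutely_continuous_curve a b \<sigma> \<and> \<sigma> ` {a..b} \<subseteq> \<Omega> \<and>
                   \<sigma> a = x \<and> \<sigma> b = y}"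

definition kobayashi_geodesic ::
    "(complex ^ 'n) set \<Rightarrow> real set \<Rightarrow> (real \<Rightarrow> complex ^ 'n) \<Rightarrow> bool" where
  "kobayashi_geodesic \<Omega> I \<sigma> \<longleftrightarrow>
     is_interval I \<and> \<sigma> ` I \<subseteq> \<Omega> \<and>
     (\<forall>s\<in>I. \<forall>t\<in>I. kobayashi_dist \<Omega> (\<sigma> s) (\<sigma> t) = ennreal \<bar>t - s\<bar>)"

definition curve_length :: "(real \<Rightarrow> 'a::metric_space) \<Rightarrow> real \<Rightarrow> real \<Rightarrow> ennreal" where
  "curve_length \<sigma> a b =
     Sup {\<Sum>i<N. ennreal (dist (\<sigma> (p i)) (\<sigma> (p (Suc i)))) | (N::nat) p.
            (\<forall>i\<le>N. p i \<in> {a..b}) \<and> (\<forall>i<N. p i \<le> p (Suc i))}"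

text \<open>Powers with a positive exponent, extended continuously to \<open>\<infinity>\<close>, so that an inequality
  involving the length of a curve does not presuppose that the curve is rectifiable.\<close>

definition ennreal_powr :: "ennreal \<Rightarrow> real \<Rightarrow> ennreal" where
  "ennreal_powr x \<alpha> = (if x = \<infinity> then \<infinity> else ennreal (enn2real x powr \<alpha>))"

end

theory Submission
  imports Defs
begin

text \<open>
  Let \<open>\<delta>\<close> be the distance to the boundary and \<open>K\<close> the Kobayashi distance. Comparison with supporting
  half planes gives \<open>K x y \<ge> \<bar>ln (\<delta> x / \<delta> y)\<bar> / 2\<close>, and \<open>m\<close>-convexity makes the Kobayashi metric at
  \<open>z\<close> at least \<open>\<bar>v\<bar> / (2 C \<delta>(z)^(1/m))\<close>. As \<open>K x y \<le> A (ln (B / \<delta> x) + ln (B / \<delta> y))\<close>, the function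
  \<open>\<delta>\<close> decays exponentially along a geodesic away from its maximum \<open>H\<close>, so for every \<open>\<beta> < 1/m\<close> the
  length of the geodesic is at most \<open>M H^\<beta>\<close>.

  Given \<open>w\<close> on a geodesic, let \<open>H\<close> be the smaller of the maxima of \<open>\<delta>\<close> on the two sides of \<open>w\<close>. There
  are points \<open>p\<close> and \<open>q\<close> on the two sides with \<open>\<delta> p = \<delta> q = H\<close> and \<open>\<delta> \<le> H\<close> in between, so that
  \<open>ln (H / \<delta> w) \<le> K p w + K w q = K p q\<close>. Moving \<open>p\<close> and \<open>q\<close> inwards by \<open>M H^\<beta> \<ge> \<bar>p - q\<bar>\<close> shows that
  \<open>K p q \<le> 3 ln (1 + C' H^(\<beta> - 1)) + 3/2\<close>, whence \<open>\<delta> w \<ge> c H^(4 - 3\<beta>)\<close>. As \<open>\<beta>\<close> tends to \<open>1/m\<close>, the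
  exponent \<open>(4 - 3\<beta>) / \<beta>\<close> decreases to \<open>4m - 3 \<le> 3m\<^sup>2 - 2m\<close>.
\<close>

section \<open>Absolutely continuous curves\<close>

text \<open>The Kobayashi distance is an infimum of \<open>nn_integral\<close>s over absolutely
  continuous curves, with an integrand not known to be measurable. Lower bounds come from
  calibration: a real function whose derivative along the curve is dominated by the metric changes
  by at most the Kobayashi length. This rests on almost everywhere differentiability and the
  fundamental theorem of calculus for absolutely continuous curves. Upper bounds come from explicit
  paths with integrable majorants.

  A geodesic is merely a distance preserving map; its continuity and its local Lipschitz bounds are
  consequences of the lower bound on the metric.

  Away from its maximum \<open>H\<close> on a geodesic, \<delta> decays exponentially, but with the
  prefactor \<open>B^2 / H\<close>, which blows up for small \<open>H\<close>. Interpolating with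
  \<delta> \<le> H repairs this and is what costs the passage from \<open>1 / m\<close> to a smaller
  \<beta>.

  \<open>H\<close> is the smaller of two maxima because the side of \<open>w\<close> on which it is
  attained then has length at most \<open>M * H powr \<beta>\<close>: the same \<open>H\<close>
  controls the minimum of the two lengths from above and \<delta> at \<open>w\<close> from
  below.\<close>

lemma absolutely_continuous_curve_seqE:
  fixes f :: "real \<Rightarrow> 'a::real_normed_vector"
  assumes "absolutely_continuous_curve a b f" "\<epsilon> > 0"
  obtains \<eta> where "\<eta> > 0"
    "\<And>N p. (\<And>i. i \<le> N \<Longrightarrow> p i \<in> {a..b}) \<Longrightarrow> (\<And>i. i < N \<Longrightarrow> p i \<le> p (Suc i)) \<Longrightarrow>
       p N - p 0 < \<eta> \<Longrightarrow> (\<Sum>i<N. dist (f (p i)) (f (p (Suc i)))) < \<epsilon>"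
proof -
  from assms obtain \<eta> where \<eta>: "\<eta> > 0"
    and ac: "\<And>D. finite D \<Longrightarrow> (\<forall>(s, t)\<in>D. a \<le> s \<and> s \<le> t \<and> t \<le> b) \<Longrightarrow>
        disjoint_family_on (\<lambda>(s, t). {s<..<t}) D \<Longrightarrow> (\<Sum>(s, t)\<in>D. t - s) < \<eta> \<Longrightarrow>
        (\<Sum>(s, t)\<in>D. norm (f t - f s)) < \<epsilon>"
    unfolding absolutely_continuous_curve_def by meson
  show ?thesis
  proof (rule that[OF \<eta>])
    fix N p
    assume p: "\<And>i. i \<le> N \<Longrightarrow> p i \<in> {a..b}" and mono: "\<And>i. i < N \<Longrightarrow> p i \<le> p (Suc i)"
      and len: "p N - p 0 < \<eta>"
    have le: "p i \<le> p j" if "i \<le> j" "j \<le> N" for i j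
      using that by (induction rule: dec_induct) (auto intro: order_trans[OF _ mono])
    \<comment> \<open>Absolute continuity is formulated with finite sets of intervals, whereas a
      partition is a sequence that may repeat points. Dropping the degenerate cells, whose
      increments vanish, makes the map from indices to intervals injective.\<close>
    define J where "J = {i. i < N \<and> p i < p (Suc i)}"
    define D where "D = (\<lambda>i. (p i, p (Suc i))) ` J"
    have finJ: "finite J"
      by (simp add: J_def)
    have sep: "p (Suc i) \<le> p j" if "i \<in> J" "j \<in> J" "i < j" for i j
      using that le[of "Suc i" j] by (auto simp: J_def)
    have inj: "inj_on (\<lambda>i. (p i, p (Suc i))) J"
    proof (rule inj_onI)
      fix i j
      assume ij: "i \<in> J" "j \<in> J" "(p i, p (Suc i)) = (p j, p (Suc j))"
      then have "p i < p (Suc i)" "p j < p (Suc j)"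
        by (auto simp: J_def)
      then show "i = j"
        using sep[of i j] sep[of j i] ij by (cases i j rule: linorder_cases) auto
    qed
    have "disjoint_family_on (\<lambda>(s, t). {s<..<t}) D"
      unfolding disjoint_family_on_def D_def
    proof (intro ballI impI)
      fix P Q
      assume "P \<in> (\<lambda>i. (p i, p (Suc i))) ` J" "Q \<in> (\<lambda>i. (p i, p (Suc i))) ` J" "P \<noteq> Q"
      then obtain i j where ij: "i \<in> J" "j \<in> J" "i \<noteq> j" "P = (p i, p (Suc i))" "Q = (p j, p (Suc j))"
        by auto
      then have "{p i<..<p (Suc i)} \<inter> {p j<..<p (Suc j)} = {}"
        using sep[of i j] sep[of j i] by (cases i j rule: linorder_cases) auto
      then show "(case P of (s, t) \<Rightarrow> {s<..<t}) \<inter> (case Q of (s, t) \<Rightarrow> {s<..<t}) = {}"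
        using ij by simp
    qed
    moreover have "\<forall>(s, t)\<in>D. a \<le> s \<and> s \<le> t \<and> t \<le> b"
      using p by (fastforce simp: D_def J_def)
    moreover have "(\<Sum>(s, t)\<in>D. t - s) < \<eta>"
    proof -
      have "(\<Sum>(s, t)\<in>D. t - s) = (\<Sum>i\<in>J. p (Suc i) - p i)"
        unfolding D_def by (subst sum.reindex[OF inj]) simp
      also have "\<dots> \<le> (\<Sum>i<N. p (Suc i) - p i)"
        by (rule sum_mono2) (auto simp: J_def mono)
      finally show ?thesis
        using len by (simp add: sum_lessThan_telescope)
    qed
    ultimately have "(\<Sum>(s, t)\<in>D. norm (f t - f s)) < \<epsilon>"
      by (intro ac) (auto simp: D_def finJ)
    also have "(\<Sum>(s, t)\<in>D. norm (f t - f s)) = (\<Sum>i\<in>J. dist (f (p i)) (f (p (Suc i))))"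
      unfolding D_def by (subst sum.reindex[OF inj]) (simp add: dist_norm norm_minus_commute)
    also have "\<dots> = (\<Sum>i<N. dist (f (p i)) (f (p (Suc i))))"
    proof (rule sum.mono_neutral_left)
      show "\<forall>i\<in>{..<N} - J. dist (f (p i)) (f (p (Suc i))) = 0"
        using mono by (auto simp: J_def) (metis dist_self order_antisym_conv not_less)
    qed (auto simp: J_def)
    finally show "(\<Sum>i<N. dist (f (p i)) (f (p (Suc i)))) < \<epsilon>" .
  qed
qed

text \<open>The two terms of the bound cover different uses: Lipschitz images of \<open>f\<close>
  need only the first, subtracting a linear function from \<open>f\<close> needs both, and Lipschitz
  curves arise from a constant \<open>f\<close> by the second.\<close>

lemma absolutely_continuous_curve_compose:
  fixes f :: "real \<Rightarrow> 'a::real_normed_vector" and g :: "real \<Rightarrow> 'b::real_normed_vector"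
  assumes f: "absolutely_continuous_curve a b f"
    and M: "\<And>s t. s \<in> {a..b} \<Longrightarrow> t \<in> {a..b} \<Longrightarrow> s \<le> t \<Longrightarrow> norm (g t - g s) \<le> M * norm (f t - f s) + L * (t - s)"
  shows "absolutely_continuous_curve a b g"
  unfolding absolutely_continuous_curve_def
proof (intro allI impI)
  fix \<epsilon> :: real
  assume \<epsilon>: "\<epsilon> > 0"
  define M' L' where "M' = \<bar>M\<bar> + 1" and "L' = \<bar>L\<bar> + 1"
  have pos: "M' > 0" "L' > 0"
    by (auto simp: M'_def L'_def)
  have bd: "norm (g t - g s) \<le> M' * norm (f t - f s) + L' * (t - s)"
    if "s \<in> {a..b}" "t \<in> {a..b}" "s \<le> t" for s t
  proof -
    have "M * norm (f t - f s) \<le> M' * norm (f t - f s)" "L * (t - s) \<le> L' * (t - s)"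
      using that by (auto intro!: mult_right_mono simp: M'_def L'_def)
    then show ?thesis
      using M[OF that] by linarith
  qed
  from f \<epsilon> pos obtain \<eta> where \<eta>: "\<eta> > 0"
    and ac: "\<And>D. finite D \<and> (\<forall>(s, t)\<in>D. a \<le> s \<and> s \<le> t \<and> t \<le> b) \<and>
        disjoint_family_on (\<lambda>(s, t). {s<..<t}) D \<and> (\<Sum>(s, t)\<in>D. t - s) < \<eta> \<Longrightarrow>
        (\<Sum>(s, t)\<in>D. norm (f t - f s)) < \<epsilon> / (2 * M')"
    unfolding absolutely_continuous_curve_def
    by (metis (no_types, lifting) divide_pos_pos mult_pos_pos zero_less_numeral)
  show "\<exists>\<eta>>0. \<forall>D. finite D \<and> (\<forall>(s, t)\<in>D. a \<le> s \<and> s \<le> t \<and> t \<le> b) \<and>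
        disjoint_family_on (\<lambda>(s, t). {s<..<t}) D \<and> (\<Sum>(s, t)\<in>D. t - s) < \<eta> \<longrightarrow>
        (\<Sum>(s, t)\<in>D. norm (g t - g s)) < \<epsilon>"
  proof (intro exI conjI allI impI)
    show "min \<eta> (\<epsilon> / (2 * L')) > 0"
      using \<eta> \<epsilon> pos by simp
    fix D
    assume D: "finite D \<and> (\<forall>(s, t)\<in>D. a \<le> s \<and> s \<le> t \<and> t \<le> b) \<and>
        disjoint_family_on (\<lambda>(s, t). {s<..<t}) D \<and> (\<Sum>(s, t)\<in>D. t - s) < min \<eta> (\<epsilon> / (2 * L'))"
    have "(\<Sum>(s, t)\<in>D. norm (g t - g s)) \<le> (\<Sum>(s, t)\<in>D. M' * norm (f t - f s) + L' * (t - s))"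
      using D by (intro sum_mono) (auto intro!: bd)
    also have "\<dots> = M' * (\<Sum>(s, t)\<in>D. norm (f t - f s)) + L' * (\<Sum>(s, t)\<in>D. t - s)"
      by (simp add: sum.distrib sum_distrib_left case_prod_unfold)
    also have "\<dots> < M' * (\<epsilon> / (2 * M')) + L' * (\<epsilon> / (2 * L'))"
      using ac[of D] D pos by (intro add_strict_mono mult_strict_left_mono) auto
    finally show "(\<Sum>(s, t)\<in>D. norm (g t - g s)) < \<epsilon>"
      using pos by simp
  qed
qed

lemma absolutely_continuous_curve_inner:
  fixes \<sigma> :: "real \<Rightarrow> 'a::real_inner"
  assumes "absolutely_continuous_curve a b \<sigma>"
  shows "absolutely_continuous_curve a b (\<lambda>t. c * (\<sigma> t \<bullet> n))"
proof (rule absolutely_continuous_curve_compose[OF assms])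
  fix s t
  have "c * (\<sigma> t \<bullet> n) - c * (\<sigma> s \<bullet> n) = c * ((\<sigma> t - \<sigma> s) \<bullet> n)"
    by (simp add: inner_diff_left algebra_simps)
  then have "norm (c * (\<sigma> t \<bullet> n) - c * (\<sigma> s \<bullet> n)) = \<bar>c\<bar> * \<bar>(\<sigma> t - \<sigma> s) \<bullet> n\<bar>"
    by (simp only: real_norm_def abs_mult)
  also have "\<dots> \<le> \<bar>c\<bar> * (norm (\<sigma> t - \<sigma> s) * norm n)"
    by (intro mult_left_mono Cauchy_Schwarz_ineq2) auto
  finally show "norm (c * (\<sigma> t \<bullet> n) - c * (\<sigma> s \<bullet> n)) \<le> (\<bar>c\<bar> * norm n) * norm (\<sigma> t - \<sigma> s) + 0 * (t - s)"
    by (simp add: mult_ac)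
qed

lemma lipschitz_imp_absolutely_continuous_curve:
  fixes f :: "real \<Rightarrow> 'a::real_normed_vector"
  assumes "L-lipschitz_on {a..b} f"
  shows "absolutely_continuous_curve a b f"
proof (rule absolutely_continuous_curve_compose)
  show "absolutely_continuous_curve a b (\<lambda>_. 0::real)"
    by (auto simp: absolutely_continuous_curve_def case_prod_unfold intro: exI[of _ 1])
  show "norm (f t - f s) \<le> 0 * norm (0 - 0 :: real) + L * (t - s)"
    if "s \<in> {a..b}" "t \<in> {a..b}" "s \<le> t" for s t
    using lipschitz_onD[OF assms that(2,1)] that by (simp add: dist_norm)
qed

lemma absolutely_continuous_curve_subinterval:
  assumes "absolutely_continuous_curve a b f" "a \<le> c" "d \<le> b"
  shows "absolutely_continuous_curve c d f"
  unfolding absolutely_continuous_curve_def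
proof (intro allI impI)
  fix \<epsilon> :: real
  assume "\<epsilon> > 0"
  with assms(1) obtain \<eta> where "\<eta> > 0" and
    ac: "\<And>D. finite D \<and> (\<forall>(s, t)\<in>D. a \<le> s \<and> s \<le> t \<and> t \<le> b) \<and>
        disjoint_family_on (\<lambda>(s, t). {s<..<t}) D \<and> (\<Sum>(s, t)\<in>D. t - s) < \<eta> \<Longrightarrow>
        (\<Sum>(s, t)\<in>D. norm (f t - f s)) < \<epsilon>"
    unfolding absolutely_continuous_curve_def by meson
  then show "\<exists>\<eta>>0. \<forall>D. finite D \<and> (\<forall>(s, t)\<in>D. c \<le> s \<and> s \<le> t \<and> t \<le> d) \<and>
        disjoint_family_on (\<lambda>(s, t). {s<..<t}) D \<and> (\<Sum>(s, t)\<in>D. t - s) < \<eta> \<longrightarrow>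
        (\<Sum>(s, t)\<in>D. norm (f t - f s)) < \<epsilon>"
    using assms(2,3) by (intro exI[of _ \<eta>] conjI allI impI ac) (auto intro: order_trans)
qed

lemma absolutely_continuous_curve_imp_continuous_on:
  fixes f :: "real \<Rightarrow> 'a::real_normed_vector"
  assumes "absolutely_continuous_curve a b f"
  shows "continuous_on {a..b} f"
  unfolding continuous_on_iff
proof (intro ballI allI impI)
  fix x and \<epsilon> :: real
  assume x: "x \<in> {a..b}" and \<epsilon>: "\<epsilon> > 0"
  obtain \<eta> where \<eta>: "\<eta> > 0" and
    ac: "\<And>N p. (\<And>i. i \<le> N \<Longrightarrow> p i \<in> {a..b}) \<Longrightarrow> (\<And>i. i < N \<Longrightarrow> p i \<le> p (Suc i)) \<Longrightarrow>
       p N - p 0 < \<eta> \<Longrightarrow> (\<Sum>i<N. dist (f (p i)) (f (p (Suc i)))) < \<epsilon>"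
    using absolutely_continuous_curve_seqE[OF assms \<epsilon>] by blast
  have "dist (f y) (f x) < \<epsilon>" if "y \<in> {a..b}" "dist y x < \<eta>" for y
    using ac[of 1 "\<lambda>i. if i = 0 then min x y else max x y"] that x
    by (cases "x \<le> y") (auto simp: dist_real_def min_def max_def dist_commute)
  with \<eta> show "\<exists>d>0. \<forall>y\<in>{a..b}. dist y x < d \<longrightarrow> dist (f y) (f x) < \<epsilon>"
    by blast
qed

section \<open>Lengths of curves and their finiteness\<close>

lemma curve_length_geI:
  assumes "\<And>i. i \<le> N \<Longrightarrow> p i \<in> {a..b}" "\<And>i. i < N \<Longrightarrow> p i \<le> p (Suc i)"
  shows "ennreal (\<Sum>i<N. dist (f (p i)) (f (p (Suc i)))) \<le> curve_length f a b"
  unfolding curve_length_def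
  by (rule Sup_upper) (use assms in \<open>auto simp: sum_ennreal intro!: exI[of _ N] exI[of _ p]\<close>)

lemma curve_length_leI:
  assumes "\<And>N p. (\<And>i. i \<le> N \<Longrightarrow> p i \<in> {a..b}) \<Longrightarrow> (\<And>i. i < N \<Longrightarrow> p i \<le> p (Suc i)) \<Longrightarrow>
     ennreal (\<Sum>i<N. dist (f (p i)) (f (p (Suc i)))) \<le> B"
  shows "curve_length f a b \<le> B"
  unfolding curve_length_def by (rule Sup_least) (use assms in \<open>auto simp: sum_ennreal\<close>)

text \<open>Clamping \<open>u\<close> to a cell records how much of the way from \<open>x 0\<close>
  to \<open>u\<close> lies in that cell. A partition of the whole interval thereby restricts to
  every cell without being refined.\<close>

lemma sum_clamp_telescope:
  fixes f :: "real \<Rightarrow> 'a::real_normed_vector" and x :: "nat \<Rightarrow> real"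
  assumes "\<And>k. k < n \<Longrightarrow> x k \<le> x (Suc k)" "x 0 \<le> u"
  shows "(\<Sum>k<n. f (max (x k) (min u (x (Suc k)))) - f (x k)) = f (min u (x n)) - f (x 0)"
  using assms
proof (induction n)
  case (Suc n)
  have "x 0 \<le> x k" if "k \<le> n" for k
    using that by (induction k) (auto intro: order_trans[OF _ Suc.prems(1)])
  then have "x 0 \<le> x n"
    by simp
  have "(\<Sum>k<n. f (max (x k) (min u (x (Suc k)))) - f (x k)) = f (min u (x n)) - f (x 0)"
    using Suc by simp
  then show ?case
    using Suc.prems(1)[of n] \<open>x 0 \<le> x n\<close> by (cases "u \<le> x n") (auto simp: min_def max_def)
qed auto

text \<open>The interval is cut into \<open>n\<close> cells shorter than the \<eta> belonging to
  \<epsilon> = 1. Any partition, clamped to a cell, has variation below 1 there, so the length is at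
  most \<open>n\<close>.\<close>

lemma absolutely_continuous_curve_finite_length:
  fixes f :: "real \<Rightarrow> 'a::real_normed_vector"
  assumes "absolutely_continuous_curve a b f" "a \<le> b"
  shows "curve_length f a b < \<infinity>"
proof -
  obtain \<eta> where \<eta>: "\<eta> > 0" and
    ac: "\<And>N p. (\<And>i. i \<le> N \<Longrightarrow> p i \<in> {a..b}) \<Longrightarrow> (\<And>i. i < N \<Longrightarrow> p i \<le> p (Suc i)) \<Longrightarrow>
       p N - p 0 < \<eta> \<Longrightarrow> (\<Sum>i<N. dist (f (p i)) (f (p (Suc i)))) < 1"
    using absolutely_continuous_curve_seqE[OF assms(1) zero_less_one] by blast
  obtain n where n: "(b - a) / \<eta> < real n"
    using reals_Archimedean2 by blast
  have n0: "n > 0"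
  proof (rule ccontr)
    assume "\<not> n > 0"
    with n have "(b - a) / \<eta> < 0" by simp
    then show False using \<eta> assms(2) by (simp add: divide_less_0_iff)
  qed
  define h where "h = (b - a) / real n"
  have h: "0 \<le> h" "h < \<eta>"
    using n n0 \<eta> assms(2) by (auto simp: h_def field_simps)
  define x where "x k = a + real k * h" for k
  have xn: "x n = b" "x 0 = a" and xs: "x k \<le> x (Suc k)" "x (Suc k) - x k = h" for k
    using n0 h by (auto simp: x_def h_def field_simps)
  have xab: "a \<le> x k" "x (Suc k) \<le> b" if "k < n" for k
  proof -
    show "a \<le> x k" using h by (simp add: x_def)
    have "real (Suc k) * h \<le> real n * h"
      using that h by (intro mult_right_mono) auto
    then show "x (Suc k) \<le> b"
      using n0 by (simp add: x_def h_def)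
  qed
  define cl where "cl k u = max (x k) (min u (x (Suc k)))" for k u
  have "curve_length f a b \<le> ennreal (real n)"
  proof (rule curve_length_leI)
    fix N p
    assume p: "\<And>i. i \<le> N \<Longrightarrow> p i \<in> {a..b}" and mono: "\<And>i. i < N \<Longrightarrow> p i \<le> p (Suc i)"
    have tel: "(\<Sum>k<n. f (cl k u) - f (x k)) = f u - f a" if "u \<in> {a..b}" for u
      using sum_clamp_telescope[of n x u f] xs xn that by (simp add: cl_def)
    have "dist (f (p i)) (f (p (Suc i))) \<le> (\<Sum>k<n. dist (f (cl k (p i))) (f (cl k (p (Suc i)))))"
      if "i < N" for i
    proof -
      have "f (p i) - f (p (Suc i)) = (\<Sum>k<n. f (cl k (p i)) - f (x k)) - (\<Sum>k<n. f (cl k (p (Suc i))) - f (x k))"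
        using tel p that by simp
      also have "\<dots> = (\<Sum>k<n. f (cl k (p i)) - f (cl k (p (Suc i))))"
        by (simp add: sum_subtractf)
      finally show ?thesis
        by (simp add: dist_norm sum_norm_le)
    qed
    then have "(\<Sum>i<N. dist (f (p i)) (f (p (Suc i)))) \<le>
        (\<Sum>i<N. \<Sum>k<n. dist (f (cl k (p i))) (f (cl k (p (Suc i)))))"
      by (intro sum_mono) auto
    also have "\<dots> = (\<Sum>k<n. \<Sum>i<N. dist (f (cl k (p i))) (f (cl k (p (Suc i)))))"
      by (rule sum.swap)
    also have "\<dots> \<le> (\<Sum>k<n. 1)"
    proof (rule sum_mono, rule less_imp_le, rule ac)
      fix k assume k: "k \<in> {..<n}"
      show "cl k (p i) \<in> {a..b}" if "i \<le> N" for i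
        using xab[of k] xs(1)[of k] k by (auto simp: cl_def)
      show "cl k (p i) \<le> cl k (p (Suc i))" if "i < N" for i
        using mono[OF that] by (auto simp: cl_def)
      show "cl k (p N) - cl k (p 0) < \<eta>"
        using xs[of k] h by (auto simp: cl_def)
    qed
    finally show "ennreal (\<Sum>i<N. dist (f (p i)) (f (p (Suc i)))) \<le> ennreal (real n)"
      by (simp add: ennreal_leI)
  qed
  then show ?thesis
    using le_less_trans by fastforce
qed

lemma curve_length_append:
  assumes "a \<le> s" "s \<le> t"
  shows "curve_length f a s + ennreal (dist (f s) (f t)) \<le> curve_length f a t"
proof -
  have *: "curve_length f a s \<le> curve_length f a t - ennreal (dist (f s) (f t))"
  proof (rule curve_length_leI)
    fix N p
    assume p: "\<And>i. i \<le> N \<Longrightarrow> p i \<in> {a..s}" and mono: "\<And>i. i < N \<Longrightarrow> p i \<le> p (Suc i)"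
    define q where "q i = (if i \<le> N then p i else if i = Suc N then s else t)" for i
    have "(\<Sum>i<N. dist (f (p i)) (f (p (Suc i)))) + dist (f s) (f t) \<le>
        (\<Sum>i<Suc (Suc N). dist (f (q i)) (f (q (Suc i))))"
      by (simp add: q_def)
    then have "ennreal ((\<Sum>i<N. dist (f (p i)) (f (p (Suc i)))) + dist (f s) (f t)) \<le>
        ennreal (\<Sum>i<Suc (Suc N). dist (f (q i)) (f (q (Suc i))))"
      by (rule ennreal_leI)
    also have "\<dots> \<le> curve_length f a t"
    proof (rule curve_length_geI)
      show "q i \<in> {a..t}" if "i \<le> Suc (Suc N)" for i
        using p[of i] assms by (auto simp: q_def)
      show "q i \<le> q (Suc i)" if "i < Suc (Suc N)" for i
        using p[of i] mono[of i] assms that by (auto simp: q_def)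
    qed
    finally show "ennreal (\<Sum>i<N. dist (f (p i)) (f (p (Suc i)))) \<le>
        curve_length f a t - ennreal (dist (f s) (f t))"
      by (subst ennreal_le_minus_iff) (simp add: ennreal_plus sum_nonneg add.commute)
  qed
  \<comment> \<open>Subtraction on \<open>ennreal\<close> is truncated, so it can be undone only
    because the subtrahend is at most the length.\<close>
  have d: "ennreal (dist (f s) (f t)) \<le> curve_length f a t"
    using curve_length_geI[of 1 "\<lambda>i. if i = 0 then s else t" a t f] assms by auto
  have "curve_length f a s + ennreal (dist (f s) (f t)) \<le>
      curve_length f a t - ennreal (dist (f s) (f t)) + ennreal (dist (f s) (f t))"
    using * by (intro add_right_mono)
  also have "\<dots> = curve_length f a t"
    by (rule diff_add_cancel_ennreal[OF d])
  finally show ?thesis .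
qed

section \<open>Almost everywhere differentiability and the fundamental theorem of calculus\<close>

lemma sum_mono_increments_le:
  fixes w :: "real \<Rightarrow> real"
  assumes "finite F" "\<And>u v. (u, v) \<in> F \<Longrightarrow> a \<le> u \<and> u < v \<and> v \<le> b"
    and "pairwise (\<lambda>(u, v) (u', v'). {u..v} \<inter> {u'..v'} = {}) F"
    and "mono_on {a..b} w" "a \<le> b"
  shows "(\<Sum>(u, v)\<in>F. w v - w u) \<le> w b - w a"
  using assms
proof (induction "card F" arbitrary: F b)
  case 0
  then show ?case
    using mono_onD[OF 0(5), of a b] by simp
next
  case (Suc n)
  have ne: "fst ` F \<noteq> {}" "finite (fst ` F)"
    using Suc.hyps(2) Suc.prems(1) by auto
  \<comment> \<open>The interval with the largest left end point: by disjointness all others end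
    before \<open>u\<close>, so the induction continues on \<open>{a..u}\<close>.\<close>
  obtain u v where uv: "(u, v) \<in> F" "u = Max (fst ` F)"
    using Max_in[OF ne(2,1)] by force
  have le: "v' \<le> u" if "(u', v') \<in> F - {(u, v)}" for u' v'
  proof (rule ccontr)
    assume "\<not> v' \<le> u"
    moreover have "u' \<le> u"
      using that ne(2) unfolding uv(2) by (intro Max_ge) force+
    moreover have "{u..v} \<inter> {u'..v'} = {}"
      using Suc.prems(3) that uv(1) unfolding pairwise_def by fastforce
    moreover have "u < v"
      using Suc.prems(2) uv(1) by auto
    ultimately show False
      by auto
  qed
  have abs: "a \<le> u" "u < v" "v \<le> b"
    using Suc.prems(2) uv(1) by auto
  have "(\<Sum>(u, v)\<in>F - {(u, v)}. w v - w u) \<le> w u - w a"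
  proof (rule Suc.hyps(1))
    show "n = card (F - {(u, v)})"
      using Suc.hyps(2) Suc.prems(1) uv(1) by simp
    show "pairwise (\<lambda>(u, v) (u', v'). {u..v} \<inter> {u'..v'} = {}) (F - {(u, v)})"
      using Suc.prems(3) by (rule pairwise_subset) auto
    show "mono_on {a..u} w"
      using abs by (intro mono_on_subset[OF Suc.prems(4)]) auto
    show "a \<le> u' \<and> u' < v' \<and> v' \<le> u" if "(u', v') \<in> F - {(u, v)}" for u' v'
      using Suc.prems(2)[of u' v'] le[OF that] that by auto
  qed (use Suc.prems abs in auto)
  moreover have "(\<Sum>(u, v)\<in>F. w v - w u) = w v - w u + (\<Sum>(u, v)\<in>F - {(u, v)}. w v - w u)"
    by (subst sum.remove[OF Suc.prems(1) uv(1)]) simp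
  moreover have "w v \<le> w b"
    using abs by (intro mono_onD[OF Suc.prems(4)]) auto
  ultimately show ?case
    by linarith
qed

text \<open>Disjoint intervals on which \<open>w\<close> has mean slope at least \<open>c\<close>
  have total length at most \<open>(w b - w a) / c\<close>, and by Vitali such intervals cover
  \<open>E\<close> up to a null set. The conclusion speaks of a superset \<open>T\<close> because
  \<open>E\<close> itself is not known to be measurable.\<close>

lemma vitali_cover_mono:
  fixes w :: "real \<Rightarrow> real"
  assumes mono: "mono_on {a..b} w" and "a \<le> b" "c > 0"
    and E: "\<And>t \<delta>. t \<in> E \<Longrightarrow> \<delta> > 0 \<Longrightarrow>
       \<exists>u v. a \<le> u \<and> u < v \<and> v \<le> b \<and> u \<le> t \<and> t \<le> v \<and> v - u < \<delta> \<and> c * (v - u) \<le> w v - w u"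
  shows "\<exists>T. E \<subseteq> T \<and> T \<in> lmeasurable \<and> measure lebesgue T \<le> (w b - w a) / c"
proof -
  define K where "K = {(u, v). a \<le> u \<and> u < v \<and> v \<le> b \<and> c * (v - u) \<le> w v - w u}"
  define m r where "m = (\<lambda>(u, v). (u + v) / 2 :: real)" and "r = (\<lambda>(u, v). (v - u) / 2 :: real)"
  have cb: "cball (m (u, v)) (r (u, v)) = {u..v}" if "(u, v) \<in> K" for u v
    using that by (auto simp: K_def m_def r_def cball_eq_atLeastAtMost field_simps)
  obtain C where C: "countable C" "C \<subseteq> K"
     "pairwise (\<lambda>i j. disjnt (cball (m i) (r i)) (cball (m j) (r j))) C"
     "negligible (E - (\<Union>i\<in>C. cball (m i) (r i)))"
  proof (rule Vitali_covering_theorem_cballs[of K r E m])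
    show "0 < r i" if "i \<in> K" for i
      using that by (auto simp: K_def r_def)
    show "\<exists>i. i \<in> K \<and> x \<in> cball (m i) (r i) \<and> r i < d" if x: "x \<in> E" "0 < d" for x d
    proof -
      obtain u v where uv: "a \<le> u" "u < v" "v \<le> b" "u \<le> x" "x \<le> v" "v - u < d" "c * (v - u) \<le> w v - w u"
        using E[OF x] by blast
      then have "(u, v) \<in> K" by (auto simp: K_def)
      then show ?thesis
        using uv cb[of u v] by (intro exI[of _ "(u, v)"]) (auto simp: r_def)
    qed
  qed blast
  define U where "U = (\<Union>i\<in>C. cball (m i) (r i))"
  have bound: "measure lebesgue (\<Union>i\<in>F. cball (m i) (r i)) \<le> (w b - w a) / c"
    if F: "F \<subseteq> C" "finite F" for F
  proof -
    have FK: "F \<subseteq> K" using F C(2) by blast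
    have "measure lebesgue (\<Union>i\<in>F. cball (m i) (r i)) \<le> (\<Sum>i\<in>F. measure lebesgue (cball (m i) (r i)))"
      by (rule measure_UNION_le) (use F in auto)
    also have "\<dots> = (\<Sum>(u, v)\<in>F. v - u)"
      by (rule sum.cong) (use FK cb in \<open>auto simp: K_def\<close>)
    also have "\<dots> \<le> (\<Sum>(u, v)\<in>F. (w v - w u) / c)"
      by (rule sum_mono) (use FK \<open>c > 0\<close> in \<open>auto simp: K_def field_simps\<close>)
    also have "\<dots> = (\<Sum>(u, v)\<in>F. (w v - w u)) / c"
      by (simp add: sum_divide_distrib case_prod_unfold)
    also have "\<dots> \<le> (w b - w a) / c"
    proof (rule divide_right_mono[OF sum_mono_increments_le[OF F(2) _ _ mono]])
      show "pairwise (\<lambda>(u, v) (u', v'). {u..v} \<inter> {u'..v'} = {}) F"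
      proof (rule pairwiseI)
        fix i j assume ij: "i \<in> F" "j \<in> F" "i \<noteq> j"
        then have "disjnt (cball (m i) (r i)) (cball (m j) (r j))"
          using C(3) F(1) unfolding pairwise_def by blast
        moreover have "i \<in> K" "j \<in> K"
          using ij FK by auto
        ultimately have "{fst i..snd i} \<inter> {fst j..snd j} = {}"
          using cb[of "fst i" "snd i"] cb[of "fst j" "snd j"] by (simp add: disjnt_def)
        then show "(\<lambda>(u, v) (u', v'). {u..v} \<inter> {u'..v'} = {}) i j"
          by (simp add: case_prod_unfold)
      qed
    qed (use assms FK in \<open>auto simp: K_def\<close>)
    finally show ?thesis .
  qed
  have U: "U \<in> lmeasurable" "measure lebesgue U \<le> (w b - w a) / c"
    unfolding U_def
    by (rule fmeasurable_UN_bound[OF C(1) _ bound], simp_all)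
       (rule measure_UN_bound[OF C(1) _ bound], simp_all)
  have "E - U \<in> null_sets lebesgue"
    using C(4) by (simp add: U_def negligible_iff_null_sets)
  then have "measure lebesgue (U \<union> (E - U)) = measure lebesgue U"
    using U by (intro measure_Un_null_set) auto
  moreover have "U \<union> (E - U) \<in> lmeasurable"
    using U(1) negligible_imp_measurable[OF C(4)] unfolding U_def by (rule fmeasurable.Un)
  ultimately show ?thesis
    using U(2) by (intro exI[of _ "U \<union> (E - U)"]) auto
qed

lemma absolutely_continuous_curve_length_function:
  fixes f :: "real \<Rightarrow> 'a::real_normed_vector"
  assumes "absolutely_continuous_curve a b f" "a \<le> s" "s \<le> t" "t \<le> b"
  shows "dist (f s) (f t) \<le> enn2real (curve_length f a t) - enn2real (curve_length f a s)"
proof -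
  have fin: "curve_length f a u < \<infinity>" if "a \<le> u" "u \<le> b" for u
    using that assms(1) by (intro absolutely_continuous_curve_finite_length
        absolutely_continuous_curve_subinterval[of a b f a u]) auto
  have "enn2real (curve_length f a s) + dist (f s) (f t) =
      enn2real (curve_length f a s + ennreal (dist (f s) (f t)))"
    using fin[of s] assms by (subst enn2real_plus) auto
  also have "\<dots> \<le> enn2real (curve_length f a t)"
    using curve_length_append[of a s t f] fin[of t] assms by (intro enn2real_mono) auto
  finally show ?thesis by simp
qed

lemma absolutely_continuous_curve_near_optimal_partition:
  fixes f :: "real \<Rightarrow> 'a::real_normed_vector"
  assumes ac: "absolutely_continuous_curve a b f" and "a \<le> b" "\<epsilon> > 0"
  obtains N p where "p 0 = a" "p N = b" "\<And>i. i < N \<Longrightarrow> p i \<le> p (Suc i)" "\<And>i. i \<le> N \<Longrightarrow> p i \<in> {a..b}"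
    "enn2real (curve_length f a b) - enn2real (curve_length f a a) - \<epsilon> \<le> (\<Sum>i<N. dist (f (p i)) (f (p (Suc i))))"
proof -
  define v where "v = enn2real (curve_length f a b)"
  have fin: "curve_length f a b < \<infinity>"
    using absolutely_continuous_curve_finite_length[OF ac \<open>a \<le> b\<close>] .
  have "\<exists>N p. (\<forall>i\<le>N. p i \<in> {a..b}) \<and> (\<forall>i<N. p i \<le> p (Suc i)) \<and>
      v - \<epsilon> \<le> (\<Sum>i<N. dist (f (p i)) (f (p (Suc i))))"
  proof (rule ccontr)
    assume neg: "\<not> ?thesis"
    have "curve_length f a b \<le> ennreal (v - \<epsilon>)"
    proof (rule curve_length_leI)
      fix N p
      assume "\<And>i. i \<le> N \<Longrightarrow> p i \<in> {a..b}" "\<And>i. i < N \<Longrightarrow> p i \<le> p (Suc i)"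
      then have "(\<Sum>i<N. dist (f (p i)) (f (p (Suc i)))) \<le> v - \<epsilon>"
        using neg by (meson linear)
      then show "ennreal (\<Sum>i<N. dist (f (p i)) (f (p (Suc i)))) \<le> ennreal (v - \<epsilon>)"
        by (rule ennreal_leI)
    qed
    then have "v \<le> enn2real (ennreal (v - \<epsilon>))"
      unfolding v_def by (rule enn2real_mono) simp
    \<comment> \<open>If \<open>v - \<epsilon>\<close> is negative, \<open>ennreal\<close> turns it
      into 0 and forces \<open>v \<le> 0\<close>; the one point partition, whose sum is 0, then
      already contradicts \<open>neg\<close>.\<close>
    then have "v \<le> max 0 (v - \<epsilon>)"
      by (cases "0 \<le> v - \<epsilon>") (auto simp: ennreal_neg)
    with \<open>\<epsilon> > 0\<close> have "v \<le> 0" "v - \<epsilon> \<le> 0"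
      by (auto simp: max_def split: if_splits)
    moreover have "\<exists>N p. (\<forall>i\<le>N. p i \<in> {a..b}) \<and> (\<forall>i<N. p i \<le> p (Suc i)) \<and>
      0 \<le> (\<Sum>i<N. dist (f (p i)) (f (p (Suc i))))"
      using \<open>a \<le> b\<close> by (intro exI[of _ "0::nat"] exI[of _ "\<lambda>_. a"]) auto
    ultimately show False
      using neg by (meson order_trans)
  qed
  then obtain N p where p: "\<And>i. i \<le> N \<Longrightarrow> p i \<in> {a..b}" "\<And>i. i < N \<Longrightarrow> p i \<le> p (Suc i)"
      "v - \<epsilon> \<le> (\<Sum>i<N. dist (f (p i)) (f (p (Suc i))))"
    by blast
  \<comment> \<open>Adding the end points \<open>a\<close> and \<open>b\<close> can only increase
    the sum.\<close>
  define q where "q = (\<lambda>i. case i of 0 \<Rightarrow> a | Suc j \<Rightarrow> if j \<le> N then p j else b)"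
  have "(\<Sum>i<N. dist (f (p i)) (f (p (Suc i)))) = (\<Sum>i<N. dist (f (q (Suc i))) (f (q (Suc (Suc i)))))"
    by (simp add: q_def)
  also have "\<dots> \<le> (\<Sum>i<Suc N. dist (f (q i)) (f (q (Suc i))))"
    by (subst sum.lessThan_Suc_shift) simp
  also have "\<dots> \<le> (\<Sum>i<Suc (Suc N). dist (f (q i)) (f (q (Suc i))))"
    by simp
  finally have 1: "v - \<epsilon> \<le> (\<Sum>i<Suc (Suc N). dist (f (q i)) (f (q (Suc i))))"
    using p(3) by linarith
  show ?thesis
  proof (rule that[of q "Suc (Suc N)"])
    show "q i \<in> {a..b}" if "i \<le> Suc (Suc N)" for i
      using p(1) \<open>a \<le> b\<close> by (auto simp: q_def split: nat.split)
    show "q i \<le> q (Suc i)" if "i < Suc (Suc N)" for i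
      using p(1,2) \<open>a \<le> b\<close> that by (auto simp: q_def Suc_le_eq split: nat.split)
    show "enn2real (curve_length f a b) - enn2real (curve_length f a a) - \<epsilon> \<le>
        (\<Sum>i<Suc (Suc N). dist (f (q i)) (f (q (Suc i))))"
      using 1 enn2real_nonneg[of "curve_length f a a"] unfolding v_def by linarith
  qed (auto simp: q_def)
qed

text \<open>
  On each cell of a nearly optimal partition the length function \<open>v\<close> exceeds \<open>\<plusminus>f\<close>, with the sign \<open>s i\<close>
  of the increment of \<open>f\<close> over the cell, by an almost constant function; summing these differences
  gives an increasing function \<open>w\<close> of tiny total increase. A chord of \<open>f\<close> whose slope is opposed
  to the sign of its cell makes \<open>w\<close> grow by twice the increment of \<open>f\<close>, so that the Vitali covering
  theorem applies to \<open>w\<close>.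
\<close>

lemma negligible_opposed_slopes:
  fixes f :: "real \<Rightarrow> real"
  assumes ac: "absolutely_continuous_curve a b f" and "a \<le> b" "c > 0"
  shows "negligible {t \<in> {a<..<b}. (\<exists>\<^sub>F h in at 0. (f (t + h) - f t) / h \<le> - c) \<and>
      (\<exists>\<^sub>F h in at 0. (f (t + h) - f t) / h \<ge> c)}" (is "negligible ?E")
  unfolding negligible_outer_le
proof (intro allI impI)
  fix e :: real
  assume "e > 0"
  define v where "v t = enn2real (curve_length f a t)" for t
  have v: "\<bar>f t - f s\<bar> \<le> v t - v s" if "a \<le> s" "s \<le> t" "t \<le> b" for s t
    using absolutely_continuous_curve_length_function[OF ac that] by (simp add: v_def dist_real_def abs_minus_commute)
  \<comment> \<open>The chords selected below have slope at least \<open>2 * c\<close> with respect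
    to \<open>w\<close>, so a total increase of \<open>2 * c * e\<close> leaves measure at most
    \<open>e\<close>.\<close>
  have ce: "2 * c * e > 0"
    using \<open>c > 0\<close> \<open>e > 0\<close> by simp
  obtain N p where p: "p 0 = a" "p N = b" "\<And>i. i < N \<Longrightarrow> p i \<le> p (Suc i)" "\<And>i. i \<le> N \<Longrightarrow> p i \<in> {a..b}"
    "enn2real (curve_length f a b) - enn2real (curve_length f a a) - 2 * c * e \<le> (\<Sum>i<N. dist (f (p i)) (f (p (Suc i))))"
    by (rule absolutely_continuous_curve_near_optimal_partition[OF ac \<open>a \<le> b\<close> ce], rule that)
  define s :: "nat \<Rightarrow> real" where "s i = (if f (p i) \<le> f (p (Suc i)) then 1 else -1)" for i
  define cl where "cl i t = max (p i) (min t (p (Suc i)))" for i t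
  define g where "g i t = v (cl i t) - s i * f (cl i t)" for i t
  define w where "w t = (\<Sum>i<N. g i t)" for t
  have g: "g i x \<le> g i y" if "i < N" "x \<le> y" for i x y
  proof -
    have "cl i x \<le> cl i y" "a \<le> cl i x" "cl i y \<le> b"
      using p(3)[of i] p(4)[of i] p(4)[of "Suc i"] that by (auto simp: cl_def)
    from v[OF this(2,1,3)] show ?thesis
      by (auto simp: g_def s_def)
  qed
  have w: "mono_on {a..b} w"
    unfolding w_def by (auto intro!: mono_onI sum_mono g)
  have "w b - w a = (\<Sum>i<N. g i b - g i a)"
    by (simp add: w_def sum_subtractf)
  also have "\<dots> = (\<Sum>i<N. (v (p (Suc i)) - v (p i)) - \<bar>f (p (Suc i)) - f (p i)\<bar>)"
  proof (rule sum.cong)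
    fix i assume "i \<in> {..<N}"
    then have "cl i b = p (Suc i)" "cl i a = p i"
      using p(3)[of i] p(4)[of i] p(4)[of "Suc i"] by (auto simp: cl_def)
    then show "g i b - g i a = (v (p (Suc i)) - v (p i)) - \<bar>f (p (Suc i)) - f (p i)\<bar>"
      by (auto simp: g_def s_def)
  qed simp
  also have "\<dots> = (v b - v a) - (\<Sum>i<N. \<bar>f (p (Suc i)) - f (p i)\<bar>)"
    using sum_lessThan_telescope[of "\<lambda>i. v (p i)" N] p(1,2) by (simp add: sum_subtractf)
  finally have wab: "w b - w a \<le> 2 * c * e"
    using p(5) by (simp add: v_def dist_real_def abs_minus_commute)
  \<comment> \<open>Removing the finitely many partition points puts every remaining
    \<open>t\<close> in the interior of a cell, where short chords around \<open>t\<close> stay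
    inside the cell.\<close>
  define X where "X = p ` {..N}"
  have "\<exists>T. ?E - X \<subseteq> T \<and> T \<in> lmeasurable \<and> measure lebesgue T \<le> (w b - w a) / (2 * c)"
  proof (rule vitali_cover_mono[OF w \<open>a \<le> b\<close>])
    fix t \<delta> :: real
    assume t: "t \<in> ?E - X" and "\<delta> > 0"
    define k where "k = (LEAST k. t \<le> p k)"
    have ex: "t \<le> p N"
      using t p(2) by auto
    have k: "t \<le> p k" "k \<le> N"
      unfolding k_def using ex by (auto intro: LeastI Least_le)
    have "k \<noteq> 0"
      using k p(1) t by (intro notI) auto
    then obtain i where i: "k = Suc i"
      by (cases k) auto
    have "\<not> t \<le> p i"
      using not_less_Least[of i "\<lambda>k. t \<le> p k"] i by (simp add: k_def)
    moreover have "t \<noteq> p k"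
      using t k by (auto simp: X_def)
    ultimately have ti: "p i < t" "t < p (Suc i)" "i < N"
      using k i by auto
    define d where "d = min \<delta> (min (t - p i) (p (Suc i) - t))"
    have d: "d > 0"
      using ti \<open>\<delta> > 0\<close> by (simp add: d_def)
    \<comment> \<open>Membership in the exceptional set provides steep chords of both signs; the
      sign of the cell decides which of them is opposed to it.\<close>
    have freq: "\<exists>\<^sub>F h in at 0. s i * ((f (t + h) - f t) / h) \<le> - c"
    proof (cases "f (p i) \<le> f (p (Suc i))")
      case False
      have "\<exists>\<^sub>F h in at 0. (f (t + h) - f t) / h \<ge> c"
        using t by simp
      then show ?thesis
        by (rule frequently_elim1) (use False in \<open>simp only: s_def if_False mult_minus1 neg_le_iff_le\<close>)
    qed (use t in \<open>simp add: s_def\<close>)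
    have ev: "\<forall>\<^sub>F h in at 0. h \<noteq> 0 \<and> \<bar>h\<bar> < d"
      using d by (auto simp: eventually_at intro!: exI[of _ d])
    obtain h where h: "s i * ((f (t + h) - f t) / h) \<le> - c" "h \<noteq> 0" "\<bar>h\<bar> < d"
      using frequently_ex[OF frequently_eventually_frequently[OF freq ev]] by auto
    define x y where "x = min t (t + h)" and "y = max t (t + h)"
    have xy: "x < y" "y - x = \<bar>h\<bar>" "x \<le> t" "t \<le> y" "p i < x" "y < p (Suc i)"
      using h ti by (auto simp: x_def y_def d_def)
    have slope: "(f y - f x) / (y - x) = (f (t + h) - f t) / h"
      using h(2) by (cases "h > 0") (auto simp: x_def y_def divide_simps)
    have sxy: "s i * (f y - f x) \<le> - c * (y - x)"
    proof -
      have "s i * (f y - f x) = s i * ((f y - f x) / (y - x)) * (y - x)"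
        using xy by simp
      also have "\<dots> \<le> - c * (y - x)"
        using h(1) xy unfolding slope by (intro mult_right_mono) auto
      finally show ?thesis .
    qed
    have ab: "a \<le> x" "y \<le> b"
      using xy ti p(4)[of i] p(4)[of "Suc i"] by auto
    have "2 * c * (y - x) \<le> \<bar>f y - f x\<bar> - s i * (f y - f x)"
      using sxy by (auto simp: s_def split: if_splits)
    also have "\<dots> \<le> g i y - g i x"
      using v[of x y] ab xy by (simp add: g_def cl_def algebra_simps)
    also have "\<dots> \<le> (\<Sum>i<N. g i y - g i x)"
      using ti g xy by (intro member_le_sum) auto
    also have "\<dots> = w y - w x"
      by (simp add: w_def sum_subtractf)
    finally have "2 * c * (y - x) \<le> w y - w x" .
    moreover have "y - x < \<delta>"
      using xy h by (auto simp: d_def)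
    ultimately show "\<exists>u v. a \<le> u \<and> u < v \<and> v \<le> b \<and> u \<le> t \<and> t \<le> v \<and> v - u < \<delta> \<and> 2 * c * (v - u) \<le> w v - w u"
      using xy ab by blast
  qed (use \<open>c > 0\<close> in auto)
  then obtain T where T: "?E - X \<subseteq> T" "T \<in> lmeasurable" "measure lebesgue T \<le> (w b - w a) / (2 * c)"
    by blast
  have X: "negligible X"
    by (auto simp: X_def intro: negligible_finite)
  have "(w b - w a) / (2 * c) \<le> e"
    using wab \<open>c > 0\<close> by (simp add: field_simps)
  then have "measure lebesgue (T \<union> X) \<le> e"
    using T X by (subst measure_Un_null_set) (auto simp: negligible_iff_null_sets)
  moreover have "T \<union> X \<in> lmeasurable"
    using T X by (auto intro: negligible_imp_measurable)
  ultimately show "\<exists>T. ?E \<subseteq> T \<and> T \<in> lmeasurable \<and> measure lebesgue T \<le> e"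
    using T(1) by blast
qed

text \<open>The length function \<open>v\<close> dominates the increments of \<open>f\<close>, so at
  these points it has arbitrarily short chords of slope at least any given \<open>c\<close>.
  Covering leaves measure at most \<open>(v b - v a) / c\<close>, and \<open>c\<close> is taken
  large in terms of \<open>e\<close>.\<close>

lemma negligible_unbounded_slopes:
  fixes f :: "real \<Rightarrow> real"
  assumes ac: "absolutely_continuous_curve a b f" and "a \<le> b"
  shows "negligible {t \<in> {a<..<b}. \<forall>M. \<exists>\<^sub>F h in at 0. \<bar>(f (t + h) - f t) / h\<bar> \<ge> M}" (is "negligible ?E")
  unfolding negligible_outer_le
proof (intro allI impI)
  fix e :: real
  assume "e > 0"
  define v where "v t = enn2real (curve_length f a t)" for t
  have v: "\<bar>f t - f s\<bar> \<le> v t - v s" if "a \<le> s" "s \<le> t" "t \<le> b" for s t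
    using absolutely_continuous_curve_length_function[OF ac that] by (simp add: v_def dist_real_def abs_minus_commute)
  have w: "mono_on {a..b} v"
    by (rule mono_onI) (use v in force)
  define c where "c = (v b - v a) / e + 1"
  have "v a \<le> v b"
    using mono_onD[OF w] \<open>a \<le> b\<close> by auto
  then have c: "c > 0" "(v b - v a) / c \<le> e"
    using \<open>e > 0\<close> by (auto simp: c_def field_simps add_pos_nonneg intro!: add_nonneg_pos)
  have "\<exists>T. ?E \<subseteq> T \<and> T \<in> lmeasurable \<and> measure lebesgue T \<le> (v b - v a) / c"
  proof (rule vitali_cover_mono[OF w \<open>a \<le> b\<close> c(1)])
    fix t \<delta> :: real
    assume t: "t \<in> ?E" and "\<delta> > 0"
    define d where "d = min \<delta> (min (t - a) (b - t))"
    have d: "d > 0"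
      using t \<open>\<delta> > 0\<close> by (simp add: d_def)
    have freq: "\<exists>\<^sub>F h in at 0. \<bar>(f (t + h) - f t) / h\<bar> \<ge> c"
      using t by auto
    have ev: "\<forall>\<^sub>F h in at 0. h \<noteq> 0 \<and> \<bar>h\<bar> < d"
      using d by (auto simp: eventually_at intro!: exI[of _ d])
    obtain h where h: "\<bar>(f (t + h) - f t) / h\<bar> \<ge> c" "h \<noteq> 0" "\<bar>h\<bar> < d"
      using frequently_ex[OF frequently_eventually_frequently[OF freq ev]] by auto
    define x y where "x = min t (t + h)" and "y = max t (t + h)"
    have xy: "x < y" "y - x = \<bar>h\<bar>" "x \<le> t" "t \<le> y" "a \<le> x" "y \<le> b"
      using h by (auto simp: x_def y_def d_def)
    have "c * (y - x) \<le> \<bar>f (t + h) - f t\<bar>"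
      using h xy by (simp add: field_simps)
    also have "\<dots> = \<bar>f y - f x\<bar>"
      by (auto simp: x_def y_def min_def max_def)
    also have "\<dots> \<le> v y - v x"
      using v xy by simp
    finally show "\<exists>u w. a \<le> u \<and> u < w \<and> w \<le> b \<and> u \<le> t \<and> t \<le> w \<and> w - u < \<delta> \<and> c * (w - u) \<le> v w - v u"
      using xy h by (intro exI[of _ x] exI[of _ y]) (auto simp: d_def)
  qed
  then show "\<exists>T. ?E \<subseteq> T \<and> T \<in> lmeasurable \<and> measure lebesgue T \<le> e"
    using c(2) order_trans by blast
qed

text \<open>A gap between lower and upper limit leaves room for \<mu> and \<open>c\<close> such that
  \<open>q\<close> is frequently below \<mu> - c and frequently above \<mu> + c. Both can be taken
  rational, so that only countably many exceptional sets arise when this is applied to difference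
  quotients.\<close>

lemma tendsto_of_bounded_no_oscillation:
  fixes q :: "real \<Rightarrow> real"
  assumes F: "F \<noteq> bot" and M: "\<forall>\<^sub>F h in F. \<bar>q h\<bar> \<le> M"
    and osc: "\<And>\<mu> c. \<mu> \<in> \<rat> \<Longrightarrow> c \<in> \<rat> \<Longrightarrow> c > 0 \<Longrightarrow> \<not> ((\<exists>\<^sub>F h in F. q h - \<mu> \<le> - c) \<and> (\<exists>\<^sub>F h in F. q h - \<mu> \<ge> c))"
  shows "\<exists>l. (q \<longlongrightarrow> l) F"
proof -
  define l u where "l = Liminf F (\<lambda>h. ereal (q h))" and "u = Limsup F (\<lambda>h. ereal (q h))"
  have lM: "ereal (- M) \<le> l"
    unfolding l_def using M by (intro Liminf_bounded) (auto elim: eventually_mono)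
  have uM: "u \<le> ereal M"
    unfolding u_def using M by (intro Limsup_bounded) (auto elim: eventually_mono)
  have lu: "l \<le> u"
    unfolding l_def u_def by (rule Liminf_le_Limsup[OF F])
  have "l = u"
  proof (rule ccontr)
    assume "l \<noteq> u"
    with lu have "l < u" by simp
    obtain l' u' where lu': "l = ereal l'" "u = ereal u'"
      using lM uM lu by (cases l; cases u) auto
    with \<open>l < u\<close> have "l' < u'" by simp
    define \<delta> where "\<delta> = (u' - l') / 4"
    have \<delta>: "\<delta> > 0" using \<open>l' < u'\<close> by (simp add: \<delta>_def)
    obtain \<mu> where \<mu>: "\<mu> \<in> \<rat>" "l' + 3 / 2 * \<delta> < \<mu>" "\<mu> < u' - 3/2 * \<delta>"
      using Rats_dense_in_real[of "l' + 3/2 * \<delta>" "u' - 3/2 * \<delta>"] \<delta> by (auto simp: \<delta>_def field_simps)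
    obtain c where c: "c \<in> \<rat>" "0 < c" "c < \<delta>"
      using Rats_dense_in_real[OF \<delta>] by auto
    have "\<exists>\<^sub>F h in F. q h - \<mu> \<le> - c"
    proof (rule ccontr)
      assume "\<not> ?thesis"
      then have "\<forall>\<^sub>F h in F. ereal (\<mu> - c) \<le> ereal (q h)"
        unfolding frequently_def not_not by (auto elim: eventually_mono)
      then have "ereal (\<mu> - c) \<le> l"
        unfolding l_def by (rule Liminf_bounded)
      then show False
        using lu' \<mu> c \<delta> by simp
    qed
    moreover have "\<exists>\<^sub>F h in F. q h - \<mu> \<ge> c"
    proof (rule ccontr)
      assume "\<not> ?thesis"
      then have "\<forall>\<^sub>F h in F. ereal (q h) \<le> ereal (\<mu> + c)"
        unfolding frequently_def not_not by (auto elim: eventually_mono)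
      then have "u \<le> ereal (\<mu> + c)"
        unfolding u_def by (rule Limsup_bounded)
      then show False
        using lu' \<mu> c \<delta> by simp
    qed
    ultimately show False
      using osc \<mu> c by blast
  qed
  obtain l' where l': "l = ereal l'"
    using lM uM \<open>l = u\<close> by (cases l) auto
  have "((\<lambda>h. ereal (q h)) \<longlongrightarrow> ereal l') F"
    using \<open>l = u\<close> l' F by (intro Liminf_eq_Limsup) (auto simp: l_def u_def)
  then show ?thesis
    by auto
qed

text \<open>Where the derivative fails to exist, the difference quotients are unbounded or oscillate
  around some rational \<mu>. Subtracting \<mu> * t from \<open>f\<close> turns the latter into
  slopes of opposite signs.\<close>

lemma absolutely_continuous_curve_differentiable_real:
  fixes f :: "real \<Rightarrow> real"
  assumes ac: "absolutely_continuous_curve a b f" and "a \<le> b"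
  shows "negligible {t \<in> {a<..<b}. \<not> f differentiable (at t)}"
proof -
  define E where "E \<mu> c = {t \<in> {a<..<b}. (\<exists>\<^sub>F h in at 0. (f (t + h) - f t) / h - \<mu> \<le> - c) \<and>
      (\<exists>\<^sub>F h in at 0. (f (t + h) - f t) / h - \<mu> \<ge> c)}" for \<mu> c
  define E0 where "E0 = {t \<in> {a<..<b}. \<forall>M. \<exists>\<^sub>F h in at 0. \<bar>(f (t + h) - f t) / h\<bar> \<ge> M}"
  have E: "negligible (E \<mu> c)" if "c > 0" for \<mu> c
  proof -
    define g where "g t = f t - \<mu> * t" for t
    have "absolutely_continuous_curve a b g"
    proof (rule absolutely_continuous_curve_compose[OF ac])
      show "norm (g t - g s) \<le> 1 * norm (f t - f s) + \<bar>\<mu>\<bar> * (t - s)" if "s \<le> t" for s t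
      proof -
        have "g t - g s = (f t - f s) - \<mu> * (t - s)"
          by (simp add: g_def algebra_simps)
        also have "norm \<dots> \<le> norm (f t - f s) + norm (\<mu> * (t - s))"
          by (rule norm_triangle_ineq4)
        finally show ?thesis
          using that by (simp add: abs_mult)
      qed
    qed
    from negligible_opposed_slopes[OF this \<open>a \<le> b\<close> that]
    have "negligible {t \<in> {a<..<b}. (\<exists>\<^sub>F h in at 0. (g (t + h) - g t) / h \<le> - c) \<and>
      (\<exists>\<^sub>F h in at 0. (g (t + h) - g t) / h \<ge> c)}" (is "negligible ?E'") .
    moreover have "E \<mu> c \<subseteq> ?E'"
    proof -
      have eq: "(g (t + h) - g t) / h = (f (t + h) - f t) / h - \<mu>" if "h \<noteq> 0" for t h
        using that by (simp add: g_def field_simps)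
      have ev: "\<forall>\<^sub>F h in at 0. (h::real) \<noteq> 0"
        by (simp add: eventually_at_filter)
      have "\<exists>\<^sub>F h in at 0. P ((g (t + h) - g t) / h)" if "\<exists>\<^sub>F h in at 0. P ((f (t + h) - f t) / h - \<mu>)" for P t
        using frequently_eventually_frequently[OF that ev]
        by (rule frequently_elim1) (simp add: eq)
      note * = this[of "\<lambda>x. x \<le> - c"] this[of "\<lambda>x. x \<ge> c"]
      show ?thesis
        using * by (auto simp: E_def)
    qed
    ultimately show ?thesis
      using negligible_subset by blast
  qed
  have "negligible E0"
    unfolding E0_def by (rule negligible_unbounded_slopes[OF ac \<open>a \<le> b\<close>])
  moreover have "negligible (\<Union>(\<mu>, c)\<in>\<rat> \<times> {c \<in> \<rat>. c > 0}. E \<mu> c)"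
  proof (rule negligible_countable_Union)
    have "countable {c \<in> \<rat>. (c::real) > 0}"
      by (rule countable_subset[OF _ countable_rat]) auto
    then show "countable ((\<lambda>(\<mu>, c). E \<mu> c) ` (\<rat> \<times> {c \<in> \<rat>. c > 0}))"
      by (intro countable_image countable_SIGMA countable_rat)
  qed (use E in auto)
  moreover have "{t \<in> {a<..<b}. \<not> f differentiable (at t)} \<subseteq> E0 \<union> (\<Union>(\<mu>, c)\<in>\<rat> \<times> {c \<in> \<rat>. c > 0}. E \<mu> c)"
  proof (rule subsetI, rule ccontr)
    fix t
    assume t: "t \<in> {t \<in> {a<..<b}. \<not> f differentiable (at t)}"
      "t \<notin> E0 \<union> (\<Union>(\<mu>, c)\<in>\<rat> \<times> {c \<in> \<rat>. c > 0}. E \<mu> c)"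
    then obtain M where "\<not> (\<exists>\<^sub>F h in at 0. \<bar>(f (t + h) - f t) / h\<bar> \<ge> M)"
      by (auto simp: E0_def)
    then have "\<forall>\<^sub>F h in at 0. \<bar>(f (t + h) - f t) / h\<bar> \<le> M"
      by (auto simp: frequently_def elim: eventually_mono)
    then have "\<exists>l. ((\<lambda>h. (f (t + h) - f t) / h) \<longlongrightarrow> l) (at 0)"
      by (rule tendsto_of_bounded_no_oscillation[rotated]) (use t in \<open>auto simp: E_def\<close>)
    then have "f differentiable (at t)"
      by (auto simp: real_differentiable_def DERIV_def)
    then show False
      using t by simp
  qed
  ultimately show ?thesis
    using negligible_Un negligible_subset by blast
qed

lemma absolutely_continuous_curve_differentiable:
  fixes f :: "real \<Rightarrow> 'a::euclidean_space"
  assumes ac: "absolutely_continuous_curve a b f" and "a \<le> b"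
  shows "negligible {t \<in> {a<..<b}. \<not> f differentiable (at t)}"
proof -
  have "negligible {t \<in> {a<..<b}. \<not> (\<lambda>t. f t \<bullet> i) differentiable (at t)}" if "i \<in> Basis" for i
  proof (rule absolutely_continuous_curve_differentiable_real[OF _ \<open>a \<le> b\<close>])
    show "absolutely_continuous_curve a b (\<lambda>t. f t \<bullet> i)"
    proof (rule absolutely_continuous_curve_compose[OF ac])
      show "norm (f t \<bullet> i - f s \<bullet> i) \<le> 1 * norm (f t - f s) + 0 * (t - s)" for s t
        using Basis_le_norm[OF that, of "f t - f s"] by (simp add: inner_diff_left)
    qed
  qed
  then have "negligible (\<Union>i\<in>Basis. {t \<in> {a<..<b}. \<not> (\<lambda>t. f t \<bullet> i) differentiable (at t)})"
    by (intro negligible_Union) auto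
  moreover have "{t \<in> {a<..<b}. \<not> f differentiable (at t)} \<subseteq>
      (\<Union>i\<in>Basis. {t \<in> {a<..<b}. \<not> (\<lambda>t. f t \<bullet> i) differentiable (at t)})"
    by (auto simp: differentiable_componentwise_within[of f])
  ultimately show ?thesis
    using negligible_subset by blast
qed

text \<open>With the gauge integral, integrability of \<open>f'\<close> need not be shown
  beforehand. Cells tagged outside \<open>N\<close> are handled by differentiability at the tag.
  Cells tagged in \<open>N\<close> contribute 0 to the Riemann sum, as \<open>f'\<close> vanishes
  there; the gauge keeps them inside an open \<open>U\<close> of small measure, so absolute
  continuity makes the increments of \<open>f\<close> over them small.\<close>

lemma absolutely_continuous_curve_has_integral:
  fixes f :: "real \<Rightarrow> real"
  assumes ac: "absolutely_continuous_curve a b f" and "a \<le> b" and N: "negligible N"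
    and der: "\<And>t. t \<in> {a..b} - N \<Longrightarrow> (f has_real_derivative f' t) (at t)"
    and zero: "\<And>t. t \<in> N \<Longrightarrow> f' t = 0"
  shows "(f' has_integral (f b - f a)) {a..b}"
  unfolding has_integral_real
proof (intro allI impI)
  fix e :: real
  assume e: "e > 0"
  define \<kappa> where "\<kappa> = e / (2 * (b - a + 1))"
  have \<kappa>: "\<kappa> > 0" "\<kappa> * (b - a) < e / 2"
    using e \<open>a \<le> b\<close> by (auto simp: \<kappa>_def field_simps)
  have "e / 2 > 0" using e by simp
  then obtain \<eta> where \<eta>: "\<eta> > 0"
    and ac': "\<And>D. finite D \<and> (\<forall>(s, t)\<in>D. a \<le> s \<and> s \<le> t \<and> t \<le> b) \<and>
        disjoint_family_on (\<lambda>(s, t). {s<..<t}) D \<and> (\<Sum>(s, t)\<in>D. t - s) < \<eta> \<Longrightarrow>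
        (\<Sum>(s, t)\<in>D. norm (f t - f s)) < e / 2"
    using ac unfolding absolutely_continuous_curve_def by meson
  obtain U where U: "open U" "N \<subseteq> U" "U \<in> lmeasurable" "measure lebesgue U < \<eta>"
  proof -
    have "N \<in> sets lebesgue"
      using N by (simp add: negligible_imp_sets)
    then obtain T where T: "open T" "N \<subseteq> T" "T - N \<in> lmeasurable" "emeasure lebesgue (T - N) < ennreal \<eta>"
      using sets_lebesgue_outer_open \<eta> by metis
    have "T = (T - N) \<union> N" using T by blast
    then have "T \<in> lmeasurable" "measure lebesgue T = measure lebesgue (T - N)"
      using T(3) N fmeasurable.Un[OF T(3) negligible_imp_measurable[OF N]]
        measure_Un_null_set[of "T - N" lebesgue N] by (auto simp: negligible_iff_null_sets)
    moreover have "measure lebesgue (T - N) < \<eta>"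
      using T(3,4) \<eta> by (simp add: emeasure_eq_measure2 ennreal_less_iff)
    ultimately show ?thesis
      using that T by auto
  qed
  have "\<exists>d>0. \<forall>y. \<bar>y - t\<bar> < d \<longrightarrow> \<bar>f y - f t - f' t * (y - t)\<bar> \<le> \<kappa> * \<bar>y - t\<bar>" if "t \<in> {a..b} - N" for t
    using der[OF that] \<kappa>(1) unfolding has_field_derivative_def has_derivative_at_alt by auto
  then obtain d where d: "\<And>t. t \<in> {a..b} - N \<Longrightarrow> d t > 0"
    "\<And>t y. t \<in> {a..b} - N \<Longrightarrow> \<bar>y - t\<bar> < d t \<Longrightarrow> \<bar>f y - f t - f' t * (y - t)\<bar> \<le> \<kappa> * \<bar>y - t\<bar>"
    by metis
  define \<gamma> where "\<gamma> t = (if t \<in> N then U else if t \<in> {a..b} then ball t (d t) else UNIV)" for t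
  have gauge: "gauge \<gamma>"
    unfolding gauge_def \<gamma>_def using U d(1) by (auto simp: subset_iff)
  have est: "norm ((\<Sum>(x, K)\<in>D. measure lborel K *\<^sub>R f' x) - (f b - f a)) < e"
    if D: "D tagged_division_of {a..b}" and fine: "\<gamma> fine D" for D
  proof -
    note Dp = tagged_division_ofD[OF D]
    have finD: "finite D" by (rule Dp(1))
    have el: "\<exists>u v. K = {u..v} \<and> u \<le> v \<and> x \<in> {u..v} \<and> a \<le> u \<and> v \<le> b" if xK: "(x, K) \<in> D" for x K
    proof -
      obtain u v where "K = cbox u v" using Dp(4)[OF xK] by blast
      then show ?thesis
        using Dp(2)[OF xK] Dp(3)[OF xK] by (auto simp: atLeastatMost_subset_iff)
    qed
    define D1 where "D1 = {z \<in> D. fst z \<in> N}"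
    define D2 where "D2 = {z \<in> D. fst z \<notin> N}"
    define T where "T = (\<lambda>(x, K). measure lborel K *\<^sub>R f' x - (f (Sup K) - f (Inf K)))"
    have "(\<Sum>(x, K)\<in>D. measure lborel K *\<^sub>R f' x) - (f b - f a) = sum T D"
      using additive_tagged_division_1[OF \<open>a \<le> b\<close> D, of f]
      by (simp add: T_def case_prod_unfold sum_subtractf)
    also have "\<dots> = sum T D1 + sum T D2"
      using finD by (subst sum.union_disjoint[symmetric]) (auto simp: D1_def D2_def intro!: sum.cong)
    finally have split: "(\<Sum>(x, K)\<in>D. measure lborel K *\<^sub>R f' x) - (f b - f a) = sum T D1 + sum T D2" .
    have "\<bar>sum T D2\<bar> \<le> (\<Sum>(x, K)\<in>D2. \<kappa> * measure lborel K)"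
    proof (rule order_trans[OF sum_abs sum_mono])
      fix z assume z: "z \<in> D2"
      obtain x K where xK: "z = (x, K)" by (cases z)
      with z have "(x, K) \<in> D" "x \<notin> N" by (auto simp: D2_def)
      from el[OF this(1)] obtain u v where uv: "K = {u..v}" "u \<le> v" "x \<in> {u..v}" "a \<le> u" "v \<le> b"
        by blast
      have "K \<subseteq> ball x (d x)"
        using fineD[OF fine \<open>(x, K) \<in> D\<close>] \<open>x \<notin> N\<close> uv by (simp add: \<gamma>_def)
      moreover have "u \<in> K" "v \<in> K"
        using uv by auto
      ultimately have "u \<in> ball x (d x)" "v \<in> ball x (d x)"
        by blast+
      then have "\<bar>u - x\<bar> < d x" "\<bar>v - x\<bar> < d x"
        by (simp_all add: dist_real_def abs_minus_commute)
      then have "\<bar>f u - f x - f' x * (u - x)\<bar> \<le> \<kappa> * \<bar>u - x\<bar>" "\<bar>f v - f x - f' x * (v - x)\<bar> \<le> \<kappa> * \<bar>v - x\<bar>"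
        using d(2)[of x u] d(2)[of x v] uv \<open>x \<notin> N\<close> by auto
      then have "\<bar>f u - f x - f' x * (u - x)\<bar> \<le> \<kappa> * (x - u)" "\<bar>f v - f x - f' x * (v - x)\<bar> \<le> \<kappa> * (v - x)"
        using uv by auto
      moreover have "(v - u) * f' x - (f v - f u) = (f u - f x - f' x * (u - x)) - (f v - f x - f' x * (v - x))"
        by (simp add: algebra_simps)
      ultimately have "\<bar>(v - u) * f' x - (f v - f u)\<bar> \<le> \<kappa> * (x - u) + \<kappa> * (v - x)"
        by linarith
      also have "\<dots> = \<kappa> * (v - u)"
        by (simp add: algebra_simps)
      finally show "\<bar>T z\<bar> \<le> (case z of (x, K) \<Rightarrow> \<kappa> * measure lborel K)"
        using uv xK by (simp add: T_def)
    qed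
    also have "\<dots> \<le> (\<Sum>(x, K)\<in>D. \<kappa> * measure lborel K)"
      using finD \<kappa> by (intro sum_mono2) (auto simp: D2_def)
    also have "\<dots> = \<kappa> * (b - a)"
      using additive_content_tagged_division[of D a b] D \<open>a \<le> b\<close>
      by (simp add: sum_distrib_left[symmetric] case_prod_unfold)
    finally have T2: "\<bar>sum T D2\<bar> < e / 2"
      using \<kappa>(2) by linarith
    have D1: "D1 tagged_partial_division_of {a..b}"
    proof (rule tagged_partial_division_subset)
      show "D tagged_partial_division_of {a..b}"
        using D by (simp add: tagged_division_of_def)
    qed (auto simp: D1_def)
    note div = partial_division_of_tagged_division[OF D1]
    define \<K> where "\<K> = {K \<in> snd ` D1. Inf K < Sup K}"
    have K: "\<exists>x u v. (x, K) \<in> D1 \<and> K = {u..v} \<and> u \<le> v \<and> a \<le> u \<and> v \<le> b \<and> K \<subseteq> U" if KD: "K \<in> snd ` D1" for K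
    proof -
      obtain x where x: "(x, K) \<in> D1" using KD by auto
      then have "(x, K) \<in> D" "x \<in> N" by (auto simp: D1_def)
      then have "K \<subseteq> U"
        using fineD[OF fine, of x K] by (simp add: \<gamma>_def)
      with el[OF \<open>(x, K) \<in> D\<close>] x show ?thesis
        by blast
    qed
    have KI: "K = {Inf K..Sup K}" "a \<le> Inf K" "Sup K \<le> b" "Inf K \<le> Sup K" "K \<subseteq> U" "measure lborel K = Sup K - Inf K" if KD: "K \<in> snd ` D1" for K
    proof -
      obtain u v where "K = {u..v}" "u \<le> v" "a \<le> u" "v \<le> b" "K \<subseteq> U"
        using K[OF KD] by blast
      then show "K = {Inf K..Sup K}" "a \<le> Inf K" "Sup K \<le> b" "Inf K \<le> Sup K" "K \<subseteq> U"
        "measure lborel K = Sup K - Inf K"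
        by simp_all
    qed
    have finK: "finite \<K>" "finite (snd ` D1)"
      using finD by (auto simp: \<K>_def D1_def intro: finite_subset[of _ D])
    define P where "P = (\<lambda>K. (Inf K, Sup K)) ` \<K>"
    have inj: "inj_on (\<lambda>K. (Inf K, Sup K)) \<K>"
    proof (rule inj_onI)
      fix K L assume KL: "K \<in> \<K>" "L \<in> \<K>" "(Inf K, Sup K) = (Inf L, Sup L)"
      have "K = {Inf K..Sup K}" "L = {Inf L..Sup L}"
        using KL(1,2) by (auto simp: \<K>_def simp flip: KI(1))
      with KL(3) show "K = L"
        by simp
    qed
    \<comment> \<open>Replacing the sum over tagged cells by a sum over cells requires
      \<open>V\<close> to vanish on all boxes with empty interior, among them the empty box, whose
      \<open>Sup\<close> and \<open>Inf\<close> carry no information.\<close>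
    define V where "V K = (if K = {} then 0 else \<bar>f (Sup K) - f (Inf K)\<bar>)" for K
    have "\<bar>sum T D1\<bar> \<le> (\<Sum>(x, K)\<in>D1. V K)"
    proof (rule order_trans[OF sum_abs sum_mono])
      fix z assume "z \<in> D1"
      then have "snd z \<noteq> {}" "f' (fst z) = 0"
        using Dp(2)[of "fst z" "snd z"] zero by (auto simp: D1_def)
      then show "\<bar>T z\<bar> \<le> (case z of (x, K) \<Rightarrow> V K)"
        by (simp add: T_def V_def case_prod_unfold)
    qed
    also have "\<dots> = (\<Sum>K\<in>snd ` D1. V K)"
    proof (rule sum.over_tagged_division_lemma[OF tagged_partial_division_of_Union_self[OF D1]])
      fix u v :: real assume "box u v = {}"
      then show "V (cbox u v) = 0"
        by (cases "u = v") (auto simp: V_def)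
    qed
    also have "\<dots> = (\<Sum>K\<in>snd ` D1. \<bar>f (Sup K) - f (Inf K)\<bar>)"
    proof (rule sum.cong)
      fix K assume "K \<in> snd ` D1"
      then have "K \<noteq> {}"
        using KI(1,4) by (metis atLeastatMost_empty_iff)
      then show "V K = \<bar>f (Sup K) - f (Inf K)\<bar>"
        by (simp add: V_def)
    qed simp
    also have "\<dots> = (\<Sum>K\<in>\<K>. \<bar>f (Sup K) - f (Inf K)\<bar>)"
    proof (rule sum.mono_neutral_right)
      show "\<forall>K\<in>snd ` D1 - \<K>. \<bar>f (Sup K) - f (Inf K)\<bar> = 0"
      proof
        fix K assume "K \<in> snd ` D1 - \<K>"
        then have "Sup K = Inf K"
          using KI(4)[of K] by (simp add: \<K>_def)
        then show "\<bar>f (Sup K) - f (Inf K)\<bar> = 0" by simp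
      qed
    qed (auto simp: finK \<K>_def)
    also have "\<dots> = (\<Sum>(s, t)\<in>P. norm (f t - f s))"
      unfolding P_def by (subst sum.reindex[OF inj]) simp
    also have "\<dots> < e / 2"
    proof (rule ac', intro conjI)
      show "finite P" by (simp add: P_def finK)
      show "\<forall>(s, t)\<in>P. a \<le> s \<and> s \<le> t \<and> t \<le> b"
        using KI by (auto simp: P_def \<K>_def)
      show "disjoint_family_on (\<lambda>(s, t). {s<..<t}) P"
        unfolding disjoint_family_on_def P_def
      proof (intro ballI impI)
        fix p q assume "p \<in> (\<lambda>K. (Inf K, Sup K)) ` \<K>" "q \<in> (\<lambda>K. (Inf K, Sup K)) ` \<K>" "p \<noteq> q"
        then obtain K L where "K \<in> \<K>" "L \<in> \<K>" and pq: "p = (Inf K, Sup K)" "q = (Inf L, Sup L)"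
          by (elim imageE)
        then have KL: "K \<in> snd ` D1" "L \<in> snd ` D1" "K \<noteq> L"
          using \<open>p \<noteq> q\<close> by (auto simp: \<K>_def)
        then have "interior K \<inter> interior L = {}"
          using division_ofD(5)[OF div] by blast
        then have "interior {Inf K..Sup K} \<inter> interior {Inf L..Sup L} = {}"
          using KI(1)[OF KL(1)] KI(1)[OF KL(2)] by simp
        then show "(case p of (s, t) \<Rightarrow> {s<..<t}) \<inter> (case q of (s, t) \<Rightarrow> {s<..<t}) = {}"
          using pq by (simp add: interior_atLeastAtMost_real)
      qed
      have "(\<Sum>(s, t)\<in>P. t - s) = (\<Sum>K\<in>\<K>. measure lborel K)"
        unfolding P_def by (subst sum.reindex[OF inj]) (simp add: KI(6) \<K>_def)
      also have "\<dots> \<le> (\<Sum>K\<in>snd ` D1. measure lborel K)"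
        by (rule sum_mono2) (auto simp: finK \<K>_def)
      also have "\<dots> = measure lebesgue (\<Union>(snd ` D1))"
      proof -
        have "measure lborel K = measure lebesgue K" if "K \<in> snd ` D1" for K
        proof -
          have "K \<in> sets lborel"
            using KI(1)[OF that] by (metis atLeastAtMost_borel sets_lborel)
          then show ?thesis
            by (simp add: measure_completion)
        qed
        then show ?thesis
          using content_division[OF div] by simp
      qed
      also have "\<dots> \<le> measure lebesgue U"
      proof (rule measure_mono_fmeasurable)
        show "\<Union>(snd ` D1) \<subseteq> U"
          using KI(5) by blast
        have "closed (\<Union>(snd ` D1))"
          by (intro closed_Union ballI finK) (metis KI(1) closed_atLeastAtMost)
        then show "\<Union>(snd ` D1) \<in> sets lebesgue" by simp
      qed (rule U)
      finally show "(\<Sum>(s, t)\<in>P. t - s) < \<eta>"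
        using U(4) by linarith
    qed
    finally have "\<bar>sum T D1\<bar> < e / 2" .
    with T2 show ?thesis
      unfolding split real_norm_def by linarith
  qed
  show "\<exists>\<gamma>. gauge \<gamma> \<and> (\<forall>D. D tagged_division_of {a..b} \<and> \<gamma> fine D \<longrightarrow>
      norm ((\<Sum>(x, K)\<in>D. measure lborel K *\<^sub>R f' x) - (f b - f a)) < e)"
  proof (intro exI[of _ \<gamma>] conjI allI impI)
    fix D assume "D tagged_division_of {a..b} \<and> \<gamma> fine D"
    then show "norm ((\<Sum>(x, K)\<in>D. measure lborel K *\<^sub>R f' x) - (f b - f a)) < e"
      using est[of D] by blast
  qed (rule gauge)
qed

text \<open>No measurability of \<open>g\<close> is assumed, since monotonicity of
  \<open>nn_integral\<close> does not ask for it: only the derivative of \<open>f\<close>,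
  measurable as a gauge integrable function, is integrated properly. If its absolute value has
  infinite integral, so has \<open>g\<close>.\<close>

lemma absolutely_continuous_curve_increment_le_nn_integral:
  fixes f :: "real \<Rightarrow> real" and g :: "real \<Rightarrow> ennreal"
  assumes ac: "absolutely_continuous_curve a b f" and "a \<le> b" and N: "negligible N"
    and der: "\<And>t. t \<in> {a<..<b} - N \<Longrightarrow> \<exists>D. (f has_real_derivative D) (at t) \<and> ennreal \<bar>D\<bar> \<le> g t"
  shows "ennreal \<bar>f b - f a\<bar> \<le> (\<integral>\<^sup>+t\<in>{a..b}. g t \<partial>lebesgue)"
proof -
  from der obtain D where D: "\<And>t. t \<in> {a<..<b} - N \<Longrightarrow> (f has_real_derivative D t) (at t)"
    "\<And>t. t \<in> {a<..<b} - N \<Longrightarrow> ennreal \<bar>D t\<bar> \<le> g t"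
    by metis
  define f' where "f' t = (if t \<in> N \<union> {a, b} then 0 else D t)" for t
  have int: "(f' has_integral (f b - f a)) {a..b}"
  proof (rule absolutely_continuous_curve_has_integral[OF ac \<open>a \<le> b\<close>])
    show "negligible (N \<union> {a, b})"
      by (rule negligible_Un[OF N]) (simp add: negligible_finite)
  qed (auto simp: f'_def intro!: D)
  let ?M = "lebesgue_on {a..b}"
  have "(\<integral>\<^sup>+t. ennreal (norm (f' t)) \<partial>?M) = (\<integral>\<^sup>+t. ennreal (norm (f' t)) * indicator {a..b} t \<partial>lebesgue)"
    by (rule nn_integral_restrict_space) auto
  also have "\<dots> \<le> (\<integral>\<^sup>+t\<in>{a..b}. g t \<partial>lebesgue)"
    by (intro nn_integral_mono) (auto simp: f'_def indicator_def intro!: D)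
  finally have le: "(\<integral>\<^sup>+t. ennreal (norm (f' t)) \<partial>?M) \<le> (\<integral>\<^sup>+t\<in>{a..b}. g t \<partial>lebesgue)" .
  show ?thesis
  proof (cases "(\<integral>\<^sup>+t. ennreal (norm (f' t)) \<partial>?M) < \<infinity>")
    case True
    have "f' \<in> borel_measurable ?M"
      using int by (intro integrable_imp_measurable) blast
    with True have f': "integrable ?M f'"
      by (simp add: integrable_iff_bounded)
    then have "f b - f a = integral\<^sup>L ?M f'"
      using has_integral_unique[OF int has_integral_integral_lebesgue_on[OF f']] by simp
    then have "ennreal \<bar>f b - f a\<bar> \<le> (\<integral>\<^sup>+t. ennreal (norm (f' t)) \<partial>?M)"
      using integral_norm_bound_ennreal[OF f'] by simp
    with le show ?thesis by simp
  next
    case False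
    with le have "(\<integral>\<^sup>+t\<in>{a..b}. g t \<partial>lebesgue) = \<infinity>"
      by (simp add: top.extremum_unique less_top[symmetric])
    then show ?thesis by simp
  qed
qed

section \<open>The Kobayashi metric of a convex domain\<close>

text \<open>The Cayley transform that sends \<open>h 0\<close> to 0 maps the right half plane into
  the unit disc; the Schwarz lemma for the composition \<open>g\<close> is the claim.\<close>

lemma deriv_bound_half_plane:
  assumes h: "h holomorphic_on ball 0 1" and pos: "\<And>z. z \<in> ball 0 1 \<Longrightarrow> 0 < Re (h z)"
  shows "norm (deriv h 0) \<le> 2 * Re (h 0)"
proof -
  define g where "g z = (h z - h 0) / (h z + cnj (h 0))" for z
  have r0: "Re (h 0) > 0"
    using pos[of 0] by simp
  have nz: "h z + cnj (h 0) \<noteq> 0" if "z \<in> ball 0 1" for z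
  proof -
    have "Re (h z + cnj (h 0)) > 0"
      using pos[OF that] r0 by simp
    then show ?thesis
      by (metis less_irrefl zero_complex.sel(1))
  qed
  have g: "g holomorphic_on ball 0 1"
    unfolding g_def using h nz by (intro holomorphic_intros) auto
  have g1: "norm (g z) < 1" if "norm z < 1" for z
  proof -
    have "Re (h z) > 0"
      using pos[of z] that by simp
    then have "0 < 4 * (Re (h z) * Re (h 0))"
      using r0 by simp
    also have "\<dots> = (norm (h z + cnj (h 0)))\<^sup>2 - (norm (h z - h 0))\<^sup>2"
      unfolding cmod_power2 by (simp add: power2_eq_square algebra_simps)
    finally have "norm (h z - h 0) < norm (h z + cnj (h 0))"
      by (simp add: power2_less_imp_less)
    moreover have "norm (h z + cnj (h 0)) > 0"
      using nz[of z] that by simp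
    ultimately show ?thesis
      by (simp add: g_def norm_divide)
  qed
  have "norm (deriv g 0) \<le> 1"
    by (rule Schwarz_Lemma(2)[OF g _ g1, of 0]) (auto simp: g_def)
  moreover have "deriv g 0 = deriv h 0 / (2 * Re (h 0))"
  proof (rule DERIV_imp_deriv)
    have dh: "(h has_field_derivative deriv h 0) (at 0)"
      using h by (intro holomorphic_derivI[of h "ball 0 1"]) auto
    have s: "h 0 + cnj (h 0) = 2 * Re (h 0)"
      by (simp add: complex_add_cnj)
    have "(g has_field_derivative
        (deriv h 0 * (h 0 + cnj (h 0)) - (h 0 - h 0) * deriv h 0) / ((h 0 + cnj (h 0)) * (h 0 + cnj (h 0)))) (at 0)"
      unfolding g_def using nz[of 0] by (auto intro!: derivative_eq_intros dh)
    then show "(g has_field_derivative deriv h 0 / (2 * Re (h 0))) (at 0)"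
      unfolding s using r0 by simp
  qed
  ultimately show ?thesis
    using r0 by (simp add: norm_divide divide_le_eq norm_mult)
qed

text \<open>The complex linear functional whose real part is the real functional
  \<open>z \<bullet> n\<close>. Composed with a holomorphic disc it is holomorphic, and it maps a
  real half space with normal \<open>n\<close> into a half plane.\<close>

definition hermitian_form :: "complex ^ 'n \<Rightarrow> complex ^ 'n \<Rightarrow> complex" where
  "hermitian_form n z = (\<Sum>j\<in>UNIV. cnj (n $ j) * z $ j)"

lemma Re_hermitian_form: "Re (hermitian_form n z) = z \<bullet> n"
  by (simp add: hermitian_form_def inner_vec_def inner_complex_def algebra_simps)

lemma inner_le_norm_hermitian_form: "\<bar>z \<bullet> n\<bar> \<le> norm (hermitian_form n z)"
  by (metis Re_hermitian_form abs_Re_le_cmod)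

lemma hermitian_form_scale: "hermitian_form n (c *s z) = c * hermitian_form n z"
  by (simp add: hermitian_form_def sum_distrib_left algebra_simps)

lemma norm_vector_smult: "norm (c *s v) = norm c * norm (v :: complex ^ 'n)"
  by (simp add: norm_vec_def norm_mult L2_set_right_distrib)

lemma bdd_below_kobayashi:
  "bdd_below {norm \<xi> | \<xi> (f :: complex \<Rightarrow> complex ^ 'n). P \<xi> f}"
  by (rule bdd_belowI[of _ 0]) auto

locale bounded_convex_domain =
  fixes \<Omega> :: "(complex ^ 'n) set"
  assumes open_dom: "open \<Omega>" and nonempty_dom: "\<Omega> \<noteq> {}"
    and bounded_dom: "bounded \<Omega>" and convex_dom: "convex \<Omega>"
begin

abbreviation \<delta> :: "complex ^ 'n \<Rightarrow> real" where
  "\<delta> \<equiv> bdist \<Omega>"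

lemma frontier_nonempty: "frontier \<Omega> \<noteq> {}"
  using nonempty_dom bounded_dom not_bounded_UNIV by (auto simp: frontier_eq_empty)

lemma frontier_disjoint: "z \<in> \<Omega> \<Longrightarrow> z \<notin> frontier \<Omega>"
  using open_dom by (simp add: frontier_def interior_open)

lemma bdist_pos: "z \<in> \<Omega> \<Longrightarrow> 0 < \<delta> z"
  unfolding bdist_def
  by (intro infdist_pos_not_in_closed frontier_nonempty frontier_closed frontier_disjoint)

lemma bdist_le_dist: "q \<in> frontier \<Omega> \<Longrightarrow> \<delta> z \<le> dist z q"
  unfolding bdist_def by (rule infdist_le)

lemma bdist_nearest: obtains q where "q \<in> frontier \<Omega>" "\<delta> z = dist z q"
  unfolding bdist_def using infdist_attains_inf[OF frontier_closed frontier_nonempty] by blast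

lemma continuous_on_bdist: "continuous_on S \<delta>"
  unfolding bdist_def by (intro continuous_intros)

lemma bdist_ball_subset:
  assumes "z \<in> \<Omega>"
  shows "ball z (\<delta> z) \<subseteq> \<Omega>"
proof (rule ccontr)
  assume "\<not> ?thesis"
  then have "ball z (\<delta> z) \<inter> frontier \<Omega> \<noteq> {}"
    using bdist_pos[OF assms] assms centre_in_ball[of z "\<delta> z"] by (intro connected_Int_frontier) blast+
  then obtain q where "q \<in> frontier \<Omega>" "dist z q < \<delta> z"
    by auto
  then show False
    using bdist_le_dist[of q z] by simp
qed

text \<open>A supporting hyperplane at \<open>q\<close> gives only nonnegativity. The better bound
  holds because the whole ball of radius \<open>\<delta> z\<close> around \<open>z\<close> lies on
  the same side, so that \<open>z\<close> can be moved by almost \<open>\<delta> z\<close> against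
  the normal.\<close>

lemma support_normal:
  assumes q: "q \<in> frontier \<Omega>"
  obtains n where "norm n = 1" "\<And>z. z \<in> \<Omega> \<Longrightarrow> \<delta> z \<le> (z - q) \<bullet> n"
proof -
  have "q \<in> closure \<Omega>" "q \<notin> rel_interior \<Omega>"
    using q open_dom nonempty_dom by (auto simp: frontier_def rel_interior_open interior_open)
  then obtain a where a: "a \<noteq> 0" "\<And>y. y \<in> closure \<Omega> \<Longrightarrow> a \<bullet> q \<le> a \<bullet> y"
    using supporting_hyperplane_relative_frontier[OF convex_dom] by metis
  define n where "n = a /\<^sub>R norm a"
  have n1: "norm n = 1"
    using a(1) by (simp add: n_def)
  have nn: "0 \<le> (y - q) \<bullet> n" if "y \<in> \<Omega>" for y
  proof -
    have "a \<bullet> q \<le> a \<bullet> y"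
      using a(2)[of y] that closure_subset by blast
    then show ?thesis
      by (simp add: n_def inner_diff_left inner_diff_right inner_commute)
  qed
  have "\<delta> z \<le> (z - q) \<bullet> n" if z: "z \<in> \<Omega>" for z
  proof (rule dense_le)
    fix s assume s: "s < \<delta> z"
    show "s \<le> (z - q) \<bullet> n"
    proof (cases "s \<ge> 0")
      case True
      have "z - s *\<^sub>R n \<in> ball z (\<delta> z)"
        using s True n1 by (simp add: dist_norm)
      then have "0 \<le> (z - s *\<^sub>R n - q) \<bullet> n"
        using bdist_ball_subset[OF z] by (intro nn) auto
      also have "\<dots> = (z - q) \<bullet> n - s * (n \<bullet> n)"
        by (simp add: algebra_simps inner_diff_left)
      also have "n \<bullet> n = 1"
        using n1 by (simp add: norm_eq_1)
      finally show ?thesis by simp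
    next
      case False
      with nn[OF z] show ?thesis by simp
    qed
  qed
  with n1 show ?thesis
    by (rule that)
qed

text \<open>The support function at a boundary point nearest to \<open>z\<close> is affine,
  dominates \<delta> on the domain, and at \<open>z\<close> is at most
  \<open>\<delta> z\<close>.\<close>

lemma bdist_concave:
  assumes "x \<in> \<Omega>" "y \<in> \<Omega>" "0 \<le> t" "t \<le> 1"
  shows "(1 - t) * \<delta> x + t * \<delta> y \<le> \<delta> (x + t *\<^sub>R (y - x))"
proof -
  define z where "z = x + t *\<^sub>R (y - x)"
  obtain q where q: "q \<in> frontier \<Omega>" "\<delta> z = dist z q"
    by (rule bdist_nearest)
  obtain n where n: "norm n = 1" "\<And>z. z \<in> \<Omega> \<Longrightarrow> \<delta> z \<le> (z - q) \<bullet> n"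
    using support_normal[OF q(1)] by blast
  have "(1 - t) * \<delta> x + t * \<delta> y \<le> (1 - t) * ((x - q) \<bullet> n) + t * ((y - q) \<bullet> n)"
    using assms n(2) by (intro add_mono mult_left_mono) auto
  also have "\<dots> = (z - q) \<bullet> n"
    by (simp add: z_def inner_diff_left inner_add_left algebra_simps)
  also have "\<dots> \<le> norm (z - q)"
    using norm_cauchy_schwarz[of "z - q" n] n(1) by simp
  finally show ?thesis
    using q(2) by (simp add: z_def dist_norm)
qed

lemma segment_in_dom:
  assumes "x \<in> \<Omega>" "y \<in> \<Omega>" "0 \<le> t" "t \<le> 1"
  shows "x + t *\<^sub>R (y - x) \<in> \<Omega>"
  using convexD_alt[OF convex_dom assms] by (simp add: algebra_simps)

text \<open>The three bounds share the affine disc of radius \<open>\<delta> z\<close> in direction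
  \<open>v\<close>: it gives the upper bound and shows that the infimum runs over a nonempty set,
  without which the lower bounds could not be read off. For the half plane bound, each competing
  disc is composed with the complex functional of \<open>n\<close>.\<close>

lemma
  assumes z: "z \<in> \<Omega>"
  shows kobayashi_metric_nonneg: "0 \<le> kobayashi_metric \<Omega> z v"
    and kobayashi_metric_le: "kobayashi_metric \<Omega> z v \<le> norm v / \<delta> z"
    and kobayashi_metric_ge_half_plane: "(\<And>w. w \<in> \<Omega> \<Longrightarrow> 0 < (w - q) \<bullet> n) \<Longrightarrow>
      norm (hermitian_form n v) \<le> 2 * ((z - q) \<bullet> n) * kobayashi_metric \<Omega> z v"
proof -
  define A where "A = {norm \<xi> | \<xi> (f :: complex \<Rightarrow> complex ^ 'n).
            (\<forall>j. (\<lambda>\<zeta>. f \<zeta> $ j) holomorphic_on ball 0 1) \<and> f ` ball 0 1 \<subseteq> \<Omega> \<and> f 0 = z \<and>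
            \<xi> *s (\<chi> j. deriv (\<lambda>\<zeta>. f \<zeta> $ j) 0) = v}"
  have kA: "kobayashi_metric \<Omega> z v = Inf A"
    by (simp add: kobayashi_metric_def A_def)
  have bdd: "bdd_below A"
    unfolding A_def by (rule bdd_below_kobayashi)
  have dp: "\<delta> z > 0" by (rule bdist_pos[OF z])
  have mem: "norm v / \<delta> z \<in> A"
  proof (cases "v = 0")
    case True
    show ?thesis
      unfolding A_def
      by (rule CollectI, rule exI[of _ 0], rule exI[of _ "\<lambda>_. z"]) (use True z in auto)
  next
    case False
    define c :: complex where "c = of_real (\<delta> z / norm v)"
    define f where "f \<zeta> = z + (\<zeta> * c) *s v" for \<zeta>
    have "norm c * norm v = \<delta> z"
      using False dp by (simp add: c_def norm_divide)
    then have "f \<zeta> \<in> ball z (\<delta> z)" if "\<zeta> \<in> ball 0 1" for \<zeta>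
      using that dp by (simp add: f_def dist_norm norm_vector_smult norm_mult mult.assoc)
    then have 1: "f ` ball 0 1 \<subseteq> \<Omega>"
      using bdist_ball_subset[OF z] by blast
    have d: "((\<lambda>\<zeta>. f \<zeta> $ j) has_field_derivative (c * v $ j)) (at \<zeta>)" for j \<zeta>
      unfolding f_def by (auto intro!: derivative_eq_intros)
    have 2: "(\<lambda>\<zeta>. f \<zeta> $ j) holomorphic_on ball 0 1" for j
      unfolding f_def by (auto intro!: holomorphic_intros)
    have "deriv (\<lambda>\<zeta>. f \<zeta> $ j) 0 = c * v $ j" for j
      by (rule DERIV_imp_deriv[OF d])
    then have 3: "of_real (norm v / \<delta> z) *s (\<chi> j. deriv (\<lambda>\<zeta>. f \<zeta> $ j) 0) = v"
      using False dp by (simp add: vec_eq_iff c_def)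
    have 4: "norm v / \<delta> z = norm (of_real (norm v / \<delta> z) :: complex)"
      by (subst norm_of_real) (use dp in simp)
    have 5: "f 0 = z"
      by (simp add: f_def)
    show ?thesis
      unfolding A_def
      by (rule CollectI, rule exI[of _ "of_real (norm v / \<delta> z)"], rule exI[of _ f], intro conjI allI)
         (rule 4, rule 2, rule 1, rule 5, rule 3)
  qed
  show "kobayashi_metric \<Omega> z v \<le> norm v / \<delta> z"
    unfolding kA by (rule cInf_lower[OF mem bdd])
  have ne: "A \<noteq> {}" using mem by blast
  show "0 \<le> kobayashi_metric \<Omega> z v"
    unfolding kA by (rule cInf_greatest[OF ne]) (auto simp: A_def)
  show "norm (hermitian_form n v) \<le> 2 * ((z - q) \<bullet> n) * kobayashi_metric \<Omega> z v"
    if pos: "\<And>w. w \<in> \<Omega> \<Longrightarrow> 0 < (w - q) \<bullet> n"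
  proof -
    have pz: "0 < (z - q) \<bullet> n" using pos[OF z] .
    have "norm (hermitian_form n v) / (2 * ((z - q) \<bullet> n)) \<le> Inf A"
    proof (rule cInf_greatest[OF ne])
      fix a assume "a \<in> A"
      then obtain \<xi> and f :: "complex \<Rightarrow> complex ^ 'n" where a: "a = norm \<xi>" and hol: "\<And>j. (\<lambda>\<zeta>. f \<zeta> $ j) holomorphic_on ball 0 1"
        and im: "f ` ball 0 1 \<subseteq> \<Omega>" and f0: "f 0 = z" and v: "\<xi> *s (\<chi> j. deriv (\<lambda>\<zeta>. f \<zeta> $ j) 0) = v"
        unfolding A_def by blast
      define h where "h \<zeta> = hermitian_form n (f \<zeta> - q)" for \<zeta>
      have hh: "h holomorphic_on ball 0 1"
        unfolding h_def hermitian_form_def vector_minus_component by (intro holomorphic_intros hol)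
      have "(h has_field_derivative hermitian_form n (\<chi> j. deriv (\<lambda>\<zeta>. f \<zeta> $ j) 0)) (at 0)"
      proof -
        have "((\<lambda>\<zeta>. f \<zeta> $ j) has_field_derivative deriv (\<lambda>\<zeta>. f \<zeta> $ j) 0) (at 0)" for j
          using hol[of j] by (intro holomorphic_derivI[of _ "ball 0 1"]) auto
        then show ?thesis
          unfolding h_def hermitian_form_def vector_minus_component
            by (auto intro!: derivative_eq_intros simp: mult.commute)
      qed
      then have "deriv h 0 = hermitian_form n (\<chi> j. deriv (\<lambda>\<zeta>. f \<zeta> $ j) 0)"
        by (rule DERIV_imp_deriv)
      then have "hermitian_form n v = \<xi> * deriv h 0"
        using v hermitian_form_scale by metis
      moreover have "norm (deriv h 0) \<le> 2 * Re (h 0)"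
        by (rule deriv_bound_half_plane[OF hh]) (use im pos in \<open>auto simp: h_def Re_hermitian_form image_subset_iff\<close>)
      moreover have "Re (h 0) = (z - q) \<bullet> n"
        by (simp add: h_def Re_hermitian_form f0)
      ultimately have "norm (hermitian_form n v) \<le> norm \<xi> * (2 * ((z - q) \<bullet> n))"
        by (simp add: norm_mult mult_left_mono)
      then show "norm (hermitian_form n v) / (2 * ((z - q) \<bullet> n)) \<le> a"
        using pz a by (simp add: divide_le_eq)
    qed
    then show ?thesis
      unfolding kA using pz by (simp add: divide_le_eq mult.commute)
  qed
qed

text \<open>The half space supporting the domain at a point \<open>q\<close> of the complex line
  through \<open>z\<close> is used. As \<open>z - q\<close> is a multiple of \<open>v\<close>, the
  value of the functional at \<open>v\<close> occurs on both sides and cancels, whatever the angle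
  between the normal and the line.\<close>

lemma kobayashi_metric_ge_dir:
  assumes z: "z \<in> \<Omega>" and v: "v \<noteq> 0"
  shows "norm v \<le> 2 * bdist_dir \<Omega> z v * kobayashi_metric \<Omega> z v"
proof -
  define k where "k = kobayashi_metric \<Omega> z v"
  define L where "L = range (\<lambda>\<zeta>. z + \<zeta> *s v)"
  have "linear (\<lambda>\<zeta>. \<zeta> *s v)"
    by (rule linearI) (simp_all add: vec_eq_iff algebra_simps)
  then have cont: "continuous_on UNIV (\<lambda>\<zeta>. \<zeta> *s v)"
    by (intro linear_continuous_on) (simp add: linear_conv_bounded_linear)
  have conn: "connected L"
    unfolding L_def by (intro connected_continuous_image continuous_intros cont connected_UNIV)
  have "z \<in> L"
    unfolding L_def by (auto intro!: image_eqI[of _ _ 0])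
  have "\<not> L \<subseteq> \<Omega>"
  proof
    assume "L \<subseteq> \<Omega>"
    obtain B where B: "\<And>w. w \<in> \<Omega> \<Longrightarrow> norm w \<le> B"
      using bounded_dom unfolding bounded_iff by blast
    define r where "r = (norm z + \<bar>B\<bar> + 1) / norm v"
    have rv: "norm (of_real r *s v) = norm z + \<bar>B\<bar> + 1"
    proof -
      have "norm (of_real r *s v) = \<bar>r\<bar> * norm v"
        by (simp only: norm_vector_smult norm_of_real)
      also have "\<bar>r\<bar> = r"
        by (simp add: r_def)
      finally show ?thesis
        using v by (simp add: r_def)
    qed
    have "z + of_real r *s v \<in> \<Omega>"
      using \<open>L \<subseteq> \<Omega>\<close> by (auto simp: L_def)
    from B[OF this] rv norm_triangle_ineq4[of "z + of_real r *s v" z] show False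
      by simp
  qed
  then have "L \<inter> frontier \<Omega> \<noteq> {}"
    using z \<open>z \<in> L\<close> by (intro connected_Int_frontier conn) auto
  then have ne: "frontier \<Omega> \<inter> L \<noteq> {}"
    by blast
  have 1: "norm v \<le> 2 * dist z q * k" if q: "q \<in> frontier \<Omega> \<inter> L" for q
  proof -
    obtain \<zeta> where \<zeta>: "q = z + \<zeta> *s v"
      using q by (auto simp: L_def)
    obtain n where n: "norm n = 1" "\<And>w. w \<in> \<Omega> \<Longrightarrow> \<delta> w \<le> (w - q) \<bullet> n"
      using support_normal q by blast
    have pos: "0 < (w - q) \<bullet> n" if "w \<in> \<Omega>" for w
      using n(2)[OF that] bdist_pos[OF that] by linarith
    have "z - q = (- \<zeta>) *s v"
      by (simp add: \<zeta> vec_eq_iff)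
    then have hq: "hermitian_form n (z - q) = - \<zeta> * hermitian_form n v" and dq: "dist z q = norm \<zeta> * norm v"
      by (simp_all only: hermitian_form_scale dist_norm norm_vector_smult norm_minus_cancel)
    have k0: "0 \<le> k"
      unfolding k_def by (rule kobayashi_metric_nonneg[OF z])
    have le: "(z - q) \<bullet> n \<le> norm \<zeta> * norm (hermitian_form n v)"
      using inner_le_norm_hermitian_form[of "z - q" n] by (simp add: hq norm_mult)
    have "norm (hermitian_form n v) \<le> 2 * ((z - q) \<bullet> n) * k"
      unfolding k_def by (rule kobayashi_metric_ge_half_plane[OF z pos])
    also have "\<dots> \<le> 2 * (norm \<zeta> * norm (hermitian_form n v)) * k"
      using le k0 by (intro mult_right_mono mult_left_mono) auto
    finally have "norm (hermitian_form n v) * 1 \<le> norm (hermitian_form n v) * (2 * norm \<zeta> * k)"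
      by (simp add: mult_ac)
    moreover have "norm (hermitian_form n v) > 0"
      using le pos[OF z] by (cases "hermitian_form n v = 0") auto
    ultimately have "1 \<le> 2 * norm \<zeta> * k"
      by (rule mult_left_le_imp_le)
    then have "norm v * 1 \<le> norm v * (2 * norm \<zeta> * k)"
      by (intro mult_left_mono) auto
    then show ?thesis
      by (simp add: dq mult_ac)
  qed
  have kp: "k > 0"
  proof (rule ccontr)
    assume "\<not> k > 0"
    then have "k = 0"
      using kobayashi_metric_nonneg[OF z] unfolding k_def by (metis less_eq_real_def)
    then show False
      using 1 ne v by auto
  qed
  have "norm v / (2 * k) \<le> infdist z (frontier \<Omega> \<inter> L)"
    unfolding infdist_notempty[OF ne]
  proof (rule cINF_greatest[OF ne])
    fix q assume "q \<in> frontier \<Omega> \<inter> L"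
    from 1[OF this] kp show "norm v / (2 * k) \<le> dist z q"
      by (simp add: divide_le_eq mult_ac)
  qed
  then show ?thesis
    using kp by (simp add: bdist_dir_def L_def k_def divide_le_eq mult_ac)
qed

end

section \<open>Lower bounds for Kobayashi length and distance\<close>

definition kobayashi_length :: "(complex ^ 'n) set \<Rightarrow> real \<Rightarrow> real \<Rightarrow> (real \<Rightarrow> complex ^ 'n) \<Rightarrow> ennreal" where
  "kobayashi_length \<Omega> a b \<sigma> =
     (\<integral>\<^sup>+t\<in>{a..b}. ennreal (kobayashi_metric \<Omega> (\<sigma> t) (vector_derivative \<sigma> (at t))) \<partial>lebesgue)"

lemma kobayashi_length_mono: "c \<le> a \<Longrightarrow> b \<le> d \<Longrightarrow> kobayashi_length \<Omega> a b \<sigma> \<le> kobayashi_length \<Omega> c d \<sigma>"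
  unfolding kobayashi_length_def by (intro nn_integral_mono) (auto simp: indicator_def)

lemma kobayashi_dist_le:
  "a \<le> b \<Longrightarrow> absolutely_continuous_curve a b \<sigma> \<Longrightarrow> \<sigma> ` {a..b} \<subseteq> \<Omega> \<Longrightarrow> \<sigma> a = x \<Longrightarrow> \<sigma> b = y \<Longrightarrow>
    kobayashi_dist \<Omega> x y \<le> kobayashi_length \<Omega> a b \<sigma>"
  unfolding kobayashi_dist_def kobayashi_length_def by (rule Inf_lower) blast

lemma kobayashi_dist_greatest:
  "(\<And>a b \<sigma>. a \<le> b \<Longrightarrow> absolutely_continuous_curve a b \<sigma> \<Longrightarrow> \<sigma> ` {a..b} \<subseteq> \<Omega> \<Longrightarrow> \<sigma> a = x \<Longrightarrow> \<sigma> b = y \<Longrightarrow>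
     B \<le> kobayashi_length \<Omega> a b \<sigma>) \<Longrightarrow> B \<le> kobayashi_dist \<Omega> x y"
  unfolding kobayashi_dist_def kobayashi_length_def by (rule Inf_greatest) blast

context bounded_convex_domain
begin

text \<open>The calibration principle. It is applied with \<open>G\<close> half the logarithm of the
  distance to a supporting hyperplane, and with \<open>G\<close> a scaled linear functional along
  the curve.\<close>

lemma increment_le_kobayashi_length:
  assumes "a \<le> b" "absolutely_continuous_curve a b \<sigma>" "absolutely_continuous_curve a b G"
    and D: "\<And>t v. t \<in> {a<..<b} \<Longrightarrow> (\<sigma> has_vector_derivative v) (at t) \<Longrightarrow>
       \<exists>D. (G has_real_derivative D) (at t) \<and> \<bar>D\<bar> \<le> kobayashi_metric \<Omega> (\<sigma> t) v"
  shows "ennreal \<bar>G b - G a\<bar> \<le> kobayashi_length \<Omega> a b \<sigma>"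
  unfolding kobayashi_length_def
proof (rule absolutely_continuous_curve_increment_le_nn_integral[OF assms(3,1)])
  show "negligible {t \<in> {a<..<b}. \<not> \<sigma> differentiable (at t)}"
    by (rule absolutely_continuous_curve_differentiable[OF assms(2,1)])
  fix t assume t: "t \<in> {a<..<b} - {t \<in> {a<..<b}. \<not> \<sigma> differentiable (at t)}"
  then have "(\<sigma> has_vector_derivative vector_derivative \<sigma> (at t)) (at t)"
    by (simp add: vector_derivative_works[symmetric])
  from D[OF _ this] t show "\<exists>D. (G has_real_derivative D) (at t) \<and>
      ennreal \<bar>D\<bar> \<le> ennreal (kobayashi_metric \<Omega> (\<sigma> t) (vector_derivative \<sigma> (at t)))"
    by (auto intro: ennreal_leI)
qed

text \<open>The function \<open>\<phi>\<close>, the signed distance to the hyperplane supporting the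
  domain at a boundary point nearest to \<open>\<sigma> w\<close>, dominates \<delta> along the
  curve and is at most \<delta> at \<open>w\<close>, so \<open>\<phi>\<close> may replace \<delta>
  in the claim. Arbitrary parameters \<open>u\<close> and \<open>w\<close> are allowed in order to
  control \<delta> on an entire curve by its total length.\<close>

lemma log_bdist_le_kobayashi_length:
  assumes "a \<le> b" and ac: "absolutely_continuous_curve a b \<sigma>" and im: "\<sigma> ` {a..b} \<subseteq> \<Omega>"
    and uw: "u \<in> {a..b}" "w \<in> {a..b}"
  shows "ennreal (ln (\<delta> (\<sigma> u) / \<delta> (\<sigma> w)) / 2) \<le> kobayashi_length \<Omega> a b \<sigma>"
proof -
  obtain q where q: "q \<in> frontier \<Omega>" "\<delta> (\<sigma> w) = dist (\<sigma> w) q"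
    by (rule bdist_nearest)
  obtain n where n: "norm n = 1" "\<And>z. z \<in> \<Omega> \<Longrightarrow> \<delta> z \<le> (z - q) \<bullet> n"
    using support_normal[OF q(1)] by blast
  have pos: "0 < (z - q) \<bullet> n" if "z \<in> \<Omega>" for z
    using n(2)[OF that] bdist_pos[OF that] by linarith
  define \<phi> where "\<phi> t = (\<sigma> t - q) \<bullet> n" for t
  define c d where "c = min u w" and "d = max u w"
  have cd: "c \<le> d" "a \<le> c" "d \<le> b"
    using uw by (auto simp: c_def d_def)
  have ac': "absolutely_continuous_curve c d \<sigma>"
    by (rule absolutely_continuous_curve_subinterval[OF ac cd(2,3)])
  have im': "\<sigma> t \<in> \<Omega>" if "t \<in> {c..d}" for t
    using im cd that by (auto simp: image_subset_iff)
  have "continuous_on {c..d} \<phi>"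
    unfolding \<phi>_def using absolutely_continuous_curve_imp_continuous_on[OF ac'] by (intro continuous_intros)
  then obtain t0 where t0: "t0 \<in> {c..d}" "\<And>t. t \<in> {c..d} \<Longrightarrow> \<phi> t0 \<le> \<phi> t"
    using continuous_attains_inf[of "{c..d}" \<phi>] cd(1) by auto
  \<comment> \<open>A positive lower bound for \<open>\<phi>\<close> on the compact parameter
    interval makes the logarithm Lipschitz on its values, so absolute continuity is
    preserved.\<close>
  define e where "e = \<phi> t0"
  have e: "e > 0" "\<And>t. t \<in> {c..d} \<Longrightarrow> e \<le> \<phi> t"
    using t0 pos im' by (auto simp: e_def \<phi>_def)
  have acG: "absolutely_continuous_curve c d (\<lambda>t. ln (\<phi> t) / 2)"
  proof (rule absolutely_continuous_curve_compose[OF absolutely_continuous_curve_inner[OF ac', of 1 n]])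
    fix s t assume st: "s \<in> {c..d}" "t \<in> {c..d}"
    have ln: "ln x - ln y \<le> \<bar>x - y\<bar> / e" if "x \<ge> e" "y \<ge> e" for x y
    proof -
      have "ln x - ln y \<le> (x - y) / y"
        using that e(1) by (intro ln_diff_le) auto
      also have "\<dots> \<le> \<bar>x - y\<bar> / y"
        using that e(1) by (intro divide_right_mono) auto
      also have "\<dots> \<le> \<bar>x - y\<bar> / e"
        using that e(1) by (intro divide_left_mono) auto
      finally show ?thesis .
    qed
    have "\<bar>ln (\<phi> t) - ln (\<phi> s)\<bar> \<le> \<bar>\<phi> t - \<phi> s\<bar> / e"
      using ln[OF e(2) e(2), OF st] ln[OF e(2) e(2), OF st(2,1)] by (simp add: abs_le_iff abs_minus_commute)
    moreover have "\<phi> t - \<phi> s = \<sigma> t \<bullet> n - \<sigma> s \<bullet> n"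
      by (simp add: \<phi>_def inner_diff_left)
    ultimately show "norm (ln (\<phi> t) / 2 - ln (\<phi> s) / 2) \<le> 1 / (2 * e) * norm (1 * (\<sigma> t \<bullet> n) - 1 * (\<sigma> s \<bullet> n)) + 0 * (t - s)"
      by (simp add: field_simps flip: diff_divide_distrib)
  qed
  have "ennreal \<bar>ln (\<phi> d) / 2 - ln (\<phi> c) / 2\<bar> \<le> kobayashi_length \<Omega> c d \<sigma>"
  proof (rule increment_le_kobayashi_length[OF cd(1) ac' acG])
    fix t v assume t: "t \<in> {c<..<d}" and v: "(\<sigma> has_vector_derivative v) (at t)"
    have z: "\<sigma> t \<in> \<Omega>" using im' t by simp
    have p: "\<phi> t > 0" using pos[OF z] by (simp add: \<phi>_def)
    have "((\<lambda>t. \<sigma> t \<bullet> n) has_real_derivative (v \<bullet> n)) (at t)"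
      using bounded_linear.has_vector_derivative[OF bounded_linear_inner_left v]
      by (simp add: has_real_derivative_iff_has_vector_derivative)
    then have "(\<phi> has_real_derivative (v \<bullet> n)) (at t)"
      unfolding \<phi>_def inner_diff_left by (auto intro!: derivative_eq_intros)
    then have "((\<lambda>t. ln (\<phi> t) / 2) has_real_derivative ((v \<bullet> n) / (2 * \<phi> t))) (at t)"
      using p by (auto intro!: derivative_eq_intros simp: field_simps)
    moreover have "\<bar>(v \<bullet> n) / (2 * \<phi> t)\<bar> \<le> kobayashi_metric \<Omega> (\<sigma> t) v"
    proof -
      have "\<bar>v \<bullet> n\<bar> \<le> norm (hermitian_form n v)"
        by (rule inner_le_norm_hermitian_form)
      also have "\<dots> \<le> 2 * \<phi> t * kobayashi_metric \<Omega> (\<sigma> t) v"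
        unfolding \<phi>_def by (rule kobayashi_metric_ge_half_plane[OF z pos])
      finally show ?thesis
        using p by (simp add: divide_le_eq mult.commute)
    qed
    ultimately show "\<exists>D. ((\<lambda>t. ln (\<phi> t) / 2) has_real_derivative D) (at t) \<and> \<bar>D\<bar> \<le> kobayashi_metric \<Omega> (\<sigma> t) v"
      by blast
  qed
  also have "\<dots> \<le> kobayashi_length \<Omega> a b \<sigma>"
    by (rule kobayashi_length_mono[OF cd(2,3)])
  finally have 1: "ennreal \<bar>ln (\<phi> d) / 2 - ln (\<phi> c) / 2\<bar> \<le> kobayashi_length \<Omega> a b \<sigma>" .
  have uw': "\<sigma> u \<in> \<Omega>" "\<sigma> w \<in> \<Omega>"
    using uw im by (auto simp: image_subset_iff)
  have "\<phi> w \<le> \<delta> (\<sigma> w)"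
    using norm_cauchy_schwarz[of "\<sigma> w - q" n] n(1) q(2) by (simp add: \<phi>_def dist_norm)
  then have "ln (\<phi> w) \<le> ln (\<delta> (\<sigma> w))"
    using pos[OF uw'(2)] by (simp add: \<phi>_def)
  moreover have "ln (\<delta> (\<sigma> u)) \<le> ln (\<phi> u)"
    using n(2)[OF uw'(1)] bdist_pos[OF uw'(1)] by (simp add: \<phi>_def)
  moreover have "ln (\<phi> u) - ln (\<phi> w) \<le> \<bar>ln (\<phi> d) - ln (\<phi> c)\<bar>"
    by (auto simp: c_def d_def min_def max_def)
  moreover have "\<bar>ln (\<phi> d) / 2 - ln (\<phi> c) / 2\<bar> = \<bar>ln (\<phi> d) - ln (\<phi> c)\<bar> / 2"
    by (simp flip: diff_divide_distrib)
  ultimately have "ln (\<delta> (\<sigma> u) / \<delta> (\<sigma> w)) / 2 \<le> \<bar>ln (\<phi> d) / 2 - ln (\<phi> c) / 2\<bar>"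
    using bdist_pos[OF uw'(1)] bdist_pos[OF uw'(2)] by (simp add: ln_div)
  then show ?thesis
    using 1 ennreal_leI order_trans by blast
qed

lemma log_bdist_le_kobayashi_dist:
  "ennreal (ln (\<delta> x / \<delta> y) / 2) \<le> kobayashi_dist \<Omega> x y"
proof (rule kobayashi_dist_greatest)
  fix a b \<sigma> assume "a \<le> b" "absolutely_continuous_curve a b \<sigma>" "\<sigma> ` {a..b} \<subseteq> \<Omega>" "\<sigma> a = x" "\<sigma> b = y"
  then show "ennreal (ln (\<delta> x / \<delta> y) / 2) \<le> kobayashi_length \<Omega> a b \<sigma>"
    using log_bdist_le_kobayashi_length[of a b \<sigma> a b] by auto
qed

end

locale m_convex_domain = bounded_convex_domain +
  fixes m C :: real
  assumes m: "m \<ge> 1" and C: "C > 0"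
    and dir: "\<And>z v. z \<in> \<Omega> \<Longrightarrow> v \<noteq> 0 \<Longrightarrow> bdist_dir \<Omega> z v \<le> C * \<delta> z powr (1 / m)"
begin

lemma kobayashi_metric_ge:
  assumes "z \<in> \<Omega>"
  shows "norm v \<le> 2 * C * \<delta> z powr (1 / m) * kobayashi_metric \<Omega> z v"
proof (cases "v = 0")
  case True
  then show ?thesis
    using kobayashi_metric_nonneg[OF assms] C by simp
next
  case False
  have "norm v \<le> 2 * bdist_dir \<Omega> z v * kobayashi_metric \<Omega> z v"
    by (rule kobayashi_metric_ge_dir[OF assms False])
  also have "\<dots> \<le> 2 * (C * \<delta> z powr (1 / m)) * kobayashi_metric \<Omega> z v"
    using dir[OF assms False] kobayashi_metric_nonneg[OF assms] by (intro mult_right_mono mult_left_mono) auto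
  finally show ?thesis by simp
qed

text \<open>A curve of Kobayashi length at most \<open>L\<close> cannot reach points with \<delta>
  above \<open>exp (2 * L) * \<delta> (\<sigma> a)\<close>. Hence one constant \<kappa> compares
  Euclidean norm and metric along the whole curve.\<close>

lemma dist_le_kobayashi_length:
  assumes "a \<le> b" and ac: "absolutely_continuous_curve a b \<sigma>" and im: "\<sigma> ` {a..b} \<subseteq> \<Omega>"
    and L: "kobayashi_length \<Omega> a b \<sigma> \<le> ennreal L" "0 \<le> L"
  shows "dist (\<sigma> a) (\<sigma> b) \<le> 2 * C * exp (2 * L) * \<delta> (\<sigma> a) powr (1 / m) * L"
proof -
  define \<kappa> where "\<kappa> = 2 * C * exp (2 * L) * \<delta> (\<sigma> a) powr (1 / m)"
  have aO: "\<sigma> a \<in> \<Omega>" using im \<open>a \<le> b\<close> by auto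
  have \<kappa>: "\<kappa> > 0"
    using C bdist_pos[OF aO] by (simp add: \<kappa>_def)
  have k: "norm v \<le> \<kappa> * kobayashi_metric \<Omega> (\<sigma> t) v" if t: "t \<in> {a..b}" for t v
  proof -
    have z: "\<sigma> t \<in> \<Omega>" using im t by auto
    have "ennreal (ln (\<delta> (\<sigma> t) / \<delta> (\<sigma> a)) / 2) \<le> ennreal L"
      using log_bdist_le_kobayashi_length[OF \<open>a \<le> b\<close> ac im t, of a] L(1) \<open>a \<le> b\<close> by (auto intro: order_trans)
    then have "ln (\<delta> (\<sigma> t) / \<delta> (\<sigma> a)) \<le> 2 * L"
      using L(2) by (simp add: ennreal_le_iff)
    then have "exp (ln (\<delta> (\<sigma> t) / \<delta> (\<sigma> a))) \<le> exp (2 * L)"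
      by simp
    then have "\<delta> (\<sigma> t) \<le> exp (2 * L) * \<delta> (\<sigma> a)"
      using bdist_pos[OF z] bdist_pos[OF aO] by (simp add: divide_le_eq)
    then have "\<delta> (\<sigma> t) powr (1 / m) \<le> (exp (2 * L) * \<delta> (\<sigma> a)) powr (1 / m)"
      using m bdist_pos[OF z] by (intro powr_mono2) auto
    also have "\<dots> = exp (2 * L) powr (1 / m) * \<delta> (\<sigma> a) powr (1 / m)"
      using bdist_pos[OF aO] by (simp add: powr_mult)
    also have "exp (2 * L) powr (1 / m) \<le> exp (2 * L) powr 1"
      using m L(2) by (intro powr_mono) auto
    finally have le: "\<delta> (\<sigma> t) powr (1 / m) \<le> exp (2 * L) * \<delta> (\<sigma> a) powr (1 / m)"
      by (simp add: mult_right_mono)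
    have "norm v \<le> 2 * C * \<delta> (\<sigma> t) powr (1 / m) * kobayashi_metric \<Omega> (\<sigma> t) v"
      by (rule kobayashi_metric_ge[OF z])
    also have "\<dots> \<le> 2 * C * (exp (2 * L) * \<delta> (\<sigma> a) powr (1 / m)) * kobayashi_metric \<Omega> (\<sigma> t) v"
      using C le kobayashi_metric_nonneg[OF z] by (intro mult_right_mono mult_left_mono) auto
    finally show ?thesis
      by (simp add: \<kappa>_def mult_ac)
  qed
  \<comment> \<open>The linear functional in the direction of the chord; for coinciding end points
    \<open>sgn\<close> gives 0, which is harmless.\<close>
  define u where "u = sgn (\<sigma> b - \<sigma> a)"
  have u1: "norm u \<le> 1" by (simp add: u_def norm_sgn)
  have "ennreal \<bar>1 / \<kappa> * (\<sigma> b \<bullet> u) - 1 / \<kappa> * (\<sigma> a \<bullet> u)\<bar> \<le> kobayashi_length \<Omega> a b \<sigma>"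
  proof (rule increment_le_kobayashi_length[OF \<open>a \<le> b\<close> ac absolutely_continuous_curve_inner[OF ac]])
    fix t v assume t: "t \<in> {a<..<b}" and v: "(\<sigma> has_vector_derivative v) (at t)"
    have "((\<lambda>t. \<sigma> t \<bullet> u) has_real_derivative (v \<bullet> u)) (at t)"
      using bounded_linear.has_vector_derivative[OF bounded_linear_inner_left v]
      by (simp add: has_real_derivative_iff_has_vector_derivative)
    then have "((\<lambda>t. 1 / \<kappa> * (\<sigma> t \<bullet> u)) has_real_derivative (1 / \<kappa> * (v \<bullet> u))) (at t)"
      by (rule DERIV_cmult)
    moreover have "\<bar>1 / \<kappa> * (v \<bullet> u)\<bar> \<le> kobayashi_metric \<Omega> (\<sigma> t) v"
    proof -
      have "\<bar>v \<bullet> u\<bar> \<le> norm v * norm u"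
        by (rule Cauchy_Schwarz_ineq2)
      also have "\<dots> \<le> norm v"
        using u1 by (simp add: mult_left_le)
      also have "\<dots> \<le> \<kappa> * kobayashi_metric \<Omega> (\<sigma> t) v"
        using t by (intro k) auto
      finally show ?thesis
        using \<kappa> by (simp add: divide_le_eq mult.commute)
    qed
    ultimately show "\<exists>D. ((\<lambda>t. 1 / \<kappa> * (\<sigma> t \<bullet> u)) has_real_derivative D) (at t) \<and> \<bar>D\<bar> \<le> kobayashi_metric \<Omega> (\<sigma> t) v"
      by blast
  qed
  then have "\<bar>1 / \<kappa> * (\<sigma> b \<bullet> u) - 1 / \<kappa> * (\<sigma> a \<bullet> u)\<bar> \<le> L"
    using L order_trans ennreal_le_iff by blast
  moreover have "1 / \<kappa> * (\<sigma> b \<bullet> u) - 1 / \<kappa> * (\<sigma> a \<bullet> u) = dist (\<sigma> a) (\<sigma> b) / \<kappa>"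
  proof -
    have "(\<sigma> b - \<sigma> a) \<bullet> u = norm (\<sigma> b - \<sigma> a)"
      by (cases "\<sigma> b = \<sigma> a") (simp_all add: u_def sgn_div_norm power2_norm_eq_inner[symmetric] power2_eq_square)
    then show ?thesis
      by (simp add: inner_diff_left dist_norm norm_minus_commute flip: diff_divide_distrib)
  qed
  ultimately have "dist (\<sigma> a) (\<sigma> b) / \<kappa> \<le> L"
    using \<kappa> by simp
  then have "dist (\<sigma> a) (\<sigma> b) \<le> \<kappa> * L"
    using \<kappa> by (simp add: divide_le_eq mult.commute)
  then show ?thesis
    unfolding \<kappa>_def .
qed

lemma dist_le_kobayashi_dist:
  assumes "kobayashi_dist \<Omega> x y \<le> ennreal r" "0 < r" "r \<le> 1"
  shows "dist x y \<le> 4 * C * exp 4 * \<delta> x powr (1 / m) * r"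
proof -
  \<comment> \<open>The infimum need not be attained, so a curve of length below
    \<open>2 * r\<close> is used; together with \<open>r \<le> 1\<close> this is the origin of the
    factors 4 and \<open>exp 4\<close>.\<close>
  have "kobayashi_dist \<Omega> x y < ennreal (2 * r)"
    using assms(1,2) by (auto intro: le_less_trans simp: ennreal_less_iff)
  then obtain a b \<sigma> where \<sigma>: "a \<le> b" "absolutely_continuous_curve a b \<sigma>" "\<sigma> ` {a..b} \<subseteq> \<Omega>" "\<sigma> a = x" "\<sigma> b = y"
    "kobayashi_length \<Omega> a b \<sigma> < ennreal (2 * r)"
    unfolding kobayashi_dist_def kobayashi_length_def Inf_less_iff by blast
  have "dist (\<sigma> a) (\<sigma> b) \<le> 2 * C * exp (2 * (2 * r)) * \<delta> (\<sigma> a) powr (1 / m) * (2 * r)"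
    by (rule dist_le_kobayashi_length) (use \<sigma> assms(2) in auto)
  also have "\<dots> \<le> 2 * C * exp 4 * \<delta> (\<sigma> a) powr (1 / m) * (2 * r)"
    using C assms(2,3) by (intro mult_right_mono mult_left_mono) auto
  finally show ?thesis
    by (simp add: \<sigma> mult_ac)
qed

end

section \<open>Upper bounds for the Kobayashi distance\<close>

context bounded_convex_domain
begin

text \<open>If a support normal \<open>n\<close> differed from \<nu>, then
  \<open>h = \<nu> - n\<close> would point into the domain, because the defining function decreases
  along \<open>h\<close>, and yet \<open>h \<bullet> n < 0\<close> would lead across the supporting
  hyperplane.\<close>

lemma unique_support_normal:
  assumes C1: "C1_boundary \<Omega>" and p: "p \<in> frontier \<Omega>"
  obtains \<nu> where "norm \<nu> = 1" "\<And>n. norm n = 1 \<Longrightarrow> (\<And>z. z \<in> \<Omega> \<Longrightarrow> 0 \<le> (z - p) \<bullet> n) \<Longrightarrow> n = \<nu>"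
proof -
  obtain U r g where U: "p \<in> U" "C1_defining_function \<Omega> U r g"
    using C1 p unfolding C1_boundary_def by blast
  then have U': "open U" "GDERIV r p :> g p" "g p \<noteq> 0" "\<Omega> \<inter> U = {x \<in> U. r x < 0}" "r p = 0"
    using p unfolding C1_defining_function_def by auto
  define \<nu> where "\<nu> = - sgn (g p)"
  have \<nu>1: "norm \<nu> = 1"
    using U'(3) by (simp add: \<nu>_def norm_sgn)
  have "n = \<nu>" if n: "norm n = 1" "\<And>z. z \<in> \<Omega> \<Longrightarrow> 0 \<le> (z - p) \<bullet> n" for n
  proof (rule ccontr)
    assume "n \<noteq> \<nu>"
    then have "0 < (\<nu> - n) \<bullet> (\<nu> - n)" by simp
    then have lt: "\<nu> \<bullet> n < 1"
      using n(1) \<nu>1 by (simp add: inner_diff_left inner_diff_right inner_commute norm_eq_1)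
    define h where "h = \<nu> - n"
    have "h \<bullet> \<nu> > 0"
      using lt \<nu>1 by (simp add: h_def inner_diff_left inner_diff_right inner_commute norm_eq_1)
    moreover have "g p = - (norm (g p) *\<^sub>R \<nu>)"
      using U'(3) by (simp add: \<nu>_def sgn_div_norm)
    then have "g p \<bullet> h = - (norm (g p) * (h \<bullet> \<nu>))"
      by (metis inner_commute inner_minus_left inner_scaleR_left)
    ultimately have neg: "g p \<bullet> h < 0"
      using U'(3) by simp
    have "((\<lambda>t. r (p + t *\<^sub>R h)) has_real_derivative (g p \<bullet> h)) (at 0)"
      by (rule GDERIV_along_line[OF U'(2)])
    from DERIV_neg_dec_right[OF this neg] U'(5)
    obtain e where e: "e > 0" "\<And>t. 0 < t \<Longrightarrow> t < e \<Longrightarrow> r (p + t *\<^sub>R h) < 0"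
      by auto
    have "((\<lambda>t::real. p + t *\<^sub>R h) \<longlongrightarrow> p + 0 *\<^sub>R h) (at_right 0)"
      by (intro tendsto_intros)
    then have "\<forall>\<^sub>F t in at_right 0. p + t *\<^sub>R h \<in> U"
      using U(1) U'(1) topological_tendstoD by fastforce
    moreover have "\<forall>\<^sub>F t in at_right 0. 0 < t \<and> t < e"
      using e(1) eventually_at_right_real[of 0 e] by (auto elim!: eventually_mono)
    ultimately have "\<forall>\<^sub>F t in at_right (0::real). 0 < t \<and> t < e \<and> p + t *\<^sub>R h \<in> U"
      by eventually_elim auto
    then obtain t where t: "0 < t" "t < e" "p + t *\<^sub>R h \<in> U"
      using eventually_happens trivial_limit_at_right_real by blast
    then have "p + t *\<^sub>R h \<in> \<Omega>"
      using e(2)[of t] U'(4) by blast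
    from n(2)[OF this] have "0 \<le> t * (h \<bullet> n)"
      by simp
    then have "0 \<le> h \<bullet> n"
      using t(1) by (simp add: zero_le_mult_iff)
    then show False
      using lt n(1) by (simp add: h_def inner_diff_left norm_eq_1)
  qed
  with \<nu>1 show ?thesis
    by (rule that)
qed

text \<open>The set \<open>S\<close> of boundary points with their support normals is compact. As
  the normal at \<open>p\<close> is unique, normals at nearby points must be close to it, and a
  Lebesgue number of the resulting cover makes the radius uniform. Any constant below 1 could be
  reached in place of \<open>2 / 3\<close>.\<close>

lemma uniform_support_cone:
  assumes C1: "C1_boundary \<Omega>"
  obtains r where "r > 0" "\<And>p. p \<in> frontier \<Omega> \<Longrightarrow> \<exists>\<nu>. norm \<nu> = 1 \<and>
    (\<forall>q n. q \<in> frontier \<Omega> \<and> dist p q < r \<and> norm n = 1 \<and> (\<forall>z\<in>\<Omega>. 0 \<le> (z - q) \<bullet> n) \<longrightarrow> 2 / 3 \<le> \<nu> \<bullet> n)"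
proof -
  define S where "S = {(q, n). q \<in> frontier \<Omega> \<and> norm n = 1 \<and> (\<forall>z\<in>\<Omega>. 0 \<le> (z - q) \<bullet> n)}"
  have S_eq: "S = (frontier \<Omega> \<times> sphere 0 1) \<inter> (\<Inter>z\<in>\<Omega>. {w. 0 \<le> (z - fst w) \<bullet> snd w})"
    using nonempty_dom by (auto simp: S_def)
  have "closed {w. 0 \<le> (z - fst w) \<bullet> snd w}" for z :: "complex ^ 'n"
    by (intro closed_Collect_le continuous_intros)
  moreover have cf: "compact (frontier \<Omega>)"
    using bounded_dom by (rule compact_frontier_bounded)
  ultimately have S: "compact S"
    unfolding S_eq by (intro compact_Int_closed compact_Times compact_sphere closed_INT) auto
  have "\<exists>\<nu> e. norm \<nu> = 1 \<and> e > 0 \<and> (\<forall>(q, n)\<in>S. dist p q < e \<longrightarrow> 2 / 3 \<le> \<nu> \<bullet> n)" if p: "p \<in> frontier \<Omega>" for p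
  proof -
    obtain \<nu> where \<nu>: "norm \<nu> = 1" "\<And>n. norm n = 1 \<Longrightarrow> (\<And>z. z \<in> \<Omega> \<Longrightarrow> 0 \<le> (z - p) \<bullet> n) \<Longrightarrow> n = \<nu>"
      using unique_support_normal[OF C1 p] by blast
    have "closed {w :: (complex ^ 'n) \<times> (complex ^ 'n). \<nu> \<bullet> snd w \<le> 2 / 3}"
      by (intro closed_Collect_le continuous_intros)
    then have "compact (fst ` (S \<inter> {w. \<nu> \<bullet> snd w \<le> 2 / 3}))"
      by (intro compact_continuous_image continuous_intros compact_Int_closed S)
    then have "closed (fst ` (S \<inter> {w. \<nu> \<bullet> snd w \<le> 2 / 3}))"
      by (rule compact_imp_closed)
    moreover have "p \<notin> fst ` (S \<inter> {w. \<nu> \<bullet> snd w \<le> 2 / 3})"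
    proof
      assume "p \<in> fst ` (S \<inter> {w. \<nu> \<bullet> snd w \<le> 2 / 3})"
      then obtain n where n: "(p, n) \<in> S" "\<nu> \<bullet> n \<le> 2 / 3"
        by auto
      then have "n = \<nu>"
        by (intro \<nu>(2)) (auto simp: S_def)
      then show False
        using n(2) \<nu>(1) by (simp add: norm_eq_1)
    qed
    ultimately obtain e where e: "e > 0" "ball p e \<subseteq> - fst ` (S \<inter> {w. \<nu> \<bullet> snd w \<le> 2 / 3})"
      by (metis ComplI open_Compl open_contains_ball)
    have "2 / 3 \<le> \<nu> \<bullet> n" if "(q, n) \<in> S" "dist p q < e" for q n
    proof (rule ccontr)
      assume "\<not> 2 / 3 \<le> \<nu> \<bullet> n"
      then have "q \<in> fst ` (S \<inter> {w. \<nu> \<bullet> snd w \<le> 2 / 3})"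
        using that(1) by (intro image_eqI[of _ _ "(q, n)"]) auto
      moreover have "q \<in> ball p e"
        using that(2) by simp
      ultimately show False
        using e(2) by blast
    qed
    then show ?thesis
      using \<nu>(1) e(1) by blast
  qed
  then obtain \<nu> e where ne: "\<And>p. p \<in> frontier \<Omega> \<Longrightarrow> norm (\<nu> p) = 1" "\<And>p. p \<in> frontier \<Omega> \<Longrightarrow> e p > 0"
    "\<And>p q n. p \<in> frontier \<Omega> \<Longrightarrow> (q, n) \<in> S \<Longrightarrow> dist p q < e p \<Longrightarrow> 2 / 3 \<le> \<nu> p \<bullet> n"
    by (metis (no_types, lifting) case_prodD)
  have "frontier \<Omega> \<subseteq> \<Union>((\<lambda>p. ball p (e p)) ` frontier \<Omega>)"
    using ne(2) by force
  then obtain r where r: "r > 0" "\<And>p. p \<in> frontier \<Omega> \<Longrightarrow> \<exists>G\<in>(\<lambda>p. ball p (e p)) ` frontier \<Omega>. ball p r \<subseteq> G"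
    using Heine_Borel_lemma[OF cf] by (metis (no_types, lifting) imageE open_ball)
  show ?thesis
  proof (rule that[OF r(1)])
    fix p assume "p \<in> frontier \<Omega>"
    from r(2)[OF this] obtain p' where p': "p' \<in> frontier \<Omega>" "ball p r \<subseteq> ball p' (e p')"
      by blast
    show "\<exists>\<nu>. norm \<nu> = 1 \<and> (\<forall>q n. q \<in> frontier \<Omega> \<and> dist p q < r \<and> norm n = 1 \<and> (\<forall>z\<in>\<Omega>. 0 \<le> (z - q) \<bullet> n) \<longrightarrow> 2 / 3 \<le> \<nu> \<bullet> n)"
    proof (intro exI[of _ "\<nu> p'"] conjI allI impI)
      fix q n assume q: "q \<in> frontier \<Omega> \<and> dist p q < r \<and> norm n = 1 \<and> (\<forall>z\<in>\<Omega>. 0 \<le> (z - q) \<bullet> n)"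
      then have "q \<in> ball p' (e p')"
        using p'(2) by auto
      then show "2 / 3 \<le> \<nu> p' \<bullet> n"
        using q by (intro ne(3)[OF p'(1), of q]) (auto simp: S_def)
    qed (rule ne(1)[OF p'(1)])
  qed
qed

text \<open>Moving along \<nu> increases the distance to every nearby supporting hyperplane at rate
  \<open>\<nu> \<bullet> n\<close>, hence at least \<open>2 / 3\<close>. One \<nu> has to serve all
  \<open>y\<close> near \<open>x\<close>, since two points will be moved in parallel.\<close>

lemma uniform_inward_direction:
  assumes C1: "C1_boundary \<Omega>"
  obtains r where "r > 0" "\<And>x. x \<in> \<Omega> \<Longrightarrow> \<delta> x < r \<Longrightarrow> \<exists>\<nu>. norm \<nu> = 1 \<and>
    (\<forall>y\<in>\<Omega>. dist x y \<le> r \<longrightarrow> (\<forall>t\<in>{0..r}. y + t *\<^sub>R \<nu> \<in> \<Omega> \<and> \<delta> y + 2 / 3 * t \<le> \<delta> (y + t *\<^sub>R \<nu>)))"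
proof -
  obtain e where e: "e > 0" "\<And>p. p \<in> frontier \<Omega> \<Longrightarrow> \<exists>\<nu>. norm \<nu> = 1 \<and>
    (\<forall>q n. q \<in> frontier \<Omega> \<and> dist p q < e \<and> norm n = 1 \<and> (\<forall>z\<in>\<Omega>. 0 \<le> (z - q) \<bullet> n) \<longrightarrow> 2 / 3 \<le> \<nu> \<bullet> n)"
    using uniform_support_cone[OF C1] by blast
  \<comment> \<open>The moved point \<open>z\<close> is within \<open>2 * r\<close> of
    \<open>x\<close>, and its nearest boundary point is within \<open>3 * r\<close> of
    \<open>z\<close>, as \<open>p\<close> is that close. This boundary point is thus less than
    \<open>5 * r\<close> from \<open>x\<close> and, because \<open>\<delta> x < r\<close>, less than
    \<open>6 * r\<close> from \<open>p\<close>.\<close>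
  define r where "r = e / 6"
  have r: "r > 0" using e(1) by (simp add: r_def)
  show ?thesis
  proof (rule that[OF r])
    fix x assume x: "x \<in> \<Omega>" "\<delta> x < r"
    obtain p where p: "p \<in> frontier \<Omega>" "\<delta> x = dist x p"
      by (rule bdist_nearest)
    obtain \<nu> where \<nu>: "norm \<nu> = 1" "\<And>q n. q \<in> frontier \<Omega> \<Longrightarrow> dist p q < e \<Longrightarrow> norm n = 1 \<Longrightarrow>
        (\<And>z. z \<in> \<Omega> \<Longrightarrow> 0 \<le> (z - q) \<bullet> n) \<Longrightarrow> 2 / 3 \<le> \<nu> \<bullet> n"
      using e(2)[OF p(1)] by blast
    have cone: "\<exists>n. norm n = 1 \<and> (\<forall>z\<in>\<Omega>. \<delta> z \<le> (z - q) \<bullet> n) \<and> 2 / 3 \<le> \<nu> \<bullet> n" if q: "q \<in> frontier \<Omega>" "dist x q < 5 * r" for q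
    proof -
      obtain n where n: "norm n = 1" "\<And>z. z \<in> \<Omega> \<Longrightarrow> \<delta> z \<le> (z - q) \<bullet> n"
        using support_normal[OF q(1)] by blast
      have "dist p q < e"
        using dist_triangle[of p q x] p(2) x(2) q(2) by (simp add: r_def dist_commute)
      moreover have "0 \<le> (z - q) \<bullet> n" if "z \<in> \<Omega>" for z
        using n(2)[OF that] bdist_pos[OF that] by linarith
      ultimately have "2 / 3 \<le> \<nu> \<bullet> n"
        using q(1) n(1) by (intro \<nu>(2)) auto
      with n show ?thesis by blast
    qed
    have "y + t *\<^sub>R \<nu> \<in> \<Omega> \<and> \<delta> y + 2 / 3 * t \<le> \<delta> (y + t *\<^sub>R \<nu>)"
      if y: "y \<in> \<Omega>" "dist x y \<le> r" and t: "t \<in> {0..r}" for y t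
    proof -
      have dy: "dist x (y + s *\<^sub>R \<nu>) \<le> 2 * r" if "0 \<le> s" "s \<le> t" for s
      proof -
        have "dist y (y + s *\<^sub>R \<nu>) = s"
          using \<nu>(1) that(1) by (simp add: dist_norm)
        then show ?thesis
          using dist_triangle[of x "y + s *\<^sub>R \<nu>" y] y(2) t that by simp
      qed
      \<comment> \<open>If the segment met the boundary at \<open>q\<close>, then \<open>y\<close>
        would arise from \<open>q\<close> by moving against \<nu>, so it would not be strictly
        inside the half space at \<open>q\<close>.\<close>
      have in_dom: "y + t *\<^sub>R \<nu> \<in> \<Omega>"
      proof (rule ccontr)
        assume "y + t *\<^sub>R \<nu> \<notin> \<Omega>"
        then have "closed_segment y (y + t *\<^sub>R \<nu>) \<inter> frontier \<Omega> \<noteq> {}"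
          using y(1) by (intro connected_Int_frontier) (auto intro: connected_segment)
        then obtain q where q: "q \<in> closed_segment y (y + t *\<^sub>R \<nu>)" "q \<in> frontier \<Omega>"
          by blast
        then obtain u where u: "0 \<le> u" "u \<le> 1" "q = (1 - u) *\<^sub>R y + u *\<^sub>R (y + t *\<^sub>R \<nu>)"
          by (auto simp: in_segment)
        define s where "s = u * t"
        have qs: "q = y + s *\<^sub>R \<nu>" "0 \<le> s" "s \<le> t"
          using u t by (auto simp: s_def algebra_simps mult_left_le)
        have "dist x q < 5 * r"
          using dy[OF qs(2,3)] qs(1) r by simp
        from cone[OF q(2) this] obtain n where n: "\<forall>z\<in>\<Omega>. \<delta> z \<le> (z - q) \<bullet> n" "2 / 3 \<le> \<nu> \<bullet> n"
          by blast
        have "\<delta> y \<le> - (s * (\<nu> \<bullet> n))"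
          using n(1) y(1) qs(1) by auto
        also have "\<dots> \<le> 0"
          using qs(2) n(2) by simp
        finally show False
          using bdist_pos[OF y(1)] by simp
      qed
      define z where "z = y + t *\<^sub>R \<nu>"
      obtain q where q: "q \<in> frontier \<Omega>" "\<delta> z = dist z q"
        by (rule bdist_nearest)
      have xz: "dist x z \<le> 2 * r"
        using dy[of t] t by (simp add: z_def)
      have "\<delta> z \<le> dist z p"
        by (rule bdist_le_dist[OF p(1)])
      also have "\<dots> \<le> dist x z + \<delta> x"
        using dist_triangle[of z p x] p(2) by (simp add: dist_commute)
      finally have "dist x q < 5 * r"
        using dist_triangle[of x q z] q(2) xz x(2) r by simp
      from cone[OF q(1) this] obtain n where n: "norm n = 1" "\<forall>z\<in>\<Omega>. \<delta> z \<le> (z - q) \<bullet> n" "2 / 3 \<le> \<nu> \<bullet> n"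
        by blast
      have "\<delta> y + 2 / 3 * t \<le> (y - q) \<bullet> n + t * (\<nu> \<bullet> n)"
        using n(2,3) y(1) t mult_left_mono[OF n(3), of t] by (intro add_mono) (auto simp: mult.commute)
      also have "\<dots> = (z - q) \<bullet> n"
        by (simp add: z_def inner_diff_left inner_add_left)
      also have "\<dots> \<le> dist z q"
        using norm_cauchy_schwarz[of "z - q" n] n(1) by (simp add: dist_norm)
      finally show ?thesis
        using in_dom q(2) by (simp add: z_def)
    qed
    then show "\<exists>\<nu>. norm \<nu> = 1 \<and> (\<forall>y\<in>\<Omega>. dist x y \<le> r \<longrightarrow>
        (\<forall>t\<in>{0..r}. y + t *\<^sub>R \<nu> \<in> \<Omega> \<and> \<delta> y + 2 / 3 * t \<le> \<delta> (y + t *\<^sub>R \<nu>)))"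
      using \<nu>(1) by blast
  qed
qed

text \<open>
  The cost \<open>R\<close> of a path is a Henstock--Kurzweil integral of a majorant \<open>\<phi>\<close>: the Kobayashi metric along
  the path is not known to be measurable, so that its own integrals over adjacent intervals could
  not be added.
\<close>

definition reachable :: "real \<Rightarrow> real \<Rightarrow> complex ^ 'n \<Rightarrow> complex ^ 'n \<Rightarrow> real \<Rightarrow> bool" where
  "reachable a b x y R \<longleftrightarrow> (\<exists>c L \<phi> N. L-lipschitz_on {a..b} c \<and> c ` {a..b} \<subseteq> \<Omega> \<and> c a = x \<and> c b = y \<and>
     (\<phi> has_integral R) {a..b} \<and> (\<forall>t. 0 \<le> \<phi> t) \<and> finite N \<and>
     (\<forall>t\<in>{a<..<b} - N. \<exists>v. (c has_vector_derivative v) (at t) \<and> kobayashi_metric \<Omega> (c t) v \<le> \<phi> t))"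

lemma reachable_imp_kobayashi_dist_le:
  assumes "reachable a b x y R" "a \<le> b"
  shows "kobayashi_dist \<Omega> x y \<le> ennreal R"
proof -
  obtain c L \<phi> N where c: "L-lipschitz_on {a..b} c" "c ` {a..b} \<subseteq> \<Omega>" "c a = x" "c b = y"
     "(\<phi> has_integral R) {a..b}" "\<And>t. 0 \<le> \<phi> t" "finite N"
     "\<And>t. t \<in> {a<..<b} - N \<Longrightarrow> \<exists>v. (c has_vector_derivative v) (at t) \<and> kobayashi_metric \<Omega> (c t) v \<le> \<phi> t"
    using assms(1) unfolding reachable_def by blast
  have "kobayashi_dist \<Omega> x y \<le> kobayashi_length \<Omega> a b c"
    by (rule kobayashi_dist_le[OF assms(2) lipschitz_imp_absolutely_continuous_curve[OF c(1)] c(2-4)])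
  also have "\<dots> \<le> (\<integral>\<^sup>+t. indicator {a..b} t * ennreal (\<phi> t) \<partial>lebesgue)"
    unfolding kobayashi_length_def
  proof (rule nn_integral_mono_AE)
    have "negligible (N \<union> {a, b})"
      using c(7) by (intro negligible_finite) auto
    then have "AE t in lebesgue. t \<notin> N \<union> {a, b}"
      unfolding negligible_iff_null_sets by (rule AE_not_in)
    then show "AE t in lebesgue. ennreal (kobayashi_metric \<Omega> (c t) (vector_derivative c (at t))) * indicator {a..b} t
        \<le> indicator {a..b} t * ennreal (\<phi> t)"
    proof eventually_elim
      case (elim t)
      show ?case
      proof (cases "t \<in> {a..b}")
        case True
        then have "t \<in> {a<..<b} - N"
          using elim by auto
        from c(8)[OF this] obtain v where "(c has_vector_derivative v) (at t)" "kobayashi_metric \<Omega> (c t) v \<le> \<phi> t"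
          by blast
        then show ?thesis
          using True by (simp add: vector_derivative_at ennreal_leI)
      qed simp
    qed
  qed
  also have "\<dots> = ennreal R"
    unfolding nn_integral_completion
    using nn_integral_has_integral_lebesgue'[OF c(6,5)] by (simp add: mult.commute)
  finally show ?thesis .
qed

lemma reachable_trans:
  assumes xy: "reachable a b x y R" and yz: "reachable b c y z S" and abc: "a \<le> b" "b \<le> c"
  shows "reachable a c x z (R + S)"
proof -
  obtain f L \<phi> N where f: "L-lipschitz_on {a..b} f" "f ` {a..b} \<subseteq> \<Omega>" "f a = x" "f b = y"
     "(\<phi> has_integral R) {a..b}" "\<And>t. 0 \<le> \<phi> t" "finite N"
     "\<And>t. t \<in> {a<..<b} - N \<Longrightarrow> \<exists>v. (f has_vector_derivative v) (at t) \<and> kobayashi_metric \<Omega> (f t) v \<le> \<phi> t"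
    using xy unfolding reachable_def by blast
  obtain g M \<psi> N' where g: "M-lipschitz_on {b..c} g" "g ` {b..c} \<subseteq> \<Omega>" "g b = y" "g c = z"
     "(\<psi> has_integral S) {b..c}" "\<And>t. 0 \<le> \<psi> t" "finite N'"
     "\<And>t. t \<in> {b<..<c} - N' \<Longrightarrow> \<exists>v. (g has_vector_derivative v) (at t) \<and> kobayashi_metric \<Omega> (g t) v \<le> \<psi> t"
    using yz unfolding reachable_def by blast
  define h where "h t = (if t \<le> b then f t else g t)" for t
  define \<xi> where "\<xi> t = (if t \<le> b then \<phi> t else \<psi> t)" for t
  have "(max L M)-lipschitz_on {a..c} h"
    unfolding h_def using f(4) g(3) by (intro lipschitz_on_concat_max f(1) g(1)) auto
  moreover have "h ` {a..c} \<subseteq> \<Omega>"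
    using f(2) g(2) by (auto simp: h_def image_subset_iff)
  moreover have "h a = x" "h c = z"
    using f(3,4) g(3,4) abc by (auto simp: h_def)
  moreover have "(\<xi> has_integral (R + S)) {a..c}"
  proof (rule has_integral_combine[OF abc])
    show "(\<xi> has_integral R) {a..b}"
      by (rule has_integral_eq[OF _ f(5)]) (simp add: \<xi>_def)
    show "(\<xi> has_integral S) {b..c}"
      by (rule has_integral_spike_finite[of "{b}", OF _ _ g(5)]) (auto simp: \<xi>_def)
  qed
  moreover have "\<forall>t. 0 \<le> \<xi> t"
    using f(6) g(6) by (simp add: \<xi>_def)
  \<comment> \<open>The joined path may have a corner at \<open>b\<close>, so this parameter joins
    the exceptional set.\<close>
  moreover have "finite (N \<union> N' \<union> {b})"
    using f(7) g(7) by simp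
  moreover have "\<exists>v. (h has_vector_derivative v) (at t) \<and> kobayashi_metric \<Omega> (h t) v \<le> \<xi> t"
    if t: "t \<in> {a<..<c} - (N \<union> N' \<union> {b})" for t
  proof (cases "t < b")
    case True
    then obtain v where v: "(f has_vector_derivative v) (at t)" "kobayashi_metric \<Omega> (f t) v \<le> \<phi> t"
      using f(8)[of t] t by auto
    have "(h has_vector_derivative v) (at t)"
      by (rule has_vector_derivative_transform_within_open[OF v(1), of "{..<b}"]) (use True in \<open>auto simp: h_def\<close>)
    then show ?thesis
      using v(2) True by (auto simp: h_def \<xi>_def)
  next
    case False
    then have gt: "b < t" using t by auto
    then obtain v where v: "(g has_vector_derivative v) (at t)" "kobayashi_metric \<Omega> (g t) v \<le> \<psi> t"
      using g(8)[of t] t by auto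
    have "(h has_vector_derivative v) (at t)"
      by (rule has_vector_derivative_transform_within_open[OF v(1), of "{b<..}"]) (use gt in \<open>auto simp: h_def\<close>)
    then show ?thesis
      using v(2) gt by (auto simp: h_def \<xi>_def)
  qed
  show ?thesis
    unfolding reachable_def
    by (intro exI[of _ h] exI[of _ "max L M"] exI[of _ \<xi>] exI[of _ "N \<union> N' \<union> {b}"] conjI ballI) fact+
qed

lemma reachable_segment:
  assumes x: "x \<in> \<Omega>" and y: "y \<in> \<Omega>"
    and D: "\<And>s. s \<in> {0..1} \<Longrightarrow> (\<Phi> has_real_derivative \<Phi>' s) (at s)"
    and le: "\<And>s. s \<in> {0..1} \<Longrightarrow> norm (y - x) / \<delta> (x + s *\<^sub>R (y - x)) \<le> \<Phi>' s"
  shows "reachable a (a + 1) x y (\<Phi> 1 - \<Phi> 0)"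
proof -
  define c where "c t = x + (t - a) *\<^sub>R (y - x)" for t
  define \<phi> where "\<phi> t = (if t \<in> {a..a+1} then \<Phi>' (t - a) else 0)" for t
  have in_dom: "c t \<in> \<Omega>" if "t \<in> {a..a+1}" for t
    unfolding c_def by (rule segment_in_dom[OF x y]) (use that in auto)
  have "(norm (y - x))-lipschitz_on {a..a+1} c"
  proof (rule lipschitz_onI)
    fix s t
    have "c s - c t = (s - t) *\<^sub>R (y - x)"
      by (simp add: c_def algebra_simps)
    then show "dist (c s) (c t) \<le> norm (y - x) * dist s t"
      by (simp add: dist_norm)
  qed simp
  moreover have "c ` {a..a+1} \<subseteq> \<Omega>"
    using in_dom by blast
  moreover have "c a = x" "c (a + 1) = y"
    by (simp_all add: c_def)
  moreover have "(\<phi> has_integral (\<Phi> 1 - \<Phi> 0)) {a..a+1}"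
  proof -
    have "((\<lambda>t. \<Phi>' (t - a)) has_integral ((\<lambda>t. \<Phi> (t - a)) (a + 1) - (\<lambda>t. \<Phi> (t - a)) a)) {a..a+1}"
    proof (rule fundamental_theorem_of_calculus)
      fix t assume t: "t \<in> {a..a+1}"
      have "((\<lambda>t. \<Phi> (t - a)) has_real_derivative (\<Phi>' (t - a) * 1)) (at t)"
        by (rule DERIV_chain2[OF D]) (use t in \<open>auto intro!: derivative_eq_intros\<close>)
      then show "((\<lambda>t. \<Phi> (t - a)) has_vector_derivative \<Phi>' (t - a)) (at t within {a..a+1})"
        by (simp add: has_real_derivative_iff_has_vector_derivative has_vector_derivative_at_within)
    qed simp
    then have "((\<lambda>t. \<Phi>' (t - a)) has_integral (\<Phi> 1 - \<Phi> 0)) {a..a+1}"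
      by simp
    then show ?thesis
      by (rule has_integral_eq[rotated]) (simp add: \<phi>_def)
  qed
  moreover have "0 \<le> \<phi> t" for t
  proof (cases "t \<in> {a..a+1}")
    case True
    have "0 \<le> norm (y - x) / \<delta> (c t)"
      using bdist_pos[OF in_dom[OF True]] by simp
    then show ?thesis
      using le[of "t - a"] True by (simp add: \<phi>_def c_def)
  qed (simp only: \<phi>_def if_False)
  moreover have "\<exists>v. (c has_vector_derivative v) (at t) \<and> kobayashi_metric \<Omega> (c t) v \<le> \<phi> t" if t: "t \<in> {a<..<a+1} - {}" for t
  proof (intro exI conjI)
    show "(c has_vector_derivative (y - x)) (at t)"
      unfolding c_def by (auto intro!: derivative_eq_intros)
    have "kobayashi_metric \<Omega> (c t) (y - x) \<le> norm (y - x) / \<delta> (c t)"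
      using t by (intro kobayashi_metric_le in_dom) auto
    also have "\<dots> \<le> \<phi> t"
      using le[of "t - a"] t by (simp add: \<phi>_def c_def)
    finally show "kobayashi_metric \<Omega> (c t) (y - x) \<le> \<phi> t" .
  qed
  show ?thesis
    unfolding reachable_def
    by (intro exI[of _ c] exI[of _ "norm (y - x)"] exI[of _ \<phi>] exI[of _ "{}"] conjI ballI allI finite.emptyI) fact+
qed

lemma reachable_away_from_boundary:
  assumes "x \<in> \<Omega>" "y \<in> \<Omega>" "0 < \<eta>" "\<eta> \<le> \<delta> x" "\<eta> \<le> \<delta> y" "dist x y \<le> D"
  shows "reachable a (a + 1) x y (D / \<eta>)"
proof -
  have D0: "0 \<le> D"
    using assms(6) zero_le_dist[of x y] by linarith
  have "reachable a (a + 1) x y (1 * (D / \<eta>) - 0 * (D / \<eta>))"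
  proof (rule reachable_segment[OF assms(1,2), where \<Phi> = "\<lambda>s. s * (D / \<eta>)" and \<Phi>' = "\<lambda>s. D / \<eta>"])
    fix s :: real assume s: "s \<in> {0..1}"
    show "((\<lambda>s. s * (D / \<eta>)) has_real_derivative D / \<eta>) (at s)"
      using assms(3) by (auto intro!: derivative_eq_intros)
    have "\<eta> = (1 - s) * \<eta> + s * \<eta>"
      by algebra
    also have "\<dots> \<le> (1 - s) * \<delta> x + s * \<delta> y"
      using assms s by (intro add_mono mult_left_mono) auto
    also have "\<dots> \<le> \<delta> (x + s *\<^sub>R (y - x))"
      using s by (intro bdist_concave assms) auto
    finally have "\<eta> \<le> \<delta> (x + s *\<^sub>R (y - x))" .
    then show "norm (y - x) / \<delta> (x + s *\<^sub>R (y - x)) \<le> D / \<eta>"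
      using assms D0 by (intro frac_le) (auto simp: dist_norm norm_minus_commute)
  qed
  then show ?thesis by simp
qed

text \<open>The bound is the integral of \<open>D / (H + B * s)\<close> over the unit interval. The
  way back is obtained by the substitution of \<open>1 - s\<close> for \<open>s\<close> rather than
  from a symmetry of the metric.\<close>

lemma reachable_log:
  assumes x: "x \<in> \<Omega>" and y: "y \<in> \<Omega>" and HB: "0 < H" "0 < B" and D: "dist x y \<le> D"
    and le: "\<And>s. s \<in> {0..1} \<Longrightarrow> H + B * s \<le> \<delta> (x + s *\<^sub>R (y - x))"
  shows "reachable a (a + 1) x y (D / B * ln (1 + B / H))" "reachable a (a + 1) y x (D / B * ln (1 + B / H))"
proof -
  have D0: "0 \<le> D"
    using D zero_le_dist[of x y] by linarith
  have ln: "ln (H + B) - ln H = ln (1 + B / H)"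
  proof -
    have "1 + B / H = (H + B) / H"
      using HB by (simp add: field_simps)
    then show ?thesis
      using HB by (simp add: ln_div)
  qed
  have pos: "H + B * s > 0" if "s \<ge> 0" for s
    using HB that by (simp add: add_pos_nonneg)
  have "reachable a (a + 1) x y ((\<lambda>s. D / B * ln (H + B * s)) 1 - (\<lambda>s. D / B * ln (H + B * s)) 0)"
  proof (rule reachable_segment[OF x y])
    fix s :: real assume s: "s \<in> {0..1}"
    show "((\<lambda>s. D / B * ln (H + B * s)) has_real_derivative D / (H + B * s)) (at s)"
    proof -
      have "((\<lambda>s. D / B * ln (H + B * s)) has_real_derivative D / B * (B / (H + B * s))) (at s)"
        using pos[of s] s by (intro DERIV_cmult) (auto intro!: derivative_eq_intros)
      then show ?thesis
        using HB by simp
    qed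
    show "norm (y - x) / \<delta> (x + s *\<^sub>R (y - x)) \<le> D / (H + B * s)"
      using pos[of s] s le[OF s] D D0 by (intro frac_le) (auto simp: dist_norm norm_minus_commute)
  qed
  then show "reachable a (a + 1) x y (D / B * ln (1 + B / H))"
    by (simp add: ln[symmetric] right_diff_distrib)
  have "reachable a (a + 1) y x ((\<lambda>s. - (D / B * ln (H + B * (1 - s)))) 1 - (\<lambda>s. - (D / B * ln (H + B * (1 - s)))) 0)"
  proof (rule reachable_segment[OF y x])
    fix s :: real assume s: "s \<in> {0..1}"
    show "((\<lambda>s. - (D / B * ln (H + B * (1 - s)))) has_real_derivative D / (H + B * (1 - s))) (at s)"
    proof -
      have "((\<lambda>s. - (D / B) * ln (H + B * (1 - s))) has_real_derivative - (D / B) * (- B / (H + B * (1 - s)))) (at s)"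
        using pos[of "1 - s"] s by (intro DERIV_cmult) (auto intro!: derivative_eq_intros)
      then show ?thesis
        using HB by simp
    qed
    have "H + B * (1 - s) \<le> \<delta> (x + (1 - s) *\<^sub>R (y - x))"
      using s by (intro le) auto
    also have "x + (1 - s) *\<^sub>R (y - x) = y + s *\<^sub>R (x - y)"
      by (simp add: algebra_simps)
    finally show "norm (x - y) / \<delta> (y + s *\<^sub>R (x - y)) \<le> D / (H + B * (1 - s))"
      using pos[of "1 - s"] s D D0 by (intro frac_le) (auto simp: dist_norm)
  qed
  then show "reachable a (a + 1) y x (D / B * ln (1 + B / H))"
    by (simp add: ln[symmetric] right_diff_distrib)
qed

lemma bdist_attains_sup:
  obtains x0 where "x0 \<in> \<Omega>" "\<And>x. x \<in> \<Omega> \<Longrightarrow> \<delta> x \<le> \<delta> x0"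
proof -
  have "compact (closure \<Omega>)"
    using bounded_dom by (simp add: compact_closure)
  then obtain x0 where x0: "x0 \<in> closure \<Omega>" "\<And>x. x \<in> closure \<Omega> \<Longrightarrow> \<delta> x \<le> \<delta> x0"
    using continuous_attains_sup[OF _ _ continuous_on_bdist] nonempty_dom by (metis closure_eq_empty)
  obtain z where z: "z \<in> \<Omega>" using nonempty_dom by blast
  have "0 < \<delta> x0"
    using bdist_pos[OF z] x0(2)[of z] z closure_subset by force
  then have "x0 \<notin> frontier \<Omega>"
    using bdist_le_dist[of x0 x0] by auto
  then have "x0 \<in> \<Omega>"
    using x0(1) open_dom by (simp add: frontier_def interior_open)
  then show ?thesis
    using that x0(2) closure_subset by blast
qed

text \<open>Every path is routed through a point \<open>x0\<close> where \<delta> is maximal; by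
  concavity \<delta> grows at least linearly towards it.\<close>

lemma kobayashi_dist_le_log_bdist:
  obtains A B where "A > 0" "B > 0" "\<And>x. x \<in> \<Omega> \<Longrightarrow> \<delta> x \<le> B"
    "\<And>x y. x \<in> \<Omega> \<Longrightarrow> y \<in> \<Omega> \<Longrightarrow> kobayashi_dist \<Omega> x y \<le> ennreal (A * (ln (B / \<delta> x) + ln (B / \<delta> y)))"
proof -
  obtain x0 where x0: "x0 \<in> \<Omega>" "\<And>x. x \<in> \<Omega> \<Longrightarrow> \<delta> x \<le> \<delta> x0"
    using bdist_attains_sup by blast
  obtain D where D: "\<And>x y. x \<in> \<Omega> \<Longrightarrow> y \<in> \<Omega> \<Longrightarrow> dist x y \<le> D" "D > 0"
  proof -
    obtain e where e: "\<forall>y\<in>\<Omega>. dist x0 y \<le> e"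
      using bounded_dom bounded_any_center by blast
    have "dist x y \<le> 2 * \<bar>e\<bar> + 1" if "x \<in> \<Omega>" "y \<in> \<Omega>" for x y
    proof -
      have "dist x0 x \<le> e" "dist x0 y \<le> e"
        using e that by auto
      then show ?thesis
        using dist_triangle[of x y x0] by (simp add: dist_commute)
    qed
    then show ?thesis
      by (rule that) auto
  qed
  have d0: "\<delta> x0 > 0" by (rule bdist_pos[OF x0(1)])
  define A B where "A = D / (\<delta> x0 / 2)" and "B = 2 * \<delta> x0"
  have AB: "A > 0" "B > 0"
    using d0 D(2) by (auto simp: A_def B_def)
  have leg: "reachable a (a + 1) x x0 (A * ln (1 + (\<delta> x0 / 2) / (\<delta> x / 2)))"
      "reachable a (a + 1) x0 x (A * ln (1 + (\<delta> x0 / 2) / (\<delta> x / 2)))"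
    and ln: "A * ln (1 + (\<delta> x0 / 2) / (\<delta> x / 2)) \<le> A * ln (B / \<delta> x)"
    if x: "x \<in> \<Omega>" for a x
  proof -
    \<comment> \<open>Concavity alone gives the slope \<open>\<delta> x0 - \<delta> x\<close>, which
      may be arbitrarily small. Giving away half of \<open>\<delta> x\<close> at the start raises
      the slope to \<open>\<delta> x0 / 2\<close>, so that \<open>A\<close> does not depend on
      \<open>x\<close>.\<close>
    have le: "\<delta> x / 2 + \<delta> x0 / 2 * s \<le> \<delta> (x + s *\<^sub>R (x0 - x))" if s: "s \<in> {0..1}" for s
    proof -
      have "\<delta> x / 2 + \<delta> x0 / 2 * s \<le> (1 - s) * \<delta> x + s * \<delta> x0"
      proof -
        have "(1 - s) * \<delta> x + s * \<delta> x0 - (\<delta> x / 2 + \<delta> x0 / 2 * s) = s / 2 * (\<delta> x0 - \<delta> x) + (1 - s) / 2 * \<delta> x"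
          by (simp add: field_simps)
        also have "\<dots> \<ge> 0"
          using s x0(2)[OF x] bdist_pos[OF x] by (intro add_nonneg_nonneg mult_nonneg_nonneg) auto
        finally show ?thesis by linarith
      qed
      also have "\<dots> \<le> \<delta> (x + s *\<^sub>R (x0 - x))"
        using s by (intro bdist_concave x x0) auto
      finally show ?thesis .
    qed
    show "reachable a (a + 1) x x0 (A * ln (1 + (\<delta> x0 / 2) / (\<delta> x / 2)))"
      "reachable a (a + 1) x0 x (A * ln (1 + (\<delta> x0 / 2) / (\<delta> x / 2)))"
      unfolding A_def by (rule reachable_log[OF x x0(1) _ _ D(1)[OF x x0(1)] le]; use bdist_pos[OF x] d0 in simp)+
    have "1 + (\<delta> x0 / 2) / (\<delta> x / 2) \<le> B / \<delta> x"
      using bdist_pos[OF x] x0(2)[OF x] by (simp add: B_def field_simps)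
    then show "A * ln (1 + (\<delta> x0 / 2) / (\<delta> x / 2)) \<le> A * ln (B / \<delta> x)"
      using bdist_pos[OF x] d0 AB by (intro mult_left_mono) (auto simp: add_pos_nonneg)
  qed
  show ?thesis
  proof (rule that[OF AB])
    show "\<delta> x \<le> B" if "x \<in> \<Omega>" for x
      using x0(2)[OF that] d0 by (simp add: B_def)
    fix x y assume xy: "x \<in> \<Omega>" "y \<in> \<Omega>"
    have "reachable 0 (1 + 1) x y (A * ln (1 + (\<delta> x0 / 2) / (\<delta> x / 2)) + A * ln (1 + (\<delta> x0 / 2) / (\<delta> y / 2)))"
      using leg(1)[OF xy(1), of 0] leg(2)[OF xy(2), of 1] by (intro reachable_trans[of 0 1 x x0]) auto
    then have "kobayashi_dist \<Omega> x y \<le> ennreal (A * ln (1 + (\<delta> x0 / 2) / (\<delta> x / 2)) + A * ln (1 + (\<delta> x0 / 2) / (\<delta> y / 2)))"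
      by (rule reachable_imp_kobayashi_dist_le) simp
    also have "\<dots> \<le> ennreal (A * (ln (B / \<delta> x) + ln (B / \<delta> y)))"
      unfolding distrib_left using ln[OF xy(1)] ln[OF xy(2)] by (intro ennreal_leI add_mono)
    finally show "kobayashi_dist \<Omega> x y \<le> ennreal (A * (ln (B / \<delta> x) + ln (B / \<delta> y)))" .
  qed
qed

lemma kobayashi_dist_le_away_from_boundary:
  assumes "x \<in> \<Omega>" "y \<in> \<Omega>" "0 < \<eta>" "\<eta> \<le> \<delta> x" "\<eta> \<le> \<delta> y" "dist x y \<le> D"
  shows "kobayashi_dist \<Omega> x y \<le> ennreal (D / \<eta>)"
  using reachable_imp_kobayashi_dist_le[OF reachable_away_from_boundary[OF assms, of 0]] by simp

text \<open>
  The factor 3 is what matters here. Moving inwards gains distance to the boundary at rate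
  \<open>2 / 3\<close>, hence costs \<open>3 / 2\<close> times a logarithm, once for each end point; any factor up to
  \<open>3 * m\<close> suffices in the end.
\<close>

lemma kobayashi_dist_le_near_boundary:
  assumes C1: "C1_boundary \<Omega>"
  obtains r where "r > 0" "\<And>x y T H. x \<in> \<Omega> \<Longrightarrow> y \<in> \<Omega> \<Longrightarrow> \<delta> x < r \<Longrightarrow> 0 < H \<Longrightarrow> H \<le> \<delta> x \<Longrightarrow> H \<le> \<delta> y \<Longrightarrow>
     dist x y \<le> T \<Longrightarrow> 0 < T \<Longrightarrow> T \<le> r \<Longrightarrow> kobayashi_dist \<Omega> x y \<le> ennreal (3 * ln (1 + 2 / 3 * T / H) + 3 / 2)"
proof -
  obtain r where r: "r > 0" "\<And>x. x \<in> \<Omega> \<Longrightarrow> \<delta> x < r \<Longrightarrow> \<exists>\<nu>. norm \<nu> = 1 \<and>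
    (\<forall>y\<in>\<Omega>. dist x y \<le> r \<longrightarrow> (\<forall>t\<in>{0..r}. y + t *\<^sub>R \<nu> \<in> \<Omega> \<and> \<delta> y + 2 / 3 * t \<le> \<delta> (y + t *\<^sub>R \<nu>)))"
    using uniform_inward_direction[OF C1] by blast
  show ?thesis
  proof (rule that[OF r(1)])
    fix x y T H
    assume xy: "x \<in> \<Omega>" "y \<in> \<Omega>" and dx: "\<delta> x < r" and H: "0 < H" "H \<le> \<delta> x" "H \<le> \<delta> y"
      and T: "dist x y \<le> T" "0 < T" "T \<le> r"
    obtain \<nu> where \<nu>: "norm \<nu> = 1"
      "\<And>y t. y \<in> \<Omega> \<Longrightarrow> dist x y \<le> r \<Longrightarrow> t \<in> {0..r} \<Longrightarrow> y + t *\<^sub>R \<nu> \<in> \<Omega> \<and> \<delta> y + 2 / 3 * t \<le> \<delta> (y + t *\<^sub>R \<nu>)"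
      using r(2)[OF xy(1) dx] by blast
    define R where "R = T / (2 / 3 * T) * ln (1 + 2 / 3 * T / H)"
    have leg: "reachable a (a + 1) z (z + T *\<^sub>R \<nu>) R" "reachable a (a + 1) (z + T *\<^sub>R \<nu>) z R"
      and mid: "z + T *\<^sub>R \<nu> \<in> \<Omega>" "2 / 3 * T \<le> \<delta> (z + T *\<^sub>R \<nu>)"
      if z: "z \<in> \<Omega>" "dist x z \<le> r" "H \<le> \<delta> z" for a z
    proof -
      have zT: "z + T *\<^sub>R \<nu> \<in> \<Omega> \<and> \<delta> z + 2 / 3 * T \<le> \<delta> (z + T *\<^sub>R \<nu>)"
        using T by (intro \<nu>(2) z) auto
      then show zO: "z + T *\<^sub>R \<nu> \<in> \<Omega>" and "2 / 3 * T \<le> \<delta> (z + T *\<^sub>R \<nu>)"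
        using bdist_pos[OF z(1)] by auto
      have le: "H + 2 / 3 * T * s \<le> \<delta> (z + s *\<^sub>R (z + T *\<^sub>R \<nu> - z))" if s: "s \<in> {0..1}" for s
      proof -
        have "s * T \<le> 1 * r"
          using s T by (intro mult_mono) auto
        then have 1: "\<delta> z + 2 / 3 * (s * T) \<le> \<delta> (z + (s * T) *\<^sub>R \<nu>)"
          using s T \<nu>(2)[OF z(1,2), of "s * T"] by auto
        have 2: "z + s *\<^sub>R (z + T *\<^sub>R \<nu> - z) = z + (s * T) *\<^sub>R \<nu>"
          by simp
        have 3: "2 / 3 * T * s = 2 / 3 * (s * T)"
          by simp
        show ?thesis
          unfolding 2 3 using 1 z(3) by linarith
      qed
      have dz: "dist z (z + T *\<^sub>R \<nu>) \<le> T"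
        using T \<nu>(1) by (simp add: dist_norm)
      have T': "0 < 2 / 3 * T" using T by simp
      show "reachable a (a + 1) z (z + T *\<^sub>R \<nu>) R" "reachable a (a + 1) (z + T *\<^sub>R \<nu>) z R"
        unfolding R_def using reachable_log[OF z(1) zO H(1) T' dz le] by simp_all
    qed
    have x: "dist x x \<le> r" "dist x y \<le> r"
      using T r(1) by auto
    have 1: "reachable 0 1 x (x + T *\<^sub>R \<nu>) R"
      using leg(1)[OF xy(1) x(1) H(2), of 0] by simp
    \<comment> \<open>Both moved points have \<delta> at least \<open>2 / 3 * T\<close> and remain
      within \<open>T\<close> of each other, so this leg costs \<open>3 / 2\<close> whatever
      \<open>T\<close> is.\<close>
    have 2: "reachable 1 2 (x + T *\<^sub>R \<nu>) (y + T *\<^sub>R \<nu>) (T / (2 / 3 * T))"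
      using reachable_away_from_boundary[OF mid(1)[OF xy(1) x(1) H(2)] mid(1)[OF xy(2) x(2) H(3)] _
        mid(2)[OF xy(1) x(1) H(2)] mid(2)[OF xy(2) x(2) H(3)], of T 1] T by (simp add: dist_norm)
    have 3: "reachable 2 3 (y + T *\<^sub>R \<nu>) y R"
      using leg(2)[OF xy(2) x(2) H(3), of 2] by simp
    have "reachable 0 2 x (y + T *\<^sub>R \<nu>) (R + T / (2 / 3 * T))"
      by (rule reachable_trans[OF 1 2]) auto
    then have "reachable 0 3 x y (R + T / (2 / 3 * T) + R)"
      by (rule reachable_trans[OF _ 3]) auto
    then have "kobayashi_dist \<Omega> x y \<le> ennreal (R + T / (2 / 3 * T) + R)"
      by (rule reachable_imp_kobayashi_dist_le) simp
    also have "R + T / (2 / 3 * T) + R = 3 * ln (1 + 2 / 3 * T / H) + 3 / 2"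
      using T(2) by (simp add: R_def)
    finally show "kobayashi_dist \<Omega> x y \<le> ennreal (3 * ln (1 + 2 / 3 * T / H) + 3 / 2)" .
  qed
qed

end

section \<open>Geodesics\<close>

lemma ennreal_powr_mono:
  assumes "x \<le> ennreal y" "0 \<le> y" "0 \<le> \<alpha>"
  shows "ennreal_powr x \<alpha> \<le> ennreal (y powr \<alpha>)"
proof -
  have fin: "x < \<infinity>"
    using assms(1) by (rule le_less_trans) simp
  have "enn2real x \<le> y"
    using assms(1,2) by (intro enn2real_leI)
  then have "enn2real x powr \<alpha> \<le> y powr \<alpha>"
    using assms(3) by (intro powr_mono2) auto
  then show ?thesis
    using fin by (auto simp: ennreal_powr_def ennreal_leI)
qed

lemma kobayashi_geodesicD:
  assumes "kobayashi_geodesic \<Omega> I \<sigma>" "s \<in> I" "t \<in> I"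
  shows "\<sigma> s \<in> \<Omega>" "kobayashi_dist \<Omega> (\<sigma> s) (\<sigma> t) = ennreal \<bar>t - s\<bar>"
  using assms unfolding kobayashi_geodesic_def by auto

lemma kobayashi_geodesic_subinterval:
  assumes "kobayashi_geodesic \<Omega> {a..b} \<sigma>" "a \<le> c" "d \<le> b"
  shows "kobayashi_geodesic \<Omega> {c..d} \<sigma>"
  using assms unfolding kobayashi_geodesic_def by (auto simp: image_subset_iff is_interval_cc)

lemma kobayashi_geodesic_reverse:
  assumes "kobayashi_geodesic \<Omega> {a..b} \<sigma>"
  shows "kobayashi_geodesic \<Omega> {- b..- a} (\<lambda>t. \<sigma> (- t))"
  unfolding kobayashi_geodesic_def
proof (intro conjI ballI)
  show "is_interval {- b..- a}"
    by (rule is_interval_cc)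
  show "(\<lambda>t. \<sigma> (- t)) ` {- b..- a} \<subseteq> \<Omega>"
  proof (rule image_subsetI)
    fix t assume "t \<in> {- b..- a}"
    then show "\<sigma> (- t) \<in> \<Omega>"
      by (intro kobayashi_geodesicD(1)[OF assms, of "- t" "- t"]) auto
  qed
  fix s t assume "s \<in> {- b..- a}" "t \<in> {- b..- a}"
  then have "kobayashi_dist \<Omega> (\<sigma> (- s)) (\<sigma> (- t)) = ennreal \<bar>(- t) - (- s)\<bar>"
    by (intro kobayashi_geodesicD(2)[OF assms]) auto
  then show "kobayashi_dist \<Omega> (\<sigma> (- s)) (\<sigma> (- t)) = ennreal \<bar>t - s\<bar>"
    by (simp add: abs_minus_commute)
qed

lemma kobayashi_geodesic_dist_le:
  assumes "kobayashi_geodesic \<Omega> {a..b} \<sigma>" "s \<in> {a..b}" "t \<in> {a..b}"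
    "kobayashi_dist \<Omega> (\<sigma> s) (\<sigma> t) \<le> ennreal R" "0 \<le> R"
  shows "\<bar>t - s\<bar> \<le> R"
  using assms(4,5) kobayashi_geodesicD(2)[OF assms(1-3)] by (simp add: ennreal_le_iff)

context bounded_convex_domain
begin

lemma geodesic_log_bdist:
  assumes "kobayashi_geodesic \<Omega> {a..b} \<sigma>" "s \<in> {a..b}" "t \<in> {a..b}"
  shows "ln (\<delta> (\<sigma> s) / \<delta> (\<sigma> t)) / 2 \<le> \<bar>t - s\<bar>"
  using log_bdist_le_kobayashi_dist[of "\<sigma> s" "\<sigma> t"] kobayashi_geodesicD(2)[OF assms]
  by (simp add: ennreal_le_iff)

end

section \<open>Regularity, length and depth of geodesics in m-convex domains\<close>

context m_convex_domain
begin

lemma geodesic_local_lipschitz: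
  assumes "kobayashi_geodesic \<Omega> {a..b} \<sigma>" "s \<in> {a..b}" "t \<in> {a..b}" "\<bar>t - s\<bar> \<le> 1"
  shows "dist (\<sigma> s) (\<sigma> t) \<le> 4 * C * exp 4 * \<delta> (\<sigma> s) powr (1 / m) * \<bar>t - s\<bar>"
proof (cases "s = t")
  case False
  then show ?thesis
    using kobayashi_geodesicD(2)[OF assms(1-3)] assms(4)
    by (intro dist_le_kobayashi_dist) auto
qed simp

text \<open>Continuity is not part of being a geodesic; it is needed for the extrema and
  intermediate values of \<delta> along it.\<close>

lemma geodesic_continuous:
  assumes geo: "kobayashi_geodesic \<Omega> {a..b} \<sigma>"
  shows "continuous_on {a..b} \<sigma>"
  unfolding continuous_on_def
proof
  fix s assume s: "s \<in> {a..b}"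
  define E where "E = 4 * C * exp 4 * \<delta> (\<sigma> s) powr (1 / m)"
  show "(\<sigma> \<longlongrightarrow> \<sigma> s) (at s within {a..b})"
  proof (rule metric_tendsto_imp_tendsto)
    show "((\<lambda>t. E * (t - s)) \<longlongrightarrow> 0) (at s within {a..b})"
      by (auto intro!: tendsto_eq_intros)
    have "\<forall>\<^sub>F t in at s within {a..b}. t \<in> {a..b} \<and> dist t s < 1"
      unfolding eventually_at by (auto intro!: exI[of _ 1])
    then show "\<forall>\<^sub>F t in at s within {a..b}. dist (\<sigma> t) (\<sigma> s) \<le> dist (E * (t - s)) 0"
    proof eventually_elim
      case (elim t)
      have "0 \<le> E"
        using C by (simp add: E_def)
      then have "dist (E * (t - s)) 0 = E * \<bar>t - s\<bar>"
        by (simp add: abs_mult)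
      moreover have "\<bar>t - s\<bar> \<le> 1"
        using elim by (simp add: dist_real_def)
      ultimately show ?case
        using geodesic_local_lipschitz[OF geo s, of t] elim
        by (simp add: E_def dist_commute)
    qed
  qed
qed

lemma geodesic_bdist_attains_sup:
  assumes geo: "kobayashi_geodesic \<Omega> {a..b} \<sigma>" and "a \<le> c" "c \<le> d" "d \<le> b"
  obtains p where "p \<in> {c..d}" "\<And>t. t \<in> {c..d} \<Longrightarrow> \<delta> (\<sigma> t) \<le> \<delta> (\<sigma> p)"
proof -
  have "continuous_on {c..d} (\<lambda>t. \<delta> (\<sigma> t))"
    using continuous_on_compose2[OF continuous_on_bdist geodesic_continuous[OF geo] subset_UNIV] 
    by (rule continuous_on_subset) (use assms in auto)
  then show ?thesis
    using continuous_attains_sup[of "{c..d}" "\<lambda>t. \<delta> (\<sigma> t)"] assms(3) that by auto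
qed

text \<open>The local Lipschitz constant of the geodesic is of order
  \<open>\<delta> powr (1 / m)\<close> and decays exponentially in the distance from
  \<open>t0\<close>. Its integral is therefore bounded independently of \<open>a\<close> and
  \<open>b\<close>; the integration is done by telescoping against an antiderivative.\<close>

lemma geodesic_length_bound:
  assumes \<beta>: "0 < \<beta>" "\<beta> < 1 / m"
  obtains M where "M > 0"
    "\<And>a b \<sigma> t0. kobayashi_geodesic \<Omega> {a..b} \<sigma> \<Longrightarrow> t0 \<in> {a..b} \<Longrightarrow> (\<And>\<tau>. \<tau> \<in> {a..b} \<Longrightarrow> \<delta> (\<sigma> \<tau>) \<le> \<delta> (\<sigma> t0)) \<Longrightarrow>
      curve_length \<sigma> a b \<le> ennreal (M * \<delta> (\<sigma> t0) powr \<beta>)"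
proof -
  obtain A B where AB: "A > 0" "B > 0" "\<And>x. x \<in> \<Omega> \<Longrightarrow> \<delta> x \<le> B"
    "\<And>x y. x \<in> \<Omega> \<Longrightarrow> y \<in> \<Omega> \<Longrightarrow> kobayashi_dist \<Omega> x y \<le> ennreal (A * (ln (B / \<delta> x) + ln (B / \<delta> y)))"
    using kobayashi_dist_le_log_bdist by blast
  \<comment> \<open>The weight of the decaying bound in the interpolation. That bound contains
    \<open>- ln H\<close>, so the combined coefficient of \<open>ln H\<close> is
    \<open>1 - 2 * \<theta>\<close>, and \<theta> is chosen to make this
    \<open>m * \<beta>\<close>.\<close>
  define \<theta> where "\<theta> = (1 - m * \<beta>) / 2"
  have \<theta>: "0 < \<theta>" "\<theta> < 1" "\<beta> = (1 - 2 * \<theta>) / m"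
  proof -
    have "0 < m * \<beta>" "m * \<beta> < 1"
      using \<beta> m by (auto simp: field_simps)
    then show "0 < \<theta>" "\<theta> < 1"
      by (auto simp: \<theta>_def)
    show "\<beta> = (1 - 2 * \<theta>) / m"
      using m by (simp add: \<theta>_def field_simps)
  qed
  define \<kappa> where "\<kappa> = \<theta> / (A * m)"
  have \<kappa>: "\<kappa> > 0" using \<theta> AB m by (simp add: \<kappa>_def)
  define G where "G = 4 * C * exp 4 * exp (2 * \<theta> / m * ln B)"
  have G: "G > 0" using C by (simp add: G_def)
  show ?thesis
  proof (rule that[of "2 * G / \<kappa>"])
    show "2 * G / \<kappa> > 0" using G \<kappa> by simp
    fix a b \<sigma> t0
    assume geo: "kobayashi_geodesic \<Omega> {a..b} \<sigma>" and t0: "t0 \<in> {a..b}"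
      and max: "\<And>\<tau>. \<tau> \<in> {a..b} \<Longrightarrow> \<delta> (\<sigma> \<tau>) \<le> \<delta> (\<sigma> t0)"
    define H where "H = \<delta> (\<sigma> t0)"
    have dom: "\<sigma> \<tau> \<in> \<Omega>" if "\<tau> \<in> {a..b}" for \<tau>
      using kobayashi_geodesicD(1)[OF geo that that] .
    have H: "H > 0" unfolding H_def by (rule bdist_pos[OF dom[OF t0]])
    define c where "c = G * H powr \<beta>"
    have c: "c > 0" using G H by (simp add: c_def)
    have decay: "4 * C * exp 4 * \<delta> (\<sigma> \<tau>) powr (1 / m) \<le> c * exp (- \<kappa> * \<bar>\<tau> - t0\<bar>)" if \<tau>: "\<tau> \<in> {a..b}" for \<tau>
    proof -
      have d: "\<delta> (\<sigma> \<tau>) > 0" by (rule bdist_pos[OF dom[OF \<tau>]])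
      have l1: "ln (\<delta> (\<sigma> \<tau>)) \<le> ln H"
        using max[OF \<tau>] d by (simp add: H_def)
      have pos: "0 \<le> ln (B / \<delta> (\<sigma> \<tau>))" "0 \<le> ln (B / H)"
        using AB(3)[OF dom[OF \<tau>]] AB(3)[OF dom[OF t0]] d H by (auto simp: H_def)
      have "\<bar>\<tau> - t0\<bar> \<le> A * (ln (B / H) + ln (B / \<delta> (\<sigma> \<tau>)))"
        using AB(4)[OF dom[OF t0] dom[OF \<tau>]] AB(1) pos
        by (intro kobayashi_geodesic_dist_le[OF geo t0 \<tau>]) (auto simp: H_def)
      then have "\<bar>\<tau> - t0\<bar> / A \<le> ln (B / H) + ln (B / \<delta> (\<sigma> \<tau>))"
        using AB(1) by (simp add: divide_le_eq mult.commute)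
      then have l2: "ln (\<delta> (\<sigma> \<tau>)) \<le> 2 * ln B - ln H - \<bar>\<tau> - t0\<bar> / A"
        using AB(2) H d by (simp add: ln_div)
      \<comment> \<open>interpolate between the bound \<open>l1\<close> by the maximum and the exponential decay \<open>l2\<close>\<close>
      have "ln (\<delta> (\<sigma> \<tau>)) = (1 - \<theta>) * ln (\<delta> (\<sigma> \<tau>)) + \<theta> * ln (\<delta> (\<sigma> \<tau>))"
        by (simp add: algebra_simps)
      also have "\<dots> \<le> (1 - \<theta>) * ln H + \<theta> * (2 * ln B - ln H - \<bar>\<tau> - t0\<bar> / A)"
        using \<theta> l1 l2 by (intro add_mono mult_left_mono) auto
      finally have "1 / m * ln (\<delta> (\<sigma> \<tau>)) \<le> 1 / m * ((1 - \<theta>) * ln H + \<theta> * (2 * ln B - ln H - \<bar>\<tau> - t0\<bar> / A))"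
        using m by (intro mult_left_mono) auto
      also have "\<dots> = 2 * \<theta> / m * ln B + \<beta> * ln H + - \<kappa> * \<bar>\<tau> - t0\<bar>"
        using m AB(1) by (simp add: \<theta>(3) \<kappa>_def field_simps)
      finally have "exp (1 / m * ln (\<delta> (\<sigma> \<tau>))) \<le> exp (2 * \<theta> / m * ln B + \<beta> * ln H + - \<kappa> * \<bar>\<tau> - t0\<bar>)"
        by simp
      also have "\<dots> = exp (2 * \<theta> / m * ln B) * H powr \<beta> * exp (- \<kappa> * \<bar>\<tau> - t0\<bar>)"
        using H by (simp only: exp_add powr_def) simp
      finally have "\<delta> (\<sigma> \<tau>) powr (1 / m) \<le> exp (2 * \<theta> / m * ln B) * H powr \<beta> * exp (- \<kappa> * \<bar>\<tau> - t0\<bar>)"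
        using d by (simp add: powr_def)
      then have "4 * C * exp 4 * \<delta> (\<sigma> \<tau>) powr (1 / m) \<le>
          4 * C * exp 4 * (exp (2 * \<theta> / m * ln B) * H powr \<beta> * exp (- \<kappa> * \<bar>\<tau> - t0\<bar>))"
        using C by (intro mult_left_mono) auto
      then show ?thesis
        by (simp add: c_def G_def mult_ac)
    qed
    \<comment> \<open>The antiderivative of
      \<open>exp (- \<kappa> * \<bar>\<tau> - t0\<bar>)\<close> that vanishes at
      \<open>t0\<close>.\<close>
    define \<Psi> where "\<Psi> \<tau> = (if t0 \<le> \<tau> then 1 - exp (- \<kappa> * (\<tau> - t0)) else exp (- \<kappa> * (t0 - \<tau>)) - 1) / \<kappa>" for \<tau>
    have \<Psi>_bound: "\<bar>\<Psi> \<tau>\<bar> \<le> 1 / \<kappa>" for \<tau>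
    proof -
      have "exp (- \<kappa> * (\<tau> - t0)) \<le> 1" if "t0 \<le> \<tau>"
        using \<kappa> that by simp
      moreover have "exp (- \<kappa> * (t0 - \<tau>)) \<le> 1" if "\<tau> \<le> t0"
        using \<kappa> that by simp
      ultimately have "\<bar>if t0 \<le> \<tau> then 1 - exp (- \<kappa> * (\<tau> - t0)) else exp (- \<kappa> * (t0 - \<tau>)) - 1\<bar> \<le> 1"
        using exp_gt_zero[of "- \<kappa> * (\<tau> - t0)"] exp_gt_zero[of "- \<kappa> * (t0 - \<tau>)"] by auto
      then show ?thesis
        using \<kappa> by (simp add: \<Psi>_def abs_divide divide_right_mono del: abs_le_iff)
    qed
    \<comment> \<open>The integral of a decreasing exponential over an interval of length
      \<open>h\<close> is at least \<open>h\<close> times its value at the far end. For this reason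
      the local Lipschitz bound is applied below at the end point farther from
      \<open>t0\<close>.\<close>
    have exp_ineq: "exp (- \<kappa> * (w + h)) * h \<le> (exp (- \<kappa> * w) - exp (- \<kappa> * (w + h))) / \<kappa>" if "h \<ge> 0" for w h
    proof -
      have "\<kappa> * h \<le> exp (\<kappa> * h) - 1"
        using exp_ge_add_one_self[of "\<kappa> * h"] by linarith
      then have "exp (- \<kappa> * (w + h)) * (\<kappa> * h) \<le> exp (- \<kappa> * (w + h)) * (exp (\<kappa> * h) - 1)"
        by (rule mult_left_mono) simp
      also have "\<dots> = exp (- \<kappa> * w) - exp (- \<kappa> * (w + h))"
        by (simp add: right_diff_distrib exp_add[symmetric] algebra_simps)
      finally show ?thesis
        using \<kappa> by (simp add: le_divide_eq mult_ac)
    qed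
    have right: "dist (\<sigma> u) (\<sigma> v) \<le> c * (\<Psi> v - \<Psi> u)"
      if uv: "u \<in> {a..b}" "v \<in> {a..b}" "t0 \<le> u" "u \<le> v" "v - u \<le> 1" for u v
    proof -
      have "dist (\<sigma> v) (\<sigma> u) \<le> 4 * C * exp 4 * \<delta> (\<sigma> v) powr (1 / m) * \<bar>u - v\<bar>"
        using uv by (intro geodesic_local_lipschitz[OF geo]) auto
      also have "\<dots> \<le> c * exp (- \<kappa> * \<bar>v - t0\<bar>) * \<bar>u - v\<bar>"
        by (intro mult_right_mono decay uv) auto
      also have "\<dots> = c * (exp (- \<kappa> * ((u - t0) + (v - u))) * (v - u))"
        using uv by simp
      also have "\<dots> \<le> c * ((exp (- \<kappa> * (u - t0)) - exp (- \<kappa> * ((u - t0) + (v - u)))) / \<kappa>)"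
        using uv c by (intro mult_left_mono exp_ineq) auto
      also have "(exp (- \<kappa> * (u - t0)) - exp (- \<kappa> * ((u - t0) + (v - u)))) / \<kappa> = \<Psi> v - \<Psi> u"
        using uv by (simp add: \<Psi>_def flip: diff_divide_distrib)
      finally show ?thesis
        by (simp add: dist_commute)
    qed
    have left: "dist (\<sigma> u) (\<sigma> v) \<le> c * (\<Psi> v - \<Psi> u)"
      if uv: "u \<in> {a..b}" "v \<in> {a..b}" "v \<le> t0" "u \<le> v" "v - u \<le> 1" for u v
    proof -
      have \<Psi>_left: "\<Psi> \<tau> = (exp (- \<kappa> * (t0 - \<tau>)) - 1) / \<kappa>" if "\<tau> \<le> t0" for \<tau>
        using that by (auto simp: \<Psi>_def)
      have "dist (\<sigma> u) (\<sigma> v) \<le> 4 * C * exp 4 * \<delta> (\<sigma> u) powr (1 / m) * \<bar>v - u\<bar>"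
        using uv by (intro geodesic_local_lipschitz[OF geo]) auto
      also have "\<dots> \<le> c * exp (- \<kappa> * \<bar>u - t0\<bar>) * \<bar>v - u\<bar>"
        by (intro mult_right_mono decay uv) auto
      also have "\<dots> = c * (exp (- \<kappa> * ((t0 - v) + (v - u))) * (v - u))"
        using uv by simp
      also have "\<dots> \<le> c * ((exp (- \<kappa> * (t0 - v)) - exp (- \<kappa> * ((t0 - v) + (v - u)))) / \<kappa>)"
        using uv c by (intro mult_left_mono exp_ineq) auto
      also have "(exp (- \<kappa> * (t0 - v)) - exp (- \<kappa> * ((t0 - v) + (v - u)))) / \<kappa> = \<Psi> v - \<Psi> u"
        using uv by (simp add: \<Psi>_left flip: diff_divide_distrib)
      finally show ?thesis .
    qed
    have short: "dist (\<sigma> u) (\<sigma> v) \<le> c * (\<Psi> v - \<Psi> u)"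
      if uv: "u \<in> {a..b}" "v \<in> {a..b}" "u \<le> v" "v - u \<le> 1" for u v
    proof -
      consider "t0 \<le> u" | "v \<le> t0" | "u \<le> t0" "t0 \<le> v" by linarith
      then show ?thesis
      proof cases
        case 3
        have "dist (\<sigma> u) (\<sigma> v) \<le> dist (\<sigma> u) (\<sigma> t0) + dist (\<sigma> t0) (\<sigma> v)"
          by (rule dist_triangle)
        also have "\<dots> \<le> c * (\<Psi> t0 - \<Psi> u) + c * (\<Psi> v - \<Psi> t0)"
          using uv 3 t0 by (intro add_mono left right) auto
        finally show ?thesis
          by (simp add: algebra_simps)
      qed (use uv in \<open>auto intro: left right\<close>)
    qed
    \<comment> \<open>The local Lipschitz bound reaches only parameter distance 1; longer steps are
      split, as the right-hand side is additive.\<close>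
    have long: "dist (\<sigma> u) (\<sigma> v) \<le> c * (\<Psi> v - \<Psi> u)"
      if "u \<in> {a..b}" "v \<in> {a..b}" "u \<le> v" "v - u \<le> real n" for u v n
      using that
    proof (induction n arbitrary: v)
      case 0
      then show ?case using short[of u v] by simp
    next
      case (Suc n)
      define w where "w = max u (v - 1)"
      have w: "w \<in> {a..b}" "u \<le> w" "w \<le> v" "w - u \<le> real n" "v - w \<le> 1"
        using Suc.prems by (auto simp: w_def)
      have "dist (\<sigma> u) (\<sigma> v) \<le> dist (\<sigma> u) (\<sigma> w) + dist (\<sigma> w) (\<sigma> v)"
        by (rule dist_triangle)
      also have "\<dots> \<le> c * (\<Psi> w - \<Psi> u) + c * (\<Psi> v - \<Psi> w)"
        using Suc.prems w by (intro add_mono Suc.IH short) auto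
      finally show ?case
        by (simp add: algebra_simps)
    qed
    have "curve_length \<sigma> a b \<le> ennreal (2 * G / \<kappa> * H powr \<beta>)"
    proof (rule curve_length_leI)
      fix N p
      assume p: "\<And>i. i \<le> N \<Longrightarrow> p i \<in> {a..b}" "\<And>i. i < N \<Longrightarrow> p i \<le> p (Suc i)"
      have "(\<Sum>i<N. dist (\<sigma> (p i)) (\<sigma> (p (Suc i)))) \<le> (\<Sum>i<N. c * (\<Psi> (p (Suc i)) - \<Psi> (p i)))"
      proof (rule sum_mono)
        fix i assume i: "i \<in> {..<N}"
        obtain n where "p (Suc i) - p i \<le> real n"
          using real_arch_simple by blast
        then show "dist (\<sigma> (p i)) (\<sigma> (p (Suc i))) \<le> c * (\<Psi> (p (Suc i)) - \<Psi> (p i))"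
          using i p by (intro long) auto
      qed
      also have "\<dots> = c * (\<Psi> (p N) - \<Psi> (p 0))"
        by (simp add: sum_lessThan_telescope[of "\<lambda>i. \<Psi> (p i)"] flip: sum_distrib_left)
      also have "\<dots> \<le> c * (2 / \<kappa>)"
        using \<Psi>_bound[of "p N"] \<Psi>_bound[of "p 0"] c by (intro mult_left_mono) (auto simp: abs_le_iff)
      finally show "ennreal (\<Sum>i<N. dist (\<sigma> (p i)) (\<sigma> (p (Suc i)))) \<le> ennreal (2 * G / \<kappa> * H powr \<beta>)"
        by (intro ennreal_leI) (simp add: c_def mult_ac)
    qed
    then show "curve_length \<sigma> a b \<le> ennreal (2 * G / \<kappa> * \<delta> (\<sigma> t0) powr \<beta>)"
      by (simp add: H_def)
  qed
qed

text \<open>The estimate near the boundary needs both \<open>H\<close> and the length bound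
  \<open>T\<close> to be small. Otherwise \<open>H\<close> is bounded below by some \<eta>, and the
  straight segment bounds the Kobayashi distance by a constant.\<close>

lemma geodesic_bdist_lower_bound:
  assumes C1: "C1_boundary \<Omega>" and \<beta>: "0 < \<beta>" "\<beta> < 1 / m"
  obtains M c where "M > 0" "c > 0"
    "\<And>a b \<sigma> t0. kobayashi_geodesic \<Omega> {a..b} \<sigma> \<Longrightarrow> t0 \<in> {a..b} \<Longrightarrow> (\<And>\<tau>. \<tau> \<in> {a..b} \<Longrightarrow> \<delta> (\<sigma> \<tau>) \<le> \<delta> (\<sigma> t0)) \<Longrightarrow>
      curve_length \<sigma> a b \<le> ennreal (M * \<delta> (\<sigma> t0) powr \<beta>)"
    "\<And>a b \<sigma> t p p'. kobayashi_geodesic \<Omega> {a..b} \<sigma> \<Longrightarrow> a \<le> p \<Longrightarrow> p \<le> t \<Longrightarrow> t \<le> p' \<Longrightarrow> p' \<le> b \<Longrightarrow>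
      (\<And>\<tau>. \<tau> \<in> {a..t} \<Longrightarrow> \<delta> (\<sigma> \<tau>) \<le> \<delta> (\<sigma> p)) \<Longrightarrow> \<delta> (\<sigma> p) \<le> \<delta> (\<sigma> p') \<Longrightarrow>
      c * \<delta> (\<sigma> p) powr (4 - 3 * \<beta>) \<le> \<delta> (\<sigma> t)"
proof -
  obtain M where M: "M > 0"
    "\<And>a b \<sigma> t0. kobayashi_geodesic \<Omega> {a..b} \<sigma> \<Longrightarrow> t0 \<in> {a..b} \<Longrightarrow> (\<And>\<tau>. \<tau> \<in> {a..b} \<Longrightarrow> \<delta> (\<sigma> \<tau>) \<le> \<delta> (\<sigma> t0)) \<Longrightarrow>
      curve_length \<sigma> a b \<le> ennreal (M * \<delta> (\<sigma> t0) powr \<beta>)"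
    using geodesic_length_bound[OF \<beta>] by blast
  obtain x0 where x0: "x0 \<in> \<Omega>" "\<And>x. x \<in> \<Omega> \<Longrightarrow> \<delta> x \<le> \<delta> x0"
    using bdist_attains_sup by blast
  define B where "B = \<delta> x0"
  have B: "B > 0" "\<And>x. x \<in> \<Omega> \<Longrightarrow> \<delta> x \<le> B"
    using x0 bdist_pos by (auto simp: B_def)
  obtain r where r: "r > 0" "\<And>x y T H. x \<in> \<Omega> \<Longrightarrow> y \<in> \<Omega> \<Longrightarrow> \<delta> x < r \<Longrightarrow> 0 < H \<Longrightarrow> H \<le> \<delta> x \<Longrightarrow> H \<le> \<delta> y \<Longrightarrow>
     dist x y \<le> T \<Longrightarrow> 0 < T \<Longrightarrow> T \<le> r \<Longrightarrow> kobayashi_dist \<Omega> x y \<le> ennreal (3 * ln (1 + 2 / 3 * T / H) + 3 / 2)"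
    using kobayashi_dist_le_near_boundary[OF C1] by blast
  have "1 / m \<le> 1"
    using m by simp
  then have \<beta>1: "\<beta> < 1" using \<beta>(2) by linarith
  \<comment> \<open>As \<open>H \<le> B\<close>, the summand 1 of \<open>1 + 2 / 3 * T / H\<close>
    is at most \<open>B powr (1 - \<beta>) * H powr (\<beta> - 1)\<close>; so the whole is at most
    \<open>M' * H powr (\<beta> - 1)\<close>.\<close>
  define M' where "M' = B powr (1 - \<beta>) + 2 / 3 * M"
  have M': "M' > 0" using B(1) M(1) by (simp add: M'_def add_pos_pos)
  define \<eta> where "\<eta> = min r ((r / M) powr (1 / \<beta>))"
  have \<eta>: "\<eta> > 0" using r(1) M(1) by (simp add: \<eta>_def)
  define Z where "Z = M * B powr \<beta> / \<eta>"
  \<comment> \<open>In the second case \<open>h\<close> is at least \<open>exp (- Z) * H\<close>;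
    the factor \<open>(H / B) powr (3 - 3 * \<beta>)\<close>, which is at most 1, brings this to the
    same power of \<open>H\<close> as in the first case.\<close>
  define c1 c2 where "c1 = 1 / (exp (3 / 2) * M' ^ 3)" and "c2 = exp (- Z) / B powr (3 - 3 * \<beta>)"
  have c12: "c1 > 0" "c2 > 0"
    using M' B(1) by (auto simp: c1_def c2_def)
  show ?thesis
  proof (rule that[OF M(1) _ M(2)])
    show "min c1 c2 > 0" using c12 by simp
    fix a b \<sigma> t p p'
    assume geo: "kobayashi_geodesic \<Omega> {a..b} \<sigma>" and ord: "a \<le> p" "p \<le> t" "t \<le> p'" "p' \<le> b"
      and max: "\<And>\<tau>. \<tau> \<in> {a..t} \<Longrightarrow> \<delta> (\<sigma> \<tau>) \<le> \<delta> (\<sigma> p)" and ge: "\<delta> (\<sigma> p) \<le> \<delta> (\<sigma> p')"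
    define H h where "H = \<delta> (\<sigma> p)" and "h = \<delta> (\<sigma> t)"
    have dom: "\<sigma> \<tau> \<in> \<Omega>" if "\<tau> \<in> {a..b}" for \<tau>
      using kobayashi_geodesicD(1)[OF geo that that] .
    have H: "0 < H" "H \<le> B" and h: "0 < h"
      using ord B(2) bdist_pos dom unfolding H_def h_def by auto
    have cont: "continuous_on {t..p'} (\<lambda>\<tau>. \<delta> (\<sigma> \<tau>))"
      using continuous_on_compose2[OF continuous_on_bdist geodesic_continuous[OF geo] subset_UNIV]
      by (rule continuous_on_subset) (use ord in auto)
    \<comment> \<open>\<open>q\<close> is the first time from \<open>t\<close> on at which \<delta>
      is at least \<open>H\<close>; it exists because of \<open>p'\<close>, and continuity excludes
      a jump above \<open>H\<close>. Thus \<delta> at \<open>p\<close> is maximal on all of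
      \<open>{p..q}\<close>, as the length bound requires, and both end points have height
      \<open>H\<close>.\<close>
    obtain q where q: "t \<le> q" "q \<le> p'" "\<delta> (\<sigma> q) = H" "\<And>\<tau>. t \<le> \<tau> \<Longrightarrow> \<tau> \<le> q \<Longrightarrow> \<delta> (\<sigma> \<tau>) \<le> H"
    proof -
      define S where "S = {\<tau> \<in> {t..p'}. H \<le> \<delta> (\<sigma> \<tau>)}"
      have "S = {t..p'} \<inter> (\<lambda>\<tau>. \<delta> (\<sigma> \<tau>)) -` {H..}"
        by (auto simp: S_def)
      then have "closed S"
        using continuous_closed_preimage[OF cont] by simp
      moreover have "bounded S"
        by (rule bounded_subset[of "{t..p'}"]) (auto simp: S_def)
      ultimately have "compact S"
        by (simp add: compact_eq_bounded_closed)
      moreover have "p' \<in> S"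
        using ord ge by (auto simp: S_def H_def)
      ultimately obtain q where q: "q \<in> S" "\<And>\<tau>. \<tau> \<in> S \<Longrightarrow> q \<le> \<tau>"
        using compact_attains_inf[of S] by blast
      have lt: "\<delta> (\<sigma> \<tau>) < H" if "t \<le> \<tau>" "\<tau> < q" for \<tau>
        using q that by (force simp: S_def)
      have "\<delta> (\<sigma> q) \<le> H"
      proof (cases "q = t")
        case True
        then show ?thesis
          using max[of t] ord by (simp add: H_def)
      next
        case False
        then have tq: "t < q" using q(1) by (auto simp: S_def)
        show ?thesis
        proof (rule ccontr)
          assume "\<not> \<delta> (\<sigma> q) \<le> H"
          moreover have "\<delta> (\<sigma> t) < H" using lt[of t] tq by simp
          moreover have "continuous_on {t..q} (\<lambda>\<tau>. \<delta> (\<sigma> \<tau>))"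
            using cont by (rule continuous_on_subset) (use q(1) in \<open>auto simp: S_def\<close>)
          ultimately obtain \<tau> where "t \<le> \<tau>" "\<tau> \<le> q" "\<delta> (\<sigma> \<tau>) = H"
            using IVT'[of "\<lambda>\<tau>. \<delta> (\<sigma> \<tau>)" t H q] tq by auto
          then show False
            using lt[of \<tau>] \<open>\<not> \<delta> (\<sigma> q) \<le> H\<close> by (cases "\<tau> = q") auto
        qed
      qed
      with q(1) have "\<delta> (\<sigma> q) = H" by (simp add: S_def)
      show ?thesis
      proof (rule that[of q])
        show "\<delta> (\<sigma> \<tau>) \<le> H" if "t \<le> \<tau>" "\<tau> \<le> q" for \<tau>
          using lt[of \<tau>] that \<open>\<delta> (\<sigma> q) = H\<close> by (cases "\<tau> = q") auto
      qed (use q(1) \<open>\<delta> (\<sigma> q) = H\<close> in \<open>auto simp: S_def\<close>)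
    qed
    have mem: "p \<in> {a..b}" "q \<in> {a..b}" "t \<in> {a..b}"
      using ord q by auto
    have max': "\<delta> (\<sigma> \<tau>) \<le> \<delta> (\<sigma> p)" if "\<tau> \<in> {p..q}" for \<tau>
      using max[of \<tau>] q(4)[of \<tau>] that ord by (cases "\<tau> \<le> t") (auto simp: H_def)
    define T where "T = M * H powr \<beta>"
    have T: "T > 0" using M(1) H by (simp add: T_def)
    have "curve_length \<sigma> p q \<le> ennreal T"
      unfolding T_def H_def
      by (rule M(2)[OF kobayashi_geodesic_subinterval[OF geo] _ max']) (use ord q in auto)
    moreover have "ennreal (dist (\<sigma> p) (\<sigma> q)) \<le> curve_length \<sigma> p q"
      using curve_length_geI[of 1 "\<lambda>i. if i = 0 then p else q" p q \<sigma>] ord q by auto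
    ultimately have "ennreal (dist (\<sigma> p) (\<sigma> q)) \<le> ennreal T"
      by (rule order_trans[rotated])
    then have pq: "dist (\<sigma> p) (\<sigma> q) \<le> T"
      using T by (simp add: ennreal_le_iff)
    \<comment> \<open>Descending from height \<open>H\<close> to \<open>h\<close> and climbing back
      each cost half the logarithm, and the two times add up to \<open>q - p\<close>.\<close>
    have low: "ln (H / h) \<le> \<bar>q - p\<bar>"
    proof -
      have "ln (H / h) / 2 \<le> \<bar>t - p\<bar>"
        using geodesic_log_bdist[OF geo mem(1,3)] by (simp add: H_def h_def)
      moreover have "ln (H / h) / 2 \<le> \<bar>t - q\<bar>"
        using geodesic_log_bdist[OF geo mem(2,3)] by (simp add: q(3) h_def)
      ultimately show ?thesis
        using ord q by simp
    qed
    have pow: "H powr (4 - 3 * \<beta>) = H * H powr (3 - 3 * \<beta>)"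
      using H(1) powr_add[of H 1 "3 - 3 * \<beta>"] by simp
    have pow_pos: "H powr (4 - 3 * \<beta>) \<ge> 0" by simp
    have "c1 * H powr (4 - 3 * \<beta>) \<le> h \<or> c2 * H powr (4 - 3 * \<beta>) \<le> h"
    proof (cases "T \<le> r \<and> H < r")
      case True
      define X where "X = 1 + 2 / 3 * T / H"
      have X: "X \<ge> 1" using T H by (simp add: X_def)
      have "\<bar>q - p\<bar> \<le> 3 * ln X + 3 / 2"
      proof (rule kobayashi_geodesic_dist_le[OF geo mem(1,2)])
        show "kobayashi_dist \<Omega> (\<sigma> p) (\<sigma> q) \<le> ennreal (3 * ln X + 3 / 2)"
          unfolding X_def using True pq T H by (intro r(2) dom mem) (auto simp: q(3) H_def[symmetric])
        show "0 \<le> 3 * ln X + 3 / 2" using X by simp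
      qed
      with low have "ln (H / h) \<le> 3 * ln X + 3 / 2" by linarith
      then have "exp (ln (H / h)) \<le> exp (3 * ln X + 3 / 2)" by simp
      also have "exp (3 * ln X + 3 / 2) = X ^ 3 * exp (3 / 2)"
        using X by (simp add: exp_add mult.commute[of 3] exp_of_nat2_mult[of "ln X" 3, simplified])
      finally have 1: "H / h \<le> X ^ 3 * exp (3 / 2)"
        using H h by simp
      have Hb: "H powr \<beta> = H * H powr (\<beta> - 1)"
        using H(1) powr_add[of H 1 "\<beta> - 1"] by simp
      have "X \<le> M' * H powr (\<beta> - 1)"
      proof -
        have "1 = H powr (1 - \<beta>) * H powr (\<beta> - 1)"
          using H(1) by (simp flip: powr_add)
        also have "\<dots> \<le> B powr (1 - \<beta>) * H powr (\<beta> - 1)"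
          using H \<beta>1 by (intro mult_right_mono powr_mono2) auto
        finally show ?thesis
          using H(1) by (simp add: X_def T_def M'_def Hb algebra_simps)
      qed
      then have "X ^ 3 \<le> (M' * H powr (\<beta> - 1)) ^ 3"
        using X by (intro power_mono) auto
      also have "\<dots> = M' ^ 3 * H powr (3 * \<beta> - 3)"
        using H(1) by (simp add: power_mult_distrib powr_power algebra_simps)
      finally have "H / h \<le> M' ^ 3 * H powr (3 * \<beta> - 3) * exp (3 / 2)"
        using 1 by (meson exp_ge_zero mult_right_mono order_trans)
      then have "H \<le> M' ^ 3 * H powr (3 * \<beta> - 3) * exp (3 / 2) * h"
        using h by (simp add: divide_le_eq)
      then have "H * H powr (3 - 3 * \<beta>) \<le> M' ^ 3 * H powr (3 * \<beta> - 3) * exp (3 / 2) * h * H powr (3 - 3 * \<beta>)"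
        by (rule mult_right_mono) simp
      also have "\<dots> = M' ^ 3 * exp (3 / 2) * h * (H powr (3 * \<beta> - 3) * H powr (3 - 3 * \<beta>))"
        by (simp add: mult_ac)
      also have "H powr (3 * \<beta> - 3) * H powr (3 - 3 * \<beta>) = 1"
        using H(1) by (simp flip: powr_add)
      finally have "c1 * H powr (4 - 3 * \<beta>) \<le> h"
        unfolding pow c1_def using M' by (simp add: divide_le_eq mult_ac)
      then show ?thesis ..
    next
      case False
      have \<eta>H: "\<eta> \<le> H"
      proof (cases "H < r")
        case True
        then have "r < M * H powr \<beta>" using False by (simp add: T_def)
        then have "r / M < H powr \<beta>"
          using M(1) by (simp add: divide_less_eq mult.commute)
        then have "(r / M) powr (1 / \<beta>) \<le> (H powr \<beta>) powr (1 / \<beta>)"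
          using r(1) M(1) \<beta>(1) by (intro powr_mono2) auto
        also have "\<dots> = H"
          using H(1) \<beta>(1) by (simp add: powr_powr)
        finally show ?thesis by (simp add: \<eta>_def)
      qed (simp add: \<eta>_def)
      have TB: "T \<le> M * B powr \<beta>"
        unfolding T_def using H M(1) \<beta>(1) by (intro mult_left_mono powr_mono2) auto
      have Z0: "0 \<le> Z" using M(1) \<eta> by (simp add: Z_def)
      have "\<bar>q - p\<bar> \<le> Z"
      proof (rule kobayashi_geodesic_dist_le[OF geo mem(1,2) _ Z0])
        show "kobayashi_dist \<Omega> (\<sigma> p) (\<sigma> q) \<le> ennreal Z"
          unfolding Z_def using \<eta> \<eta>H pq TB
          by (intro kobayashi_dist_le_away_from_boundary dom mem) (auto simp: q(3) H_def[symmetric])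
      qed
      with low have "ln (H / h) \<le> Z" by linarith
      then have "exp (ln (H / h)) \<le> exp Z" by simp
      then have "H / h \<le> exp Z" using H h by simp
      then have "exp (- Z) * H \<le> h"
        using h by (simp add: divide_le_eq exp_minus field_simps)
      moreover have "H powr (3 - 3 * \<beta>) \<le> B powr (3 - 3 * \<beta>)"
        using H \<beta>1 by (intro powr_mono2) auto
      then have "H powr (3 - 3 * \<beta>) / B powr (3 - 3 * \<beta>) \<le> 1"
        using B(1) by simp
      then have "exp (- Z) * H * (H powr (3 - 3 * \<beta>) / B powr (3 - 3 * \<beta>)) \<le> exp (- Z) * H * 1"
        using H by (intro mult_left_mono) auto
      ultimately have "c2 * H powr (4 - 3 * \<beta>) \<le> h"
        unfolding pow c2_def by (simp add: mult_ac)
      then show ?thesis ..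
    qed
    moreover have "min c1 c2 * H powr (4 - 3 * \<beta>) \<le> c1 * H powr (4 - 3 * \<beta>)" "min c1 c2 * H powr (4 - 3 * \<beta>) \<le> c2 * H powr (4 - 3 * \<beta>)"
      by (auto intro: mult_right_mono)
    ultimately have "min c1 c2 * H powr (4 - 3 * \<beta>) \<le> h" by linarith
    then show "min c1 c2 * \<delta> (\<sigma> p) powr (4 - 3 * \<beta>) \<le> \<delta> (\<sigma> t)"
      by (simp add: H_def h_def)
  qed
qed

lemma geodesic_bdist_ge_length_powr:
  assumes C1: "C1_boundary \<Omega>" and \<alpha>: "\<alpha> > 4 * m - 3"
  obtains K where "K > 0" "\<And>a b \<sigma> t. kobayashi_geodesic \<Omega> {a..b} \<sigma> \<Longrightarrow> t \<in> {a..b} \<Longrightarrow>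
     ennreal K * ennreal_powr (min (curve_length \<sigma> a t) (curve_length \<sigma> t b)) \<alpha> \<le> ennreal (\<delta> (\<sigma> t))"
proof -
  \<comment> \<open>The solution of \<open>\<beta> * \<alpha> = 4 - 3 * \<beta>\<close>, which
    matches the power of \<open>H\<close> in the length bound with that in the depth bound. The
    assumption on \<alpha> says precisely that \<beta> < 1 / m.\<close>
  define \<beta> where "\<beta> = 4 / (\<alpha> + 3)"
  have \<alpha>0: "\<alpha> > 0" using \<alpha> m by linarith
  have \<beta>: "0 < \<beta>" "\<beta> < 1 / m" "\<beta> * \<alpha> = 4 - 3 * \<beta>"
    using \<alpha> \<alpha>0 m by (auto simp: \<beta>_def field_simps)
  obtain M c where M: "M > 0" "c > 0"
    "\<And>a b \<sigma> t0. kobayashi_geodesic \<Omega> {a..b} \<sigma> \<Longrightarrow> t0 \<in> {a..b} \<Longrightarrow> (\<And>\<tau>. \<tau> \<in> {a..b} \<Longrightarrow> \<delta> (\<sigma> \<tau>) \<le> \<delta> (\<sigma> t0)) \<Longrightarrow>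
      curve_length \<sigma> a b \<le> ennreal (M * \<delta> (\<sigma> t0) powr \<beta>)"
    "\<And>a b \<sigma> t p p'. kobayashi_geodesic \<Omega> {a..b} \<sigma> \<Longrightarrow> a \<le> p \<Longrightarrow> p \<le> t \<Longrightarrow> t \<le> p' \<Longrightarrow> p' \<le> b \<Longrightarrow>
      (\<And>\<tau>. \<tau> \<in> {a..t} \<Longrightarrow> \<delta> (\<sigma> \<tau>) \<le> \<delta> (\<sigma> p)) \<Longrightarrow> \<delta> (\<sigma> p) \<le> \<delta> (\<sigma> p') \<Longrightarrow>
      c * \<delta> (\<sigma> p) powr (4 - 3 * \<beta>) \<le> \<delta> (\<sigma> t)"
    using geodesic_bdist_lower_bound[OF C1 \<beta>(1,2)] by blast
  define K where "K = c / M powr \<alpha>"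
  have K: "K > 0" using M by (simp add: K_def)
  show ?thesis
  proof (rule that[OF K])
    fix a b \<sigma> t
    assume geo: "kobayashi_geodesic \<Omega> {a..b} \<sigma>" and t: "t \<in> {a..b}"
    obtain p where p: "p \<in> {a..t}" "\<And>\<tau>. \<tau> \<in> {a..t} \<Longrightarrow> \<delta> (\<sigma> \<tau>) \<le> \<delta> (\<sigma> p)"
      using geodesic_bdist_attains_sup[OF geo, of a t] t by auto
    obtain p' where p': "p' \<in> {t..b}" "\<And>\<tau>. \<tau> \<in> {t..b} \<Longrightarrow> \<delta> (\<sigma> \<tau>) \<le> \<delta> (\<sigma> p')"
      using geodesic_bdist_attains_sup[OF geo, of t b] t by auto
    have len: "curve_length \<sigma> a t \<le> ennreal (M * \<delta> (\<sigma> p) powr \<beta>)" "curve_length \<sigma> t b \<le> ennreal (M * \<delta> (\<sigma> p') powr \<beta>)"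
      using t by (auto intro!: M(3)[OF kobayashi_geodesic_subinterval[OF geo]] p p')
    \<comment> \<open>\<open>H\<close> is the smaller of the two maxima of \<open>\<delta>\<close> on either side of \<open>t\<close>\<close>
    have "\<exists>H. min (curve_length \<sigma> a t) (curve_length \<sigma> t b) \<le> ennreal (M * H powr \<beta>) \<and> 0 \<le> H \<and>
        c * H powr (4 - 3 * \<beta>) \<le> \<delta> (\<sigma> t)"
    proof (cases "\<delta> (\<sigma> p) \<le> \<delta> (\<sigma> p')")
      case True
      show ?thesis
      proof (intro exI[of _ "\<delta> (\<sigma> p)"] conjI)
        show "c * \<delta> (\<sigma> p) powr (4 - 3 * \<beta>) \<le> \<delta> (\<sigma> t)"
          by (rule M(4)[OF geo _ _ _ _ p(2) True]) (use p(1) p'(1) in auto)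
      qed (use len(1) in \<open>auto simp: bdist_def infdist_nonneg intro: min.coboundedI1\<close>)
    next
      case False
      show ?thesis
      proof (intro exI[of _ "\<delta> (\<sigma> p')"] conjI)
        \<comment> \<open>The depth bound wants the smaller maximum on the left of \<open>t\<close>;
          running the geodesic backwards exchanges the two sides.\<close>
        have "c * \<delta> (\<sigma> (- (- p'))) powr (4 - 3 * \<beta>) \<le> \<delta> (\<sigma> (- (- t)))"
          by (rule M(4)[OF kobayashi_geodesic_reverse[OF geo], of "- p'" "- t" "- p"]) (use p(1) p' False in auto)
        then show "c * \<delta> (\<sigma> p') powr (4 - 3 * \<beta>) \<le> \<delta> (\<sigma> t)"
          by simp
      qed (use len(2) in \<open>auto simp: bdist_def infdist_nonneg intro: min.coboundedI2\<close>)
    qed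
    then obtain H where H: "min (curve_length \<sigma> a t) (curve_length \<sigma> t b) \<le> ennreal (M * H powr \<beta>)" "0 \<le> H"
      "c * H powr (4 - 3 * \<beta>) \<le> \<delta> (\<sigma> t)"
      by blast
    have "ennreal_powr (min (curve_length \<sigma> a t) (curve_length \<sigma> t b)) \<alpha> \<le> ennreal ((M * H powr \<beta>) powr \<alpha>)"
      using M(1) \<alpha>0 by (intro ennreal_powr_mono H(1)) auto
    then have "ennreal K * ennreal_powr (min (curve_length \<sigma> a t) (curve_length \<sigma> t b)) \<alpha> \<le>
        ennreal K * ennreal ((M * H powr \<beta>) powr \<alpha>)"
      by (rule mult_left_mono) simp
    also have "\<dots> = ennreal (K * (M * H powr \<beta>) powr \<alpha>)"
      using K by (simp add: ennreal_mult)
    also have "K * (M * H powr \<beta>) powr \<alpha> = c * H powr (4 - 3 * \<beta>)"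
      using M(1) by (simp add: K_def powr_mult powr_powr \<beta>(3))
    also have "ennreal \<dots> \<le> ennreal (\<delta> (\<sigma> t))"
      by (rule ennreal_leI[OF H(3)])
    finally show "ennreal K * ennreal_powr (min (curve_length \<sigma> a t) (curve_length \<sigma> t b)) \<alpha> \<le> ennreal (\<delta> (\<sigma> t))" .
  qed
qed

end

theorem lemma1p5:
  fixes \<Omega> :: "(complex ^ 'n) set" and m \<alpha> :: real
  assumes "CARD('n) \<ge> 2"
    and "m \<ge> 1"
    and "m_convex m \<Omega>"
    and "Dini_smooth_boundary \<Omega>"
    and "\<alpha> > 3 * m^2 - 2 * m"
  shows "\<exists>C>0. \<forall>x\<in>\<Omega>. \<forall>y\<in>\<Omega>. \<forall>a b \<sigma>.
           a \<le> b \<and> kobayashi_geodesic \<Omega> {a..b} \<sigma> \<and> \<sigma> a = x \<and> \<sigma> b = y \<longrightarrow>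
           (\<forall>t\<in>{a..b}. ennreal (bdist \<Omega> (\<sigma> t)) \<ge>
              ennreal C * ennreal_powr (min (curve_length \<sigma> a t) (curve_length \<sigma> t b)) \<alpha>)"
proof -
  obtain C where "C > 0" "\<And>z v. z \<in> \<Omega> \<Longrightarrow> v \<noteq> 0 \<Longrightarrow> bdist_dir \<Omega> z v \<le> C * bdist \<Omega> z powr (1 / m)"
    using assms(3) unfolding m_convex_def by blast
  then interpret m_convex_domain \<Omega> m C
    using assms(2,3) by unfold_locales (auto simp: m_convex_def)
  have "C1_boundary \<Omega>"
    using assms(4) by (simp add: Dini_smooth_boundary_def)
  moreover have "\<alpha> > 4 * m - 3"
  proof -
    have "3 * m^2 - 2 * m - (4 * m - 3) = 3 * (m - 1)^2"
      by (simp add: power2_eq_square algebra_simps)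
    also have "\<dots> \<ge> 0" by simp
    finally show ?thesis using assms(5) by linarith
  qed
  ultimately obtain K where "K > 0" "\<And>a b \<sigma> t. kobayashi_geodesic \<Omega> {a..b} \<sigma> \<Longrightarrow> t \<in> {a..b} \<Longrightarrow>
     ennreal K * ennreal_powr (min (curve_length \<sigma> a t) (curve_length \<sigma> t b)) \<alpha> \<le> ennreal (bdist \<Omega> (\<sigma> t))"
    using geodesic_bdist_ge_length_powr by blast
  then show ?thesis
    by blast
qed

end
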